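(* Let $h_1,h_2,c_1,c_2\in\mathbb C$. The Verma module $M_{\mathfrak g}(h_1,h_2,c_1,c_2)$ over the N=1 BMS superalgebra $\mathfrak g$ is simple if and only if $$h_2+\frac{i^2-1}{24}c_2\neq0\qquad\text{for all } i\in\mathbb Z_+ .$$
   Context: $\mathbb Z_+$ denotes positive integers, $\mathbb N$ nonnegative integers. The N=1 BMS superalgebra $\mathfrak g$ is the complex Lie superalgebra with even basis $L_n,M_n$ ($n\in\mathbb Z$), $\mathbf c_1,\mathbf c_2$, odd basis $Q_r$ ($r\in\mathbb Z+\frac12$), and brackets $[L_m,L_n]=(m-n)L_{m+n}+\frac1{12}\delta_{m+n,0}(m^3-m)\mathbf c_1$, $[L_m,M_n]=(m-n)M_{m+n}+\frac1{12}\delta_{m+n,0}(m^3-m)\mathbf c_2$, $[Q_r,Q_s]=2M_{r+s}+\frac13\delta_{r+s,0}(r^2-\frac14)\mathbf c_2$, $[L_m,Q_r]=(\frac m2-r)Q_{m+r}$, $[M_m,M_n]=[M_n,Q_r]=0$, with $\mathbf c_1,\mathbf c_2$ central. Let $\mathfrak g_+$ be the span of $L_n,M_n$ ($n\in\mathbb Z_+$) and $Q_r$ ($r\in\mathbb N+\frac12$), and $\mathfrak g_0=\mathrm{span}(L_0,M_0,\mathbf c_1,\mathbf c_2)$. The Verma module is $M_{\mathfrak g}(h_1,h_2,c_1,c_2)=U(\mathfrak g)\otimes_{U(\mathfrak g_0\oplus\mathfrak g_+)}\mathbb C$, where on the one-dimensional module $\mathbb C$ the elements $L_0,M_0,\mathbf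 c_1,\mathbf c_2$ act as the scalars $h_1,h_2,c_1,c_2$ and $\mathfrak g_+$ acts as $0$. *)

theory Defs
  imports Complex_Main "HOL-Library.Poly_Mapping" "HOL-Algebra.Free_Abelian_Groups"
begin

section \<open>Complex Lie superalgebras\<close>

class complex_space = ab_group_add +
  fixes scaleC :: "complex \<Rightarrow> 'a \<Rightarrow> 'a" (infixr \<open>*\<^sub>C\<close> 75)
  assumes scaleC_add_right: "c *\<^sub>C (x + y) = c *\<^sub>C x + c *\<^sub>C y"
    and scaleC_add_left: "(c + d) *\<^sub>C x = c *\<^sub>C x + d *\<^sub>C x"
    and scaleC_scaleC: "c *\<^sub>C d *\<^sub>C x = (c * d) *\<^sub>C x"
    and scaleC_one: "1 *\<^sub>C x = x"

class complex_algebra = complex_space + ring_1 +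
  assumes scaleC_mult_left: "(c *\<^sub>C x) * y = c *\<^sub>C (x * y)"
    and scaleC_mult_right: "x * (c *\<^sub>C y) = c *\<^sub>C (x * y)"

instantiation complex :: complex_algebra
begin

definition scaleC_complex :: "complex \<Rightarrow> complex \<Rightarrow> complex"
  where "scaleC_complex c x = c * x"

instance
  by standard (simp_all add: scaleC_complex_def algebra_simps)

end

text \<open>Parities are Booleans: \<open>False\<close> is even and \<open>True\<close> is odd, so that parities
  add by \<open>\<noteq>\<close>, and \<open>koszul p q\<close> is \<open>(-1)\<close> to the power \<open>p q\<close>.\<close>

definition koszul :: "bool \<Rightarrow> bool \<Rightarrow> complex"
  where "koszul p q = (if p \<and> q then - 1 else 1)"

class lie_superalgebra = complex_space +
  fixes parity_part :: "bool \<Rightarrow> 'a set"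
    and lie_bracket :: "'a \<Rightarrow> 'a \<Rightarrow> 'a"
  assumes parity_part_zero: "0 \<in> parity_part p"
    and parity_part_add: "x \<in> parity_part p \<Longrightarrow> y \<in> parity_part p \<Longrightarrow> x + y \<in> parity_part p"
    and parity_part_scale: "x \<in> parity_part p \<Longrightarrow> c *\<^sub>C x \<in> parity_part p"
    and parity_part_Int: "parity_part False \<inter> parity_part True = {0}"
    and parity_part_decomp: "\<exists>y \<in> parity_part False. \<exists>z \<in> parity_part True. x = y + z"
    and bracket_add_left: "lie_bracket (x + y) z = lie_bracket x z + lie_bracket y z"
    and bracket_add_right: "lie_bracket x (y + z) = lie_bracket x y + lie_bracket x z"
    and bracket_scale_left: "lie_bracket (c *\<^sub>C x) y = c *\<^sub>C lie_bracket x y"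
    and bracket_scale_right: "lie_bracket x (c *\<^sub>C y) = c *\<^sub>C lie_bracket x y"
    and bracket_parity: "x \<in> parity_part p \<Longrightarrow> y \<in> parity_part q
      \<Longrightarrow> lie_bracket x y \<in> parity_part (p \<noteq> q)"
    and bracket_skew: "x \<in> parity_part p \<Longrightarrow> y \<in> parity_part q
      \<Longrightarrow> lie_bracket x y = - (koszul p q *\<^sub>C lie_bracket y x)"
    and bracket_jacobi: "x \<in> parity_part p \<Longrightarrow> y \<in> parity_part q \<Longrightarrow> z \<in> parity_part s
      \<Longrightarrow> lie_bracket x (lie_bracket y z)
          = lie_bracket (lie_bracket x y) z + koszul p q *\<^sub>C lie_bracket y (lie_bracket x z)"


section \<open>Universal enveloping algebras\<close>

text \<open>With lists as a monoid under concatenation, the convolution ring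
  \<open>'a list \<Rightarrow>\<^sub>0 complex\<close> is the free unital associative complex algebra on the
  symbols \<open>x :: 'a\<close>; the scalar \<open>c\<close> is \<open>single [] c\<close>.\<close>

instantiation list :: (type) monoid_add
begin

definition zero_list :: "'a list" where "zero_list = []"
definition plus_list :: "'a list \<Rightarrow> 'a list \<Rightarrow> 'a list" where "plus_list = (@)"

instance
  by standard (simp_all add: zero_list_def plus_list_def)

end

text \<open>The quotient of the free algebra by the first two families of relators is the tensor
  algebra of \<open>'a\<close>, in which the third family imposes
  \<open>x y - (-1)^(p q) y x = [x, y]\<close>.\<close>

inductive_set uea_ideal :: "('a::lie_superalgebra list \<Rightarrow>\<^sub>0 complex) set" where
  additive: "Poly_Mapping.single [x + y] 1 - Poly_Mapping.single [x] 1 - Poly_Mapping.single [y] 1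
    \<in> uea_ideal"
| homogeneous: "Poly_Mapping.single [c *\<^sub>C x] 1 - Poly_Mapping.single [x] c \<in> uea_ideal"
| supercommutator: "x \<in> parity_part p \<Longrightarrow> y \<in> parity_part q \<Longrightarrow>
    Poly_Mapping.single [x, y] 1 - Poly_Mapping.single [y, x] (koszul p q)
      - Poly_Mapping.single [lie_bracket x y] 1 \<in> uea_ideal"
| zero: "0 \<in> uea_ideal"
| add: "s \<in> uea_ideal \<Longrightarrow> t \<in> uea_ideal \<Longrightarrow> s + t \<in> uea_ideal"
| mult: "t \<in> uea_ideal \<Longrightarrow> a * t * b \<in> uea_ideal"

lemma uea_ideal_mult_left: "t \<in> uea_ideal \<Longrightarrow> a * t \<in> uea_ideal"
  using uea_ideal.mult[of t a 1] by simp

lemma uea_ideal_mult_right: "t \<in> uea_ideal \<Longrightarrow> t * b \<in> uea_ideal"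
  using uea_ideal.mult[of t 1 b] by simp

lemma uea_ideal_uminus: "t \<in> uea_ideal \<Longrightarrow> - t \<in> uea_ideal"
  using uea_ideal.mult[of t "- 1" 1] by simp

lemma lookup_mult_Nil:
  "Poly_Mapping.lookup (s * t) [] = Poly_Mapping.lookup s [] * Poly_Mapping.lookup t []"
  for s t :: "'a list \<Rightarrow>\<^sub>0 complex"
proof -
  have eq: "Sum_any (\<lambda>r. Poly_Mapping.lookup t r when [] = q + r) =
      (Poly_Mapping.lookup t [] when q = [])" for q :: "'a list"
    by (cases "q = []") (simp_all add: plus_list_def when_def)
  show ?thesis
    by (simp add: lookup_mult eq mult_when)
qed

lemma uea_ideal_lookup_Nil: "t \<in> uea_ideal \<Longrightarrow> Poly_Mapping.lookup t [] = 0"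
  by (induction rule: uea_ideal.induct)
    (simp_all add: lookup_minus lookup_add lookup_single lookup_mult_Nil)

lemma single_Nil_one: "Poly_Mapping.single [] 1 = (1 :: 'a list \<Rightarrow>\<^sub>0 complex)"
  by (metis single_one zero_list_def)

lemma scalar_central:
  "Poly_Mapping.single [] c * t = t * Poly_Mapping.single [] c"
  for c :: complex and t :: "'a list \<Rightarrow>\<^sub>0 complex"
proof (rule poly_mapping_eqI)
  fix k :: "'a list"
  have 1: "Sum_any (\<lambda>r. Poly_Mapping.lookup t r when k = [] + r) = Poly_Mapping.lookup t k"
    by (simp add: plus_list_def)
  have 2: "Sum_any (\<lambda>r. Poly_Mapping.lookup (Poly_Mapping.single [] c) r when k = q + r)
      = (c when q = k)" for q :: "'a list"
  proof -
    have "(Poly_Mapping.lookup (Poly_Mapping.single [] c) r when k = q + r)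
        = ((c when q = k) when r = [])" for r :: "'a list"
      by (auto simp: lookup_single when_def plus_list_def)
    then show ?thesis by simp
  qed
  have 3: "Poly_Mapping.lookup (Poly_Mapping.single [] c) q * x = (c * x when q = [])"
    for q :: "'a list" and x
    by (auto simp: lookup_single when_def)
  show "Poly_Mapping.lookup (Poly_Mapping.single [] c * t) k
      = Poly_Mapping.lookup (t * Poly_Mapping.single [] c) k"
    unfolding lookup_mult 2 3 by (simp add: 1 mult_when)
qed

lemma scalar_left_commute:
  "s * (Poly_Mapping.single [] c * t) = Poly_Mapping.single [] c * (s * t)"
  for c :: complex and s t :: "'a list \<Rightarrow>\<^sub>0 complex"
  by (metis mult.assoc scalar_central)

definition uea_rel :: "('a::lie_superalgebra list \<Rightarrow>\<^sub>0 complex) \<Rightarrow> ('a list \<Rightarrow>\<^sub>0 complex) \<Rightarrow> bool"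
  where "uea_rel s t \<longleftrightarrow> s - t \<in> uea_ideal"

quotient_type (overloaded) 'a uea = "'a::lie_superalgebra list \<Rightarrow>\<^sub>0 complex" / uea_rel
proof (rule equivpI)
  show "reflp uea_rel"
    by (simp add: reflp_def uea_rel_def uea_ideal.zero)
  show "symp uea_rel"
    unfolding symp_def uea_rel_def using uea_ideal_uminus by (metis minus_diff_eq)
  show "transp uea_rel"
    unfolding transp_def uea_rel_def
    by (metis (no_types, opaque_lifting) uea_ideal.add diff_add_cancel add_diff_eq)
qed

instantiation uea :: (lie_superalgebra) complex_algebra
begin

lift_definition zero_uea :: "'a uea" is 0 .
lift_definition one_uea :: "'a uea" is 1 .

lift_definition plus_uea :: "'a uea \<Rightarrow> 'a uea \<Rightarrow> 'a uea" is "(+)"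
  unfolding uea_rel_def by (metis add_diff_add uea_ideal.add)

lift_definition uminus_uea :: "'a uea \<Rightarrow> 'a uea" is uminus
  unfolding uea_rel_def by (metis minus_diff_minus uea_ideal_uminus)

lift_definition minus_uea :: "'a uea \<Rightarrow> 'a uea \<Rightarrow> 'a uea" is "(-)"
  unfolding uea_rel_def
  by (metis (no_types, opaque_lifting) add_diff_add diff_conv_add_uminus
      minus_diff_minus uea_ideal.add uea_ideal_uminus)

lift_definition times_uea :: "'a uea \<Rightarrow> 'a uea \<Rightarrow> 'a uea" is "(*)"
proof -
  fix s s' t t' :: "'a list \<Rightarrow>\<^sub>0 complex"
  assume "uea_rel s s'" "uea_rel t t'"
  moreover have "s * t - s' * t' = s * (t - t') + (s - s') * t'"
    by (simp add: algebra_simps)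
  ultimately show "uea_rel (s * t) (s' * t')"
    by (simp add: uea_rel_def uea_ideal.add uea_ideal_mult_left uea_ideal_mult_right)
qed

lift_definition scaleC_uea :: "complex \<Rightarrow> 'a uea \<Rightarrow> 'a uea"
  is "\<lambda>c t. Poly_Mapping.single [] c * t"
  unfolding uea_rel_def by (metis right_diff_distrib uea_ideal_mult_left)

instance
proof
  fix a b x y z :: "'a uea" and c d :: complex
  show "a + b + x = a + (b + x)" "a + b = b + a" "0 + a = a" "- a + a = 0" "a - b = a + - b"
    "a * b * x = a * (b * x)" "1 * a = a" "a * 1 = a"
    "(a + b) * x = a * x + b * x" "a * (b + x) = a * b + a * x"
    by (transfer, simp add: algebra_simps uea_rel_def uea_ideal.zero)+
  show "(0 :: 'a uea) \<noteq> 1"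
  proof (transfer, rule notI)
    assume "uea_rel (0 :: 'a list \<Rightarrow>\<^sub>0 complex) 1"
    then have "Poly_Mapping.lookup (0 - 1 :: 'a list \<Rightarrow>\<^sub>0 complex) [] = 0"
      unfolding uea_rel_def by (rule uea_ideal_lookup_Nil)
    then show False
      by (simp add: lookup_minus lookup_one zero_list_def)
  qed
  show "c *\<^sub>C (x + y) = c *\<^sub>C x + c *\<^sub>C y" "(c + d) *\<^sub>C x = c *\<^sub>C x + d *\<^sub>C x"
    by (transfer, simp add: algebra_simps uea_rel_def uea_ideal.zero single_add)+
  show "c *\<^sub>C d *\<^sub>C x = (c * d) *\<^sub>C x"
    by transfer (simp add: uea_rel_def uea_ideal.zero mult_single plus_list_def mult.assoc[symmetric])
  show "1 *\<^sub>C x = x"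
    by transfer (simp add: uea_rel_def uea_ideal.zero single_Nil_one)
  show "(c *\<^sub>C x) * y = c *\<^sub>C (x * y)"
    by transfer (simp add: uea_rel_def uea_ideal.zero mult.assoc)
  show "x * (c *\<^sub>C y) = c *\<^sub>C (x * y)"
    by transfer (simp add: uea_rel_def uea_ideal.zero scalar_left_commute)
qed

end

definition uea_of :: "'a::lie_superalgebra \<Rightarrow> 'a uea"
  where "uea_of x = abs_uea (Poly_Mapping.single [x] 1)"

lemma uea_of_add: "uea_of (x + y) = uea_of x + uea_of y"
  unfolding uea_of_def plus_uea.abs_eq uea.abs_eq_iff uea_rel_def
  using uea_ideal.additive[of x y] by (simp add: algebra_simps)

lemma uea_of_scale: "uea_of (c *\<^sub>C x) = c *\<^sub>C uea_of x"
  unfolding uea_of_def scaleC_uea.abs_eq uea.abs_eq_iff uea_rel_def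
  using uea_ideal.homogeneous[of c x] by (simp add: mult_single plus_list_def)

lemma uea_of_bracket:
  assumes "x \<in> parity_part p" "y \<in> parity_part q"
  shows "uea_of x * uea_of y - koszul p q *\<^sub>C (uea_of y * uea_of x) = uea_of (lie_bracket x y)"
  unfolding uea_of_def scaleC_uea.abs_eq times_uea.abs_eq minus_uea.abs_eq uea.abs_eq_iff uea_rel_def
  using uea_ideal.supercommutator[OF assms] by (simp add: mult_single plus_list_def)

text \<open>Evaluation of a noncommutative polynomial, and the extension of a map
  \<open>f :: 'a \<Rightarrow> 'r\<close> to the enveloping algebra of \<open>'a\<close>. The latter is independent of the chosen
  representative, and is an algebra homomorphism extending \<open>f\<close>, whenever \<open>f\<close> is a
  \<open>super_representation\<close>; see \<open>uea_lift_abs\<close> and the lemmas following it.\<close>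

definition free_eval :: "('a \<Rightarrow> 'r::complex_algebra) \<Rightarrow> ('a list \<Rightarrow>\<^sub>0 complex) \<Rightarrow> 'r"
  where "free_eval f t =
    (\<Sum>w \<in> Poly_Mapping.keys t. Poly_Mapping.lookup t w *\<^sub>C prod_list (map f w))"

definition uea_lift :: "('a::lie_superalgebra \<Rightarrow> 'r::complex_algebra) \<Rightarrow> 'a uea \<Rightarrow> 'r"
  where "uea_lift f u = free_eval f (rep_uea u)"

definition super_representation :: "('a::lie_superalgebra \<Rightarrow> 'r::complex_algebra) \<Rightarrow> bool"
  where "super_representation f \<longleftrightarrow>
    (\<forall>x y. f (x + y) = f x + f y) \<and> (\<forall>c x. f (c *\<^sub>C x) = c *\<^sub>C f x) \<and>
    (\<forall>p q. \<forall>x \<in> parity_part p. \<forall>y \<in> parity_part q.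
      f x * f y - koszul p q *\<^sub>C (f y * f x) = f (lie_bracket x y))"

lemma super_representation_uea_of: "super_representation uea_of"
  by (simp add: super_representation_def uea_of_add uea_of_scale uea_of_bracket)

lemma scaleC_zero_left [simp]: "0 *\<^sub>C x = (0 :: 'a::complex_space)"
  using scaleC_add_left[of 0 0 x] by simp

lemma scaleC_zero_right [simp]: "c *\<^sub>C (0 :: 'a::complex_space) = 0"
  using scaleC_add_right[of c 0 0] by simp

lemma scaleC_uminus_left: "(- c) *\<^sub>C x = - (c *\<^sub>C (x :: 'a::complex_space))"
  using scaleC_add_left[of "- c" c x] by (simp add: eq_neg_iff_add_eq_0)

lemma scaleC_uminus_right: "c *\<^sub>C (- x) = - (c *\<^sub>C (x :: 'a::complex_space))"
  using scaleC_add_right[of c "- x" x] by (simp add: eq_neg_iff_add_eq_0)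

lemma free_eval_superset:
  assumes "finite A" "Poly_Mapping.keys t \<subseteq> A"
  shows "free_eval f t = (\<Sum>w \<in> A. Poly_Mapping.lookup t w *\<^sub>C prod_list (map f w))"
  unfolding free_eval_def using assms
  by (intro sum.mono_neutral_left) (auto simp: in_keys_iff)

lemma free_eval_add: "free_eval f (s + t) = free_eval f s + free_eval f t"
proof -
  let ?A = "Poly_Mapping.keys s \<union> Poly_Mapping.keys t"
  have "Poly_Mapping.keys (s + t) \<subseteq> ?A"
    by (rule keys_add)
  then show ?thesis
    by (simp add: free_eval_superset[where A = ?A] lookup_add scaleC_add_left sum.distrib)
qed

lemma free_eval_single: "free_eval f (Poly_Mapping.single w c) = c *\<^sub>C prod_list (map f w)"
  by (simp add: free_eval_def)

lemma free_eval_zero: "free_eval f 0 = 0"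
  by (simp add: free_eval_def)

lemma free_eval_uminus: "free_eval f (- t) = - free_eval f t"
  using free_eval_add[of f "- t" t] by (simp add: free_eval_zero eq_neg_iff_add_eq_0)

lemma free_eval_diff: "free_eval f (s - t) = free_eval f s - free_eval f t"
  by (metis free_eval_add free_eval_uminus diff_conv_add_uminus)

lemma poly_mapping_keys_induct [case_names zero add single]:
  assumes "P 0" "\<And>s t. P s \<Longrightarrow> P t \<Longrightarrow> P (s + t)"
    and "\<And>k c. k \<in> Poly_Mapping.keys t \<Longrightarrow> P (Poly_Mapping.single k c)"
  shows "P (t :: 'a \<Rightarrow>\<^sub>0 'b::comm_monoid_add)"
proof -
  have *: "P (\<Sum>k \<in> A. Poly_Mapping.single k (Poly_Mapping.lookup t k))"
    if "finite A" "A \<subseteq> Poly_Mapping.keys t" for A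
    using that by (induction A) (auto intro: assms)
  have "t = (\<Sum>k \<in> Poly_Mapping.keys t. Poly_Mapping.single k (Poly_Mapping.lookup t k))"
    by (rule poly_mapping_eqI)
      (auto simp: lookup_sum lookup_single when_def in_keys_iff)
  then show ?thesis
    using *[of "Poly_Mapping.keys t"] by simp
qed

lemma free_eval_mult: "free_eval f (s * t) = free_eval f s * free_eval f t"
proof (induction s rule: poly_mapping_keys_induct)
  case (single v c)
  show ?case
    by (induction t rule: poly_mapping_keys_induct)
      (simp_all add: free_eval_add free_eval_zero free_eval_single distrib_left mult_single
        plus_list_def scaleC_mult_left scaleC_mult_right scaleC_scaleC mult.commute)
qed (simp_all add: free_eval_add free_eval_zero distrib_right)

lemma free_eval_uea_ideal:
  assumes "super_representation f" "t \<in> uea_ideal"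
  shows "free_eval f t = 0"
  using assms(2)
proof (induction rule: uea_ideal.induct)
  case (supercommutator x p y q)
  then have "f x * f y - koszul p q *\<^sub>C (f y * f x) = f (lie_bracket x y)"
    using assms(1) by (auto simp: super_representation_def)
  then show ?case
    by (simp add: free_eval_diff free_eval_single scaleC_one)
qed (use assms(1) in \<open>simp_all add: super_representation_def free_eval_diff free_eval_add
      free_eval_single free_eval_zero free_eval_mult scaleC_one\<close>)

lemma uea_lift_abs:
  assumes "super_representation f"
  shows "uea_lift f (abs_uea t) = free_eval f t"
proof -
  have "uea_rel (rep_uea (abs_uea t)) t"
    using uea.abs_eq_iff Quotient3_abs_rep[OF Quotient3_uea] by blast
  then have "free_eval f (rep_uea (abs_uea t) - t) = 0"
    unfolding uea_rel_def by (rule free_eval_uea_ideal[OF assms])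
  then show ?thesis
    by (simp add: uea_lift_def free_eval_diff)
qed

lemma uea_lift_hom:
  assumes "super_representation f"
  shows "uea_lift f (uea_of x) = f x" "uea_lift f (u + v) = uea_lift f u + uea_lift f v"
    "uea_lift f (u * v) = uea_lift f u * uea_lift f v"
    "uea_lift f 1 = 1" "uea_lift f (c *\<^sub>C u) = c *\<^sub>C uea_lift f u"
proof -
  note lift = uea_lift_abs[OF assms]
  show "uea_lift f (uea_of x) = f x"
    by (simp add: uea_of_def lift free_eval_single scaleC_one)
  show "uea_lift f (u + v) = uea_lift f u + uea_lift f v"
    by (induct u, induct v) (simp add: plus_uea.abs_eq lift free_eval_add)
  show "uea_lift f (u * v) = uea_lift f u * uea_lift f v"
    by (induct u, induct v) (simp add: times_uea.abs_eq lift free_eval_mult)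
  show "uea_lift f 1 = 1"
    by (simp add: one_uea_def lift free_eval_single scaleC_one zero_list_def flip: single_one)
  show "uea_lift f (c *\<^sub>C u) = c *\<^sub>C uea_lift f u"
    by (induct u) (simp add: scaleC_uea.abs_eq lift free_eval_mult free_eval_single
        scaleC_mult_left)
qed


section \<open>Modules over noncommutative rings and induction\<close>

text \<open>The underlying abelian group of a module is written multiplicatively.\<close>

locale left_module = comm_group G for G (structure) +
  fixes act :: "'r::ring_1 \<Rightarrow> 'm \<Rightarrow> 'm"
  assumes act_closed: "x \<in> carrier G \<Longrightarrow> act r x \<in> carrier G"
    and act_mult: "x \<in> carrier G \<Longrightarrow> y \<in> carrier G \<Longrightarrow> act r (x \<otimes> y) = act r x \<otimes> act r y"
    and act_plus: "x \<in> carrier G \<Longrightarrow> act (r + s) x = act r x \<otimes> act s x"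
    and act_times: "x \<in> carrier G \<Longrightarrow> act (r * s) x = act r (act s x)"
    and act_one: "x \<in> carrier G \<Longrightarrow> act 1 x = x"

definition left_submodule ::
  "('m, 'c) monoid_scheme \<Rightarrow> ('r \<Rightarrow> 'm \<Rightarrow> 'm) \<Rightarrow> 'm set \<Rightarrow> bool"
  where "left_submodule G act W \<longleftrightarrow> subgroup W G \<and> (\<forall>r. \<forall>w \<in> W. act r w \<in> W)"

text \<open>Submodules of a module over an enveloping superalgebra are not required to be
  \<open>\<int>/2\<close>-graded. For Verma modules of the N=1 BMS superalgebra this makes no difference: \<open>L_0\<close>
  acts diagonalisably, with the parity of an eigenvector determined by its eigenvalue, so that
  every submodule is graded.\<close>

definition simple_left_module ::
  "('m, 'c) monoid_scheme \<Rightarrow> ('r::ring_1 \<Rightarrow> 'm \<Rightarrow> 'm) \<Rightarrow> bool"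
  where "simple_left_module G act \<longleftrightarrow> left_module G act \<and> carrier G \<noteq> {\<one>\<^bsub>G\<^esub>} \<and>
    (\<forall>W. left_submodule G act W \<longrightarrow> W = {\<one>\<^bsub>G\<^esub>} \<or> W = carrier G)"

text \<open>For a ring homomorphism \<open>\<phi> :: 'r \<Rightarrow> 's\<close> and an action \<open>act\<close> of \<open>'r\<close> on \<open>'b\<close>, the induced
  module is the tensor product over \<open>'r\<close> of \<open>'s\<close>, a right \<open>'r\<close>-module through \<open>\<phi>\<close>, with \<open>'b\<close>: the
  free abelian group on \<open>'s \<times> 'b\<close> modulo the tensor relations. The ring \<open>'s\<close> acts on the first
  factor.\<close>

definition tensor_relators ::
  "('r \<Rightarrow> 's::ring_1) \<Rightarrow> ('r \<Rightarrow> 'b::ab_group_add \<Rightarrow> 'b) \<Rightarrow> ('s \<times> 'b \<Rightarrow>\<^sub>0 int) set"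
  where "tensor_relators \<phi> act =
    {frag_of (u + v, z) - frag_of (u, z) - frag_of (v, z) |u v z. True} \<union>
    {frag_of (u, y + z) - frag_of (u, y) - frag_of (u, z) |u y z. True} \<union>
    {frag_of (u * \<phi> r, z) - frag_of (u, act r z) |u r z. True}"

definition tensor_kernel ::
  "('r \<Rightarrow> 's::ring_1) \<Rightarrow> ('r \<Rightarrow> 'b::ab_group_add \<Rightarrow> 'b) \<Rightarrow> ('s \<times> 'b \<Rightarrow>\<^sub>0 int) set"
  where "tensor_kernel \<phi> act = generate (free_Abelian_group UNIV) (tensor_relators \<phi> act)"

definition induced_group ::
  "('r \<Rightarrow> 's::ring_1) \<Rightarrow> ('r \<Rightarrow> 'b::ab_group_add \<Rightarrow> 'b) \<Rightarrow> ('s \<times> 'b \<Rightarrow>\<^sub>0 int) set monoid"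
  where "induced_group \<phi> act = free_Abelian_group UNIV Mod tensor_kernel \<phi> act"

definition induced_act ::
  "('r \<Rightarrow> 's::ring_1) \<Rightarrow> ('r \<Rightarrow> 'b::ab_group_add \<Rightarrow> 'b) \<Rightarrow>
    's \<Rightarrow> ('s \<times> 'b \<Rightarrow>\<^sub>0 int) set \<Rightarrow> ('s \<times> 'b \<Rightarrow>\<^sub>0 int) set"
  where "induced_act \<phi> act s X =
    (\<Union>x \<in> X. tensor_kernel \<phi> act #>\<^bsub>free_Abelian_group UNIV\<^esub>
      frag_extend (\<lambda>(u, z). frag_of (s * u, z)) x)"

lemma comm_group_free: "comm_group (free_Abelian_group UNIV)"
  by (rule abelian_free_Abelian_group)

lemma carrier_free [simp]: "carrier (free_Abelian_group UNIV) = UNIV"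
  by (auto simp: set_eq_iff)

lemma tensor_kernel_subgroup: "subgroup (tensor_kernel \<phi> act) (free_Abelian_group UNIV)"
  unfolding tensor_kernel_def by (rule group.generate_is_subgroup) auto

lemma tensor_kernel_normal: "tensor_kernel \<phi> act \<lhd> free_Abelian_group UNIV"
  using comm_group.subgroup_imp_normal[OF comm_group_free tensor_kernel_subgroup] .

lemma tensor_kernel_closed:
  "0 \<in> tensor_kernel \<phi> act"
  "x \<in> tensor_kernel \<phi> act \<Longrightarrow> y \<in> tensor_kernel \<phi> act \<Longrightarrow> x + y \<in> tensor_kernel \<phi> act"
  "x \<in> tensor_kernel \<phi> act \<Longrightarrow> - x \<in> tensor_kernel \<phi> act"
  using subgroup.one_closed[OF tensor_kernel_subgroup]
    subgroup.m_closed[OF tensor_kernel_subgroup]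
    subgroup.m_inv_closed[OF tensor_kernel_subgroup]
  by auto

lemma r_coset_free_eq_iff:
  "tensor_kernel \<phi> act #>\<^bsub>free_Abelian_group UNIV\<^esub> x
     = tensor_kernel \<phi> act #>\<^bsub>free_Abelian_group UNIV\<^esub> y \<longleftrightarrow> x - y \<in> tensor_kernel \<phi> act"
  (is "?C x = ?C y \<longleftrightarrow> _")
proof
  assume "?C x = ?C y"
  moreover have "x \<in> ?C x"
    using tensor_kernel_closed(1)[of \<phi> act] by (force simp: r_coset_def)
  ultimately show "x - y \<in> tensor_kernel \<phi> act"
    by (auto simp: r_coset_def)
next
  have *: "?C x \<subseteq> ?C y" if "x - y \<in> tensor_kernel \<phi> act" for x y
  proof
    fix w assume "w \<in> ?C x"
    then obtain k where "k \<in> tensor_kernel \<phi> act" "w = k + x"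
      by (auto simp: r_coset_def)
    then have "k + (x - y) \<in> tensor_kernel \<phi> act" "w = (k + (x - y)) + y"
      using that tensor_kernel_closed(2) by auto
    then show "w \<in> ?C y"
      unfolding r_coset_def mult_free_Abelian_group by blast
  qed
  assume "x - y \<in> tensor_kernel \<phi> act"
  then show "?C x = ?C y"
    using *[of x y] *[of y x] tensor_kernel_closed(3)[of "x - y" \<phi> act] by auto
qed

lemma translate_tensor_kernel:
  assumes "x \<in> tensor_kernel \<phi> act"
  shows "frag_extend (\<lambda>(u, z). frag_of (s * u, z)) x \<in> tensor_kernel \<phi> act"
proof -
  have rel: "frag_extend (\<lambda>(u, z). frag_of (s * u, z)) x \<in> tensor_kernel \<phi> act"
    if "x \<in> tensor_relators \<phi> act" for x
  proof -
    from that consider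
        (1) u v z where "x = frag_of (u + v, z) - frag_of (u, z) - frag_of (v, z)"
      | (2) u y z where "x = frag_of (u, y + z) - frag_of (u, y) - frag_of (u, z)"
      | (3) u r z where "x = frag_of (u * \<phi> r, z) - frag_of (u, act r z)"
      unfolding tensor_relators_def by blast
    then have "frag_extend (\<lambda>(u, z). frag_of (s * u, z)) x \<in> tensor_relators \<phi> act"
    proof cases
      case 1
      then have "frag_extend (\<lambda>(u, z). frag_of (s * u, z)) x
          = frag_of (s * u + s * v, z) - frag_of (s * u, z) - frag_of (s * v, z)"
        by (simp add: frag_extend_diff distrib_left)
      then show ?thesis
        unfolding tensor_relators_def by blast
    next
      case 2
      then have "frag_extend (\<lambda>(u, z). frag_of (s * u, z)) x
          = frag_of (s * u, y + z) - frag_of (s * u, y) - frag_of (s * u, z)"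
        by (simp add: frag_extend_diff)
      then show ?thesis
        unfolding tensor_relators_def by blast
    next
      case 3
      then have "frag_extend (\<lambda>(u, z). frag_of (s * u, z)) x
          = frag_of ((s * u) * \<phi> r, z) - frag_of (s * u, act r z)"
        by (simp add: frag_extend_diff mult.assoc)
      then show ?thesis
        unfolding tensor_relators_def by blast
    qed
    then show ?thesis
      unfolding tensor_kernel_def by (rule generate.incl)
  qed
  show ?thesis
    using assms[unfolded tensor_kernel_def]
  proof (induction rule: generate.induct)
    case (inv h)
    then show ?case
      by (simp add: frag_extend_minus tensor_kernel_closed(3) rel)
  qed (simp_all add: frag_extend_add tensor_kernel_closed rel)
qed

lemma induced_act_coset:
  "induced_act \<phi> act s (tensor_kernel \<phi> act #>\<^bsub>free_Abelian_group UNIV\<^esub> x)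
    = tensor_kernel \<phi> act #>\<^bsub>free_Abelian_group UNIV\<^esub> frag_extend (\<lambda>(u, z). frag_of (s * u, z)) x"
  (is "_ (?C x) = ?C (?f x)")
proof -
  have "?C (?f y) = ?C (?f x)" if "y \<in> ?C x" for y
  proof -
    from that have "y - x \<in> tensor_kernel \<phi> act"
      by (auto simp: r_coset_def)
    then show ?thesis
      using translate_tensor_kernel by (force simp: r_coset_free_eq_iff simp flip: frag_extend_diff)
  qed
  moreover have "x \<in> ?C x"
    using tensor_kernel_closed(1)[of \<phi> act] by (force simp: r_coset_def)
  ultimately show ?thesis
    unfolding induced_act_def by blast
qed

lemma left_module_induced: "left_module (induced_group \<phi> act) (induced_act \<phi> act)"
proof -
  let ?F = "free_Abelian_group UNIV" and ?K = "tensor_kernel \<phi> act"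
  let ?f = "\<lambda>s. frag_extend (\<lambda>(u, z). frag_of (s * u, z))"
  interpret comm_group "?F Mod ?K"
    using comm_group.abelian_FactGroup[OF comm_group_free tensor_kernel_subgroup] .
  have mult: "(?K #>\<^bsub>?F\<^esub> x) \<otimes>\<^bsub>?F Mod ?K\<^esub> (?K #>\<^bsub>?F\<^esub> y) = ?K #>\<^bsub>?F\<^esub> (x + y)" for x y
    using normal.rcos_sum[OF tensor_kernel_normal, of x y \<phi> act] by simp
  have car: "x \<in> carrier (?F Mod ?K) \<longleftrightarrow> (\<exists>y. x = ?K #>\<^bsub>?F\<^esub> y)" for x
    by (auto simp: carrier_FactGroup)
  have plus: "?f (r + s) x - (?f r x + ?f s x) \<in> ?K" for r s x
  proof (induction x rule: frag_induction[OF subset_UNIV, case_names zero one diff])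
    case (one x)
    obtain u z where "x = (u, z)"
      by (cases x)
    then have "?f (r + s) (frag_of x) - (?f r (frag_of x) + ?f s (frag_of x))
        = frag_of (r * u + s * u, z) - frag_of (r * u, z) - frag_of (s * u, z)"
      by (simp add: distrib_right)
    also have "\<dots> \<in> ?K"
      unfolding tensor_kernel_def by (rule generate.incl) (unfold tensor_relators_def, blast)
    finally show ?case .
  next
    case (diff x y)
    have "?f (r + s) (x - y) - (?f r (x - y) + ?f s (x - y)) =
        (?f (r + s) x - (?f r x + ?f s x)) + - (?f (r + s) y - (?f r y + ?f s y))"
      by (simp add: frag_extend_diff)
    then show ?case
      using diff tensor_kernel_closed(2,3) by metis
  qed (simp_all add: tensor_kernel_closed)
  have times: "?f (r * s) x = ?f r (?f s x)" for r s :: 'a and x :: "'a \<times> 'b \<Rightarrow>\<^sub>0 int"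
    by (induction x rule: frag_induction[OF subset_UNIV, case_names zero one diff])
      (auto simp: frag_extend_diff mult.assoc[of r s])
  have one: "?f 1 x = x" for x :: "'a \<times> 'b \<Rightarrow>\<^sub>0 int"
    by (induction x rule: frag_induction[OF subset_UNIV, case_names zero one diff]) (auto simp: frag_extend_diff)
  show ?thesis
    unfolding induced_group_def
  proof unfold_locales
    fix X Y :: "('a \<times> 'b \<Rightarrow>\<^sub>0 int) set" and r s :: 'a
    assume "X \<in> carrier (?F Mod ?K)"
    then obtain x where X: "X = ?K #>\<^bsub>?F\<^esub> x"
      by (auto simp: car)
    show "induced_act \<phi> act r X \<in> carrier (?F Mod ?K)"
      by (auto simp: car X induced_act_coset)
    show "induced_act \<phi> act (r + s) X
        = induced_act \<phi> act r X \<otimes>\<^bsub>?F Mod ?K\<^esub> induced_act \<phi> act s X"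
      unfolding X induced_act_coset mult r_coset_free_eq_iff by (rule plus)
    show "induced_act \<phi> act (r * s) X = induced_act \<phi> act r (induced_act \<phi> act s X)"
      unfolding X induced_act_coset times ..
    show "induced_act \<phi> act 1 X = X"
      unfolding X induced_act_coset one ..
    assume "Y \<in> carrier (?F Mod ?K)"
    then obtain y where Y: "Y = ?K #>\<^bsub>?F\<^esub> y"
      by (auto simp: car)
    show "induced_act \<phi> act r (X \<otimes>\<^bsub>?F Mod ?K\<^esub> Y)
        = induced_act \<phi> act r X \<otimes>\<^bsub>?F Mod ?K\<^esub> induced_act \<phi> act r Y"
      unfolding X Y induced_act_coset mult frag_extend_add ..
  qed
qed

section \<open>The N=1 BMS superalgebra\<close>

text \<open>\<open>Qgen k\<close> indexes \<open>Q_r\<close> with \<open>r = k + 1/2\<close>.\<close>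

datatype bms_gen = Lgen int | Mgen int | Qgen int | C1gen | C2gen

typedef bms = "UNIV :: (bms_gen \<Rightarrow>\<^sub>0 complex) set"
  morphisms bms_coeffs Bms
  by simp

setup_lifting type_definition_bms

lift_definition bms_coeff :: "bms \<Rightarrow> bms_gen \<Rightarrow> complex" is Poly_Mapping.lookup .

lift_definition bms_support :: "bms \<Rightarrow> bms_gen set" is Poly_Mapping.keys .

lift_definition bms_basis :: "bms_gen \<Rightarrow> bms" is "\<lambda>g. Poly_Mapping.single g 1" .

lemma bms_eqI: "(\<And>g. bms_coeff x g = bms_coeff y g) \<Longrightarrow> x = y"
  by transfer (rule poly_mapping_eqI)

lemma support_iff: "g \<in> bms_support x \<longleftrightarrow> bms_coeff x g \<noteq> 0"
  by transfer (simp add: in_keys_iff)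

lemma finite_support [simp]: "finite (bms_support x)"
  by transfer simp

lemma coeff_gen: "bms_coeff (bms_basis g) h = (if g = h then 1 else 0)"
  by transfer (simp add: lookup_single when_def)

instantiation bms :: complex_space
begin

lift_definition zero_bms :: bms is 0 .
lift_definition plus_bms :: "bms \<Rightarrow> bms \<Rightarrow> bms" is "(+)" .
lift_definition uminus_bms :: "bms \<Rightarrow> bms" is uminus .
lift_definition minus_bms :: "bms \<Rightarrow> bms \<Rightarrow> bms" is "(-)" .
lift_definition scaleC_bms :: "complex \<Rightarrow> bms \<Rightarrow> bms" is "\<lambda>c. Poly_Mapping.map ((*) c)" .

lemma coeff_simps [simp]:
  "bms_coeff 0 g = 0" "bms_coeff (x + y) g = bms_coeff x g + bms_coeff y g" "bms_coeff (- x) g = - bms_coeff x g"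
  "bms_coeff (x - y) g = bms_coeff x g - bms_coeff y g" "bms_coeff (c *\<^sub>C x) g = c * bms_coeff x g"
  by (transfer, simp add: lookup_add lookup_minus Poly_Mapping.map.rep_eq when_def)+

instance
  by standard (rule bms_eqI, simp add: algebra_simps)+

end

fun gen_bracket :: "bms_gen \<Rightarrow> bms_gen \<Rightarrow> bms" where
  "gen_bracket (Lgen m) (Lgen n) = of_int (m - n) *\<^sub>C bms_basis (Lgen (m + n))
     + (if m + n = 0 then of_int (m ^ 3 - m) / 12 else 0) *\<^sub>C bms_basis C1gen"
| "gen_bracket (Lgen m) (Mgen n) = of_int (m - n) *\<^sub>C bms_basis (Mgen (m + n))
     + (if m + n = 0 then of_int (m ^ 3 - m) / 12 else 0) *\<^sub>C bms_basis C2gen"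
| "gen_bracket (Mgen m) (Lgen n) = - (of_int (n - m) *\<^sub>C bms_basis (Mgen (n + m))
     + (if n + m = 0 then of_int (n ^ 3 - n) / 12 else 0) *\<^sub>C bms_basis C2gen)"
| "gen_bracket (Lgen m) (Qgen k) =
     (of_int m / 2 - (of_int k + 1 / 2)) *\<^sub>C bms_basis (Qgen (m + k))"
| "gen_bracket (Qgen k) (Lgen m) =
     - ((of_int m / 2 - (of_int k + 1 / 2)) *\<^sub>C bms_basis (Qgen (m + k)))"
| "gen_bracket (Qgen k) (Qgen l) = 2 *\<^sub>C bms_basis (Mgen (k + l + 1))
     + (if k + l + 1 = 0 then ((of_int k + 1 / 2)\<^sup>2 - 1 / 4) / 3 else 0) *\<^sub>C bms_basis C2gen"
| "gen_bracket _ _ = 0"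

fun gen_odd :: "bms_gen \<Rightarrow> bool" where
  "gen_odd (Qgen _) = True"
| "gen_odd _ = False"

definition bms_bracket :: "bms \<Rightarrow> bms \<Rightarrow> bms"
  where "bms_bracket x y =
    (\<Sum>a \<in> bms_support x. \<Sum>b \<in> bms_support y. (bms_coeff x a * bms_coeff y b) *\<^sub>C gen_bracket a b)"

lemma scaleC_sum: "c *\<^sub>C sum f A = (\<Sum>a \<in> A. c *\<^sub>C (f a :: 'a::complex_space))"
  by (induction A rule: infinite_finite_induct) (simp_all add: scaleC_add_right)

lemma bms_bracket_superset:
  assumes "finite A" "bms_support x \<subseteq> A" "finite B" "bms_support y \<subseteq> B"
  shows "bms_bracket x y =
    (\<Sum>a \<in> A. \<Sum>b \<in> B. (bms_coeff x a * bms_coeff y b) *\<^sub>C gen_bracket a b)"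
proof -
  have "bms_bracket x y =
      (\<Sum>a \<in> A. \<Sum>b \<in> bms_support y. (bms_coeff x a * bms_coeff y b) *\<^sub>C gen_bracket a b)"
    unfolding bms_bracket_def using assms
    by (intro sum.mono_neutral_left) (auto simp: support_iff)
  also have "\<dots> = (\<Sum>a \<in> A. \<Sum>b \<in> B. (bms_coeff x a * bms_coeff y b) *\<^sub>C gen_bracket a b)"
    using assms by (intro sum.cong sum.mono_neutral_left) (auto simp: support_iff)
  finally show ?thesis .
qed

lemma bms_bracket_linear:
  "bms_bracket (x + y) z = bms_bracket x z + bms_bracket y z"
  "bms_bracket x (y + z) = bms_bracket x y + bms_bracket x z"
  "bms_bracket (c *\<^sub>C x) y = c *\<^sub>C bms_bracket x y"
  "bms_bracket x (c *\<^sub>C y) = c *\<^sub>C bms_bracket x y"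
proof -
  let ?A = "bms_support x \<union> bms_support y \<union> bms_support z"
  have sub: "bms_support (x + y) \<subseteq> ?A" "bms_support (y + z) \<subseteq> ?A" "bms_support (c *\<^sub>C x) \<subseteq> ?A"
    "bms_support (c *\<^sub>C y) \<subseteq> ?A" "bms_support x \<subseteq> ?A" "bms_support y \<subseteq> ?A" "bms_support z \<subseteq> ?A"
    by (auto simp: support_iff)
  have fin: "finite ?A"
    by simp
  note sup = bms_bracket_superset[OF fin _ fin]
  show "bms_bracket (x + y) z = bms_bracket x z + bms_bracket y z"
    "bms_bracket x (y + z) = bms_bracket x y + bms_bracket x z"
    "bms_bracket (c *\<^sub>C x) y = c *\<^sub>C bms_bracket x y"
    "bms_bracket x (c *\<^sub>C y) = c *\<^sub>C bms_bracket x y"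
    by (simp_all only: sup sub coeff_simps)
      (simp_all add: distrib_left distrib_right scaleC_add_left sum.distrib scaleC_sum
        scaleC_scaleC mult_ac)
qed

lemma bms_bracket_gen: "bms_bracket (bms_basis a) (bms_basis b) = gen_bracket a b"
proof -
  have "bms_support (bms_basis g) = {g}" for g
    by (auto simp: support_iff coeff_gen split: if_splits)
  then show ?thesis
    by (simp add: bms_bracket_def coeff_gen scaleC_one)
qed

lemma bms_bracket_zero: "bms_bracket 0 x = 0" "bms_bracket x 0 = 0"
  using bms_bracket_linear(3)[of 0 0 x] bms_bracket_linear(4)[of x 0 0] by simp_all

lemma bms_bracket_uminus:
  "bms_bracket (- x) y = - bms_bracket x y" "bms_bracket x (- y) = - bms_bracket x y"
  using bms_bracket_linear(1)[of "- x" x y] bms_bracket_linear(2)[of x "- y" y]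
  by (simp_all add: bms_bracket_zero eq_neg_iff_add_eq_0)

lemma bms_induct [case_names zero add bms_basis]:
  assumes "P 0" "\<And>y z. P y \<Longrightarrow> P z \<Longrightarrow> P (y + z)"
    and "\<And>g c. g \<in> bms_support x \<Longrightarrow> P (c *\<^sub>C bms_basis g)"
  shows "P x"
proof -
  have *: "P (\<Sum>g \<in> A. bms_coeff x g *\<^sub>C bms_basis g)" if "finite A" "A \<subseteq> bms_support x" for A
    using that by (induction A) (auto intro: assms)
  have coeff_sum: "bms_coeff (sum f A) h = (\<Sum>g \<in> A. bms_coeff (f g) h)" for f h and A :: "bms_gen set"
    by (induction A rule: infinite_finite_induct) simp_all
  have "x = (\<Sum>g \<in> bms_support x. bms_coeff x g *\<^sub>C bms_basis g)"
    by (rule bms_eqI) (auto simp: coeff_sum coeff_gen support_iff if_distrib cong: if_cong)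
  then show ?thesis
    using *[of "bms_support x"] by simp
qed

lemma gen_bracket_skew:
  "gen_bracket a b = - (koszul (gen_odd a) (gen_odd b) *\<^sub>C gen_bracket b a)"
proof (cases a; cases b)
  fix m n assume ab: "a = Lgen m" "b = Lgen n"
  show ?thesis
  proof (cases "m + n = 0")
    case True
    then have "n = - m" by simp
    then show ?thesis
      unfolding ab by (intro bms_eqI) (simp add: koszul_def coeff_gen)
  qed (use ab in \<open>intro bms_eqI, simp add: koszul_def coeff_gen add.commute\<close>)
next
  fix k l assume ab: "a = Qgen k" "b = Qgen l"
  show ?thesis
  proof (cases "k + l + 1 = 0")
    case True
    then have l: "l = - 1 - k" by simp
    show ?thesis
      unfolding ab l by (intro bms_eqI) (simp add: koszul_def coeff_gen power2_eq_square field_simps)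
  qed (use ab in \<open>intro bms_eqI, simp add: koszul_def coeff_gen add.commute\<close>)
qed (intro bms_eqI, simp add: koszul_def coeff_gen)+

lemma bms_bracket_diff:
  "bms_bracket (x - y) z = bms_bracket x z - bms_bracket y z"
  "bms_bracket x (y - z) = bms_bracket x y - bms_bracket x z"
  by (metis bms_bracket_linear(1) bms_bracket_uminus(1) diff_conv_add_uminus)
    (metis bms_bracket_linear(2) bms_bracket_uminus(2) diff_conv_add_uminus)

lemma gen_bracket_jacobi:
  "bms_bracket (bms_basis a) (gen_bracket b c) = bms_bracket (gen_bracket a b) (bms_basis c)
     + koszul (gen_odd a) (gen_odd b) *\<^sub>C bms_bracket (bms_basis b) (gen_bracket a c)"
proof -
  note expand = bms_bracket_linear bms_bracket_uminus bms_bracket_diff bms_bracket_zero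
    bms_bracket_gen koszul_def coeff_gen
  show ?thesis
  proof (cases a; cases b; cases c)
    fix i j k assume abc: "a = Lgen i" "b = Lgen j" "c = Lgen k"
    obtain d where k: "k = d - i - j"
      by (rule that[of "k + i + j"]) simp
    show ?thesis
      unfolding abc k
      by (intro bms_eqI; cases "d = 0")
        (simp_all add: expand power2_eq_square power3_eq_cube field_simps)
  next
    fix i j k assume abc: "a = Lgen i" "b = Lgen j" "c = Mgen k"
    obtain d where k: "k = d - i - j"
      by (rule that[of "k + i + j"]) simp
    show ?thesis
      unfolding abc k
      by (intro bms_eqI; cases "d = 0")
        (simp_all add: expand power2_eq_square power3_eq_cube field_simps)
  next
    fix i j k assume abc: "a = Lgen i" "b = Mgen j" "c = Lgen k"
    obtain d where k: "k = d - i - j"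
      by (rule that[of "k + i + j"]) simp
    show ?thesis
      unfolding abc k
      by (intro bms_eqI; cases "d = 0")
        (simp_all add: expand power2_eq_square power3_eq_cube field_simps)
  next
    fix i j k assume abc: "a = Mgen i" "b = Lgen j" "c = Lgen k"
    obtain d where k: "k = d - i - j"
      by (rule that[of "k + i + j"]) simp
    show ?thesis
      unfolding abc k
      by (intro bms_eqI; cases "d = 0")
        (simp_all add: expand power2_eq_square power3_eq_cube field_simps)
  next
    fix i j k assume abc: "a = Lgen i" "b = Lgen j" "c = Qgen k"
    obtain d where k: "k = d - i - j"
      by (rule that[of "k + i + j"]) simp
    show ?thesis
      unfolding abc k
      by (intro bms_eqI; cases "d = 0")
        (simp_all add: expand power2_eq_square power3_eq_cube field_simps)
  next
    fix i j k assume abc: "a = Lgen i" "b = Qgen j" "c = Lgen k"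
    obtain d where k: "k = d - i - j"
      by (rule that[of "k + i + j"]) simp
    show ?thesis
      unfolding abc k
      by (intro bms_eqI; cases "d = 0")
        (simp_all add: expand power2_eq_square power3_eq_cube field_simps)
  next
    fix i j k assume abc: "a = Qgen i" "b = Lgen j" "c = Lgen k"
    obtain d where k: "k = d - i - j"
      by (rule that[of "k + i + j"]) simp
    show ?thesis
      unfolding abc k
      by (intro bms_eqI; cases "d = 0")
        (simp_all add: expand power2_eq_square power3_eq_cube field_simps)
  next
    fix i j k assume abc: "a = Lgen i" "b = Qgen j" "c = Qgen k"
    obtain d where k: "k = d - i - j - 1"
      by (rule that[of "k + i + j + 1"]) simp
    show ?thesis
      unfolding abc k
      by (intro bms_eqI; cases "d = 0")
        (simp_all add: expand power2_eq_square power3_eq_cube field_simps)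
  next
    fix i j k assume abc: "a = Qgen i" "b = Lgen j" "c = Qgen k"
    obtain d where k: "k = d - i - j - 1"
      by (rule that[of "k + i + j + 1"]) simp
    show ?thesis
      unfolding abc k
      by (intro bms_eqI; cases "d = 0")
        (simp_all add: expand power2_eq_square power3_eq_cube field_simps)
  next
    fix i j k assume abc: "a = Qgen i" "b = Qgen j" "c = Lgen k"
    obtain d where k: "k = d - i - j - 1"
      by (rule that[of "k + i + j + 1"]) simp
    show ?thesis
      unfolding abc k
      by (intro bms_eqI; cases "d = 0")
        (simp_all add: expand power2_eq_square power3_eq_cube field_simps)
  qed (simp_all add: expand split del: if_split)
qed

lemma support_simps:
  "bms_support 0 = {}" "bms_support (x + y) \<subseteq> bms_support x \<union> bms_support y" "bms_support (- x) = bms_support x"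
  "bms_support (x - y) \<subseteq> bms_support x \<union> bms_support y" "bms_support (c *\<^sub>C x) \<subseteq> bms_support x"
  by (auto simp: support_iff)

lemma bms_bracket_parity:
  assumes "g \<in> bms_support (gen_bracket a b)"
  shows "gen_odd g = (gen_odd a \<noteq> gen_odd b)"
  using assms by (cases a; cases b) (auto simp: support_iff coeff_gen split: if_splits)

instantiation bms :: lie_superalgebra
begin

definition parity_part_bms :: "bool \<Rightarrow> bms set"
  where "parity_part_bms p = {x. \<forall>g \<in> bms_support x. gen_odd g = p}"

definition lie_bracket_bms :: "bms \<Rightarrow> bms \<Rightarrow> bms"
  where "lie_bracket_bms = bms_bracket"

instance
proof
  fix x y z :: bms and p q s :: bool and c :: complex
  show part_zero: "0 \<in> (parity_part p :: bms set)" for p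
    by (simp add: parity_part_bms_def support_simps)
  show part_add: "x \<in> parity_part p \<Longrightarrow> y \<in> parity_part p \<Longrightarrow> x + y \<in> parity_part p" for x y :: bms and p
    using support_simps(2)[of x y] unfolding parity_part_bms_def by blast
  show part_scale: "x \<in> parity_part p \<Longrightarrow> c *\<^sub>C x \<in> parity_part p" for x :: bms and p c
    by (simp add: parity_part_bms_def support_iff)
  show "parity_part False \<inter> parity_part True = {0 :: bms}"
    by (auto simp: parity_part_bms_def support_iff intro: bms_eqI)
  show "\<exists>y \<in> parity_part False. \<exists>z \<in> parity_part True. x = y + z"
  proof (induction x rule: bms_induct)
    case zero
    show ?case
      by (rule bexI[of _ 0], rule bexI[of _ 0]) (use part_zero in simp_all)
  next
    case (add x y)
    then obtain x0 x1 y0 y1 where "x0 \<in> parity_part False" "x1 \<in> parity_part True" "x = x0 + x1"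
      "y0 \<in> parity_part False" "y1 \<in> parity_part True" "y = y0 + y1"
      by blast
    then show ?case
      by (intro bexI[of _ "x0 + y0"] bexI[of _ "x1 + y1"])
        (simp_all add: part_add)
  next
    case (bms_basis g c)
    have "c *\<^sub>C bms_basis g \<in> parity_part (gen_odd g)"
      by (auto simp: parity_part_bms_def support_iff coeff_gen split: if_splits)
    then show ?case
      using part_zero by (metis (full_types) add_0 add.right_neutral)
  qed
  show "lie_bracket (x + y) z = lie_bracket x z + lie_bracket y z"
    "lie_bracket x (y + z) = lie_bracket x y + lie_bracket x z"
    "lie_bracket (c *\<^sub>C x) y = c *\<^sub>C lie_bracket x y"
    "lie_bracket x (c *\<^sub>C y) = c *\<^sub>C lie_bracket x y"
    unfolding lie_bracket_bms_def by (rule bms_bracket_linear)+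
  assume x: "x \<in> parity_part p"
  assume y: "y \<in> parity_part q"
  have odd_x: "gen_odd g = p" if "g \<in> bms_support x" for g
    using x that by (simp add: parity_part_bms_def)
  have odd_y: "gen_odd g = q" if "g \<in> bms_support y" for g
    using y that by (simp add: parity_part_bms_def)
  show "lie_bracket x y \<in> parity_part (p \<noteq> q)"
    unfolding lie_bracket_bms_def
  proof (induction x rule: bms_induct)
    case (bms_basis a c)
    show ?case
    proof (induction y rule: bms_induct)
      case (bms_basis b d)
      have "gen_bracket a b \<in> parity_part (p \<noteq> q)"
        using bms_bracket_parity odd_x[OF \<open>a \<in> bms_support x\<close>] odd_y[OF \<open>b \<in> bms_support y\<close>]
        by (simp add: parity_part_bms_def)
      then show ?case
        by (simp add: bms_bracket_linear bms_bracket_gen part_scale)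
    qed (simp_all add: bms_bracket_linear bms_bracket_zero part_zero part_add)
  qed (simp_all add: bms_bracket_linear bms_bracket_zero part_zero part_add)
  show "lie_bracket x y = - (koszul p q *\<^sub>C lie_bracket y x)"
    unfolding lie_bracket_bms_def
  proof (induction x rule: bms_induct)
    case (bms_basis a c)
    show ?case
    proof (induction y rule: bms_induct)
      case (bms_basis b d)
      show ?case
        using gen_bracket_skew[of a b] odd_x[OF \<open>a \<in> bms_support x\<close>] odd_y[OF \<open>b \<in> bms_support y\<close>]
        by (simp add: bms_bracket_linear bms_bracket_gen scaleC_scaleC scaleC_uminus_right mult_ac)
    qed (simp_all add: bms_bracket_linear bms_bracket_zero scaleC_add_right)
  qed (simp_all add: bms_bracket_linear bms_bracket_zero scaleC_add_right)
  assume "z \<in> parity_part s"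
  show "lie_bracket x (lie_bracket y z)
      = lie_bracket (lie_bracket x y) z + koszul p q *\<^sub>C lie_bracket y (lie_bracket x z)"
    unfolding lie_bracket_bms_def
  proof (induction x rule: bms_induct)
    case (bms_basis a c)
    show ?case
    proof (induction y rule: bms_induct)
      case (bms_basis b d)
      show ?case
      proof (induction z rule: bms_induct)
        case (bms_basis g e)
        show ?case
          using gen_bracket_jacobi[of a b g] odd_x[OF \<open>a \<in> bms_support x\<close>] odd_y[OF \<open>b \<in> bms_support y\<close>]
          by (simp add: bms_bracket_linear bms_bracket_gen scaleC_scaleC scaleC_add_right mult_ac)
      qed (simp_all add: bms_bracket_linear bms_bracket_zero scaleC_add_right algebra_simps)
    qed (simp_all add: bms_bracket_linear bms_bracket_zero scaleC_add_right algebra_simps)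
  qed (simp_all add: bms_bracket_linear bms_bracket_zero scaleC_add_right algebra_simps)
qed

end

definition cartan_gens :: "bms_gen set"
  where "cartan_gens = {Lgen 0, Mgen 0, C1gen, C2gen}"

definition positive_gens :: "bms_gen set"
  where "positive_gens = {Lgen n |n. n > 0} \<union> {Mgen n |n. n > 0} \<union> {Qgen k |k. k \<ge> 0}"

typedef bms_borel = "{x :: bms. bms_support x \<subseteq> cartan_gens \<union> positive_gens}"
  morphisms borel_incl Borel
  by (rule exI[of _ 0]) (simp add: support_iff subset_iff)

setup_lifting type_definition_bms_borel

lemma bms_bracket_borel:
  assumes "bms_support x \<subseteq> cartan_gens \<union> positive_gens" "bms_support y \<subseteq> cartan_gens \<union> positive_gens"
  shows "bms_support (bms_bracket x y) \<subseteq> cartan_gens \<union> positive_gens"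
    "g \<in> cartan_gens \<Longrightarrow> bms_coeff (bms_bracket x y) g = 0"
proof -
  have ab: "bms_support (gen_bracket a b) \<subseteq> positive_gens"
    if "a \<in> cartan_gens \<union> positive_gens" "b \<in> cartan_gens \<union> positive_gens" for a b
    using that by (cases a; cases b)
      (auto simp: cartan_gens_def positive_gens_def support_iff coeff_gen split: if_splits)
  have "bms_support (bms_bracket x y) \<subseteq> positive_gens"
  proof (induction x rule: bms_induct)
    case (bms_basis a c)
    show ?case
    proof (induction y rule: bms_induct)
      case (bms_basis b d)
      have "bms_support (gen_bracket a b) \<subseteq> positive_gens"
        using bms_basis \<open>a \<in> bms_support x\<close> assms ab by blast
      then show ?case
        using support_simps(5) by (simp add: bms_bracket_linear bms_bracket_gen) blast
    next
      case (add y z)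
      then show ?case
        unfolding bms_bracket_linear using support_simps(2) by blast
    qed (simp add: bms_bracket_zero support_simps)
  next
    case (add x z)
    then show ?case
      unfolding bms_bracket_linear using support_simps(2) by blast
  qed (simp add: bms_bracket_zero support_simps)
  moreover have "cartan_gens \<inter> positive_gens = {}"
    by (auto simp: cartan_gens_def positive_gens_def)
  ultimately show "bms_support (bms_bracket x y) \<subseteq> cartan_gens \<union> positive_gens"
    "g \<in> cartan_gens \<Longrightarrow> bms_coeff (bms_bracket x y) g = 0"
    by (auto simp: support_iff subset_iff)
qed

instantiation bms_borel :: lie_superalgebra
begin

lift_definition zero_bms_borel :: bms_borel is 0
  by (simp add: support_iff subset_iff)
lift_definition plus_bms_borel :: "bms_borel \<Rightarrow> bms_borel \<Rightarrow> bms_borel" is "(+)"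
  by (force simp: support_iff subset_iff)
lift_definition uminus_bms_borel :: "bms_borel \<Rightarrow> bms_borel" is uminus
  by (simp add: support_iff subset_iff)
lift_definition minus_bms_borel :: "bms_borel \<Rightarrow> bms_borel \<Rightarrow> bms_borel" is "(-)"
  by (force simp: support_iff subset_iff)
lift_definition scaleC_bms_borel :: "complex \<Rightarrow> bms_borel \<Rightarrow> bms_borel" is "(*\<^sub>C)"
  by (simp add: support_iff subset_iff)
definition parity_part_bms_borel :: "bool \<Rightarrow> bms_borel set"
  where "parity_part_bms_borel p = {x. borel_incl x \<in> parity_part p}"
lift_definition lie_bracket_bms_borel :: "bms_borel \<Rightarrow> bms_borel \<Rightarrow> bms_borel" is lie_bracket
  unfolding lie_bracket_bms_def by (rule bms_bracket_borel(1))

lemmas borel_incl_simps =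
  zero_bms_borel.rep_eq plus_bms_borel.rep_eq uminus_bms_borel.rep_eq minus_bms_borel.rep_eq
  scaleC_bms_borel.rep_eq lie_bracket_bms_borel.rep_eq

instance
proof
  fix x y z :: bms_borel and p q s :: bool and c d :: complex
  note eq = borel_incl_inject[symmetric] borel_incl_simps
  note part = parity_part_bms_borel_def
  show "x + y + z = x + (y + z)" "x + y = y + x" "0 + x = x" "- x + x = 0" "x - y = x + - y"
    by (simp_all add: eq algebra_simps)
  show "c *\<^sub>C (x + y) = c *\<^sub>C x + c *\<^sub>C y" "(c + d) *\<^sub>C x = c *\<^sub>C x + d *\<^sub>C x"
    "c *\<^sub>C d *\<^sub>C x = (c * d) *\<^sub>C x" "1 *\<^sub>C x = x"
    by (simp_all add: eq scaleC_add_left scaleC_add_right scaleC_scaleC scaleC_one)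
  show "0 \<in> (parity_part p :: bms_borel set)"
    by (simp add: part eq parity_part_zero)
  show "x \<in> parity_part p \<Longrightarrow> y \<in> parity_part p \<Longrightarrow> x + y \<in> parity_part p"
    "x \<in> parity_part p \<Longrightarrow> c *\<^sub>C x \<in> parity_part p"
    by (simp_all add: part eq parity_part_add parity_part_scale)
  show "parity_part False \<inter> parity_part True = {0 :: bms_borel}"
    using parity_part_Int[where 'a = bms] by (simp add: set_eq_iff parity_part_bms_borel_def eq)
  show "\<exists>y \<in> parity_part False. \<exists>z \<in> parity_part True. x = y + z"
  proof -
    obtain y z where yz: "y \<in> parity_part False" "z \<in> parity_part True" "borel_incl x = y + z"
      using parity_part_decomp by blast
    have "bms_coeff y g = 0 \<or> bms_coeff z g = 0" for g
      using yz(1,2) unfolding parity_part_bms_def by (metis (mono_tags) mem_Collect_eq support_iff)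
    then have "bms_support y \<subseteq> bms_support (borel_incl x)" "bms_support z \<subseteq> bms_support (borel_incl x)"
      unfolding yz(3) by (force simp: support_iff)+
    then have "borel_incl (Borel y) = y" "borel_incl (Borel z) = z"
      using borel_incl[of x] by (auto simp: Borel_inverse)
    then show ?thesis
      using yz by (intro bexI[of _ "Borel y"] bexI[of _ "Borel z"]) (simp_all add: part eq)
  qed
  show "lie_bracket (x + y) z = lie_bracket x z + lie_bracket y z"
    "lie_bracket x (y + z) = lie_bracket x y + lie_bracket x z"
    "lie_bracket (c *\<^sub>C x) y = c *\<^sub>C lie_bracket x y"
    "lie_bracket x (c *\<^sub>C y) = c *\<^sub>C lie_bracket x y"
    by (simp_all add: eq bracket_add_left bracket_add_right bracket_scale_left bracket_scale_right)
  assume xy: "x \<in> parity_part p" "y \<in> parity_part q"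
  then show "lie_bracket x y \<in> parity_part (p \<noteq> q)"
    unfolding part mem_Collect_eq eq by (rule bracket_parity)
  show "lie_bracket x y = - (koszul p q *\<^sub>C lie_bracket y x)"
    using xy unfolding part mem_Collect_eq eq by (rule bracket_skew)
  assume "z \<in> parity_part s"
  then show "lie_bracket x (lie_bracket y z)
      = lie_bracket (lie_bracket x y) z + koszul p q *\<^sub>C lie_bracket y (lie_bracket x z)"
    using xy unfolding part mem_Collect_eq eq by (rule bracket_jacobi[rotated 2])
qed

end


section \<open>Verma modules\<close>

text \<open>\<open>borel_uea_incl\<close> and \<open>uea_lift (verma_char h1 h2 c1 c2)\<close> are homomorphisms of algebras by
  \<open>uea_lift_hom\<close> and the two lemmas \<open>super_representation_\<dots>\<close> below.\<close>

definition borel_uea_incl :: "bms_borel uea \<Rightarrow> bms uea"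
  where "borel_uea_incl = uea_lift (\<lambda>x. uea_of (borel_incl x))"

definition verma_char ::
  "complex \<Rightarrow> complex \<Rightarrow> complex \<Rightarrow> complex \<Rightarrow> bms_borel \<Rightarrow> complex"
  where "verma_char h1 h2 c1 c2 x =
    h1 * bms_coeff (borel_incl x) (Lgen 0) + h2 * bms_coeff (borel_incl x) (Mgen 0)
    + c1 * bms_coeff (borel_incl x) C1gen + c2 * bms_coeff (borel_incl x) C2gen"

definition verma_char_act ::
  "complex \<Rightarrow> complex \<Rightarrow> complex \<Rightarrow> complex \<Rightarrow> bms_borel uea \<Rightarrow> complex \<Rightarrow> complex"
  where "verma_char_act h1 h2 c1 c2 r z = uea_lift (verma_char h1 h2 c1 c2) r * z"

definition verma_group ::
  "complex \<Rightarrow> complex \<Rightarrow> complex \<Rightarrow> complex \<Rightarrow> (bms uea \<times> complex \<Rightarrow>\<^sub>0 int) set monoid"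
  where "verma_group h1 h2 c1 c2 = induced_group borel_uea_incl (verma_char_act h1 h2 c1 c2)"

definition verma_act ::
  "complex \<Rightarrow> complex \<Rightarrow> complex \<Rightarrow> complex \<Rightarrow> bms uea \<Rightarrow>
    (bms uea \<times> complex \<Rightarrow>\<^sub>0 int) set \<Rightarrow> (bms uea \<times> complex \<Rightarrow>\<^sub>0 int) set"
  where "verma_act h1 h2 c1 c2 = induced_act borel_uea_incl (verma_char_act h1 h2 c1 c2)"

lemma left_module_verma: "left_module (verma_group h1 h2 c1 c2) (verma_act h1 h2 c1 c2)"
  unfolding verma_group_def verma_act_def by (rule left_module_induced)

lemma super_representation_borel_incl: "super_representation (\<lambda>x. uea_of (borel_incl x))"
  by (auto simp: super_representation_def borel_incl_simps uea_of_add uea_of_scale uea_of_bracket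
      parity_part_bms_borel_def)

lemma super_representation_verma_char: "super_representation (verma_char h1 h2 c1 c2)"
proof -
  have "bms_coeff (borel_incl (lie_bracket x y)) g = 0" if "g \<in> cartan_gens" for x y g
    using bms_bracket_borel(2)[OF _ _ that] borel_incl
    by (simp add: borel_incl_simps lie_bracket_bms_def)
  then have bracket: "verma_char h1 h2 c1 c2 (lie_bracket x y) = 0" for x y
    by (simp add: verma_char_def cartan_gens_def)
  have odd: "verma_char h1 h2 c1 c2 x = 0" if x: "x \<in> parity_part True" for x
  proof -
    have "bms_coeff (borel_incl x) g = 0" if "\<not> gen_odd g" for g
      using x that by (auto simp: parity_part_bms_borel_def parity_part_bms_def support_iff)
    then show ?thesis
      by (simp add: verma_char_def)
  qed
  have comm: "verma_char h1 h2 c1 c2 x * verma_char h1 h2 c1 c2 y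
      - koszul p q *\<^sub>C (verma_char h1 h2 c1 c2 y * verma_char h1 h2 c1 c2 x) = 0"
    if "x \<in> parity_part p" "y \<in> parity_part q" for p q x y
    using that odd[of x] odd[of y] by (cases p; cases q) (auto simp: koszul_def scaleC_complex_def)
  have linear: "verma_char h1 h2 c1 c2 (x + y)
      = verma_char h1 h2 c1 c2 x + verma_char h1 h2 c1 c2 y"
    "verma_char h1 h2 c1 c2 (c *\<^sub>C x) = c *\<^sub>C verma_char h1 h2 c1 c2 x" for c x y
    by (simp_all add: verma_char_def borel_incl_simps scaleC_complex_def algebra_simps)
  show ?thesis
    unfolding super_representation_def bracket using comm linear by blast
qed

end

theory Submission
  imports Defs "HOL-Library.Multiset"
begin

text \<open>Straightening words in the basis of the superalgebra, with Bergman's diamond lemma for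
  confluence, yields for every function on the normal words (sorted words in the negative
  generators) a linear functional on the enveloping algebra that vanishes on the annihilator of
  the highest weight vector \<open>v\<close>; conversely the normal words applied to \<open>v\<close> span the Verma module.

  Put \<open>f(i) = h\<^sub>2 + (i\<^sup>2 - 1) c\<^sub>2 / 24\<close>. On vectors killed by the \<open>M\<^sub>n\<close> with \<open>n > 0\<close>, on which
  \<open>M\<^sub>0\<close> acts as \<open>h\<^sub>2\<close>, the brackets of \<open>M\<^sub>a\<close> with \<open>L\<^bsub>-a\<^esub>\<close>, of \<open>Q\<^sub>r\<close> with \<open>Q\<^bsub>-r\<^esub>\<close> and of
  \<open>L\<^sub>a\<close> with \<open>M\<^bsub>-a\<^esub>\<close> are \<open>2 a f(a)\<close>, \<open>2 f(2 r)\<close> and \<open>2 a f(a)\<close>, while those of \<open>M\<^sub>a\<close> with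
  \<open>L\<^bsub>-b\<^esub>\<close> for \<open>b < a\<close>, and so on, vanish. If no \<open>f(i)\<close> is zero, any nonzero vector is
  therefore brought back to \<open>v\<close> by removing first the \<open>L\<close>'s with positive \<open>M\<close>'s, then the
  \<open>Q\<close>'s with positive \<open>Q\<close>'s, then the \<open>M\<close>'s with positive \<open>L\<close>'s. If \<open>f(i) = 0\<close>, there is an
  explicit singular vector of degree \<open>i\<close>, a polynomial in the negative \<open>M\<close>'s applied to \<open>v\<close>.\<close>

section \<open>Linear extensions\<close>

text \<open>The Verma module is a quotient, so nonvanishing needs a certificate; the functionals
  supply it for \<open>1\<close>, for the singular vector, and to keep \<open>v\<close> out of the
  submodule that the latter generates. In the other direction spanning suffices: coefficients of
  words are carried along as vectors, and those that vanish in the module are discarded. The order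
  L, Q, M puts the block removed first on the left: the Q's and M's to its right commute with every
  M, so they preserve conditions imposed by M's.

  The singular vector comes from a Hill equation. The M's behave like the modes of a quadratic
  density in the coadjoint representation of the Virasoro algebra, with constant mode
  \<open>h2 - c2/24\<close>, which is \<open>- c2 i^2/24\<close> if \<open>f(i) = 0\<close>. With
  \<open>T = z d/dz\<close> and \<open>V\<close> the sum of the \<open>M_{-k} z^k\<close>, the
  equation \<open>(c2/6) T^2 psi + (h2 - c2/24 + V) psi = 0\<close> has exponents \<open>i/2\<close>
  and \<open>-i/2\<close>, and \<open>psi = z^(-i/2) S\<close> turns it into
  \<open>(c2/6) T (T - i) S + V S = 0\<close>. The power series solution with
  \<open>S(0) = 1\<close> is obstructed at \<open>z^i\<close>, and this obstruction is killed by the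
  positive L's. If \<open>c2 = 0\<close>, then \<open>h2 = 0\<close> and the vector is
  \<open>M_{-1} v\<close>.\<close>

instantiation poly_mapping :: (type, complex_space) complex_space
begin

definition scaleC_poly_mapping :: "complex \<Rightarrow> ('a \<Rightarrow>\<^sub>0 'b) \<Rightarrow> 'a \<Rightarrow>\<^sub>0 'b"
  where "scaleC_poly_mapping c = Poly_Mapping.map ((*\<^sub>C) c)"

lemma lookup_scaleC [simp]:
  "Poly_Mapping.lookup (c *\<^sub>C t) k = c *\<^sub>C Poly_Mapping.lookup t k"
  for t :: "'a \<Rightarrow>\<^sub>0 'b"
  by (simp add: scaleC_poly_mapping_def Poly_Mapping.map.rep_eq when_def)

instance
  by standard (rule poly_mapping_eqI,
      simp add: lookup_add scaleC_add_left scaleC_add_right scaleC_scaleC scaleC_one)+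

end

lemma scaleC_single: "c *\<^sub>C Poly_Mapping.single k a = Poly_Mapping.single k (c *\<^sub>C a)"
  by (rule poly_mapping_eqI) (simp add: lookup_single when_def)

text \<open>Lets the free algebra on the basis symbols serve as a target of
  \<open>free_eval\<close>, which substitutes \<open>gen_embed x\<close> for every letter
  \<open>x\<close>.\<close>

instance poly_mapping :: (monoid_add, complex_algebra) complex_algebra
proof
  fix c :: complex and x y :: "'a \<Rightarrow>\<^sub>0 'b"
  show "(c *\<^sub>C x) * y = c *\<^sub>C (x * y)"
  proof (induction x rule: poly_mapping_keys_induct)
    case (single k a)
    show ?case
      by (induction y rule: poly_mapping_keys_induct)
        (simp_all add: distrib_left scaleC_add_right scaleC_single mult_single scaleC_mult_left)
  qed (simp_all add: distrib_right scaleC_add_right)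
  show "x * (c *\<^sub>C y) = c *\<^sub>C (x * y)"
  proof (induction x rule: poly_mapping_keys_induct)
    case (single k a)
    show ?case
      by (induction y rule: poly_mapping_keys_induct)
        (simp_all add: distrib_left scaleC_add_right scaleC_single mult_single scaleC_mult_right)
  qed (simp_all add: distrib_right scaleC_add_right)
qed

definition linear_extension :: "('a \<Rightarrow> complex) \<Rightarrow> ('a \<Rightarrow>\<^sub>0 complex) \<Rightarrow> complex"
  where "linear_extension f t =
    (\<Sum>w \<in> Poly_Mapping.keys t. Poly_Mapping.lookup t w * f w)"

lemma linear_extension_add:
  "linear_extension f (s + t) = linear_extension f s + linear_extension f t"
proof -
  let ?A = "Poly_Mapping.keys s \<union> Poly_Mapping.keys t"
  have sup: "linear_extension f u = (\<Sum>w \<in> ?A. Poly_Mapping.lookup u w * f w)"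
    if "Poly_Mapping.keys u \<subseteq> ?A" for u
    unfolding linear_extension_def using that
    by (intro sum.mono_neutral_left) (auto simp: in_keys_iff)
  show ?thesis
    using keys_add[of s t]
    by (simp add: sup lookup_add distrib_right sum.distrib)
qed

lemma linear_extension_zero [simp]: "linear_extension f 0 = 0"
  by (simp add: linear_extension_def)

lemma linear_extension_uminus: "linear_extension f (- t) = - linear_extension f t"
  using linear_extension_add[of f "- t" t] by (simp add: eq_neg_iff_add_eq_0)

lemma linear_extension_diff:
  "linear_extension f (s - t) = linear_extension f s - linear_extension f t"
  by (metis linear_extension_add linear_extension_uminus diff_conv_add_uminus)

lemma linear_extension_single: "linear_extension f (Poly_Mapping.single w c) = c * f w"
  by (simp add: linear_extension_def)

lemma linear_extension_scaleC: "linear_extension f (c *\<^sub>C t) = c * linear_extension f t"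
  by (induction t rule: poly_mapping_keys_induct)
    (simp_all add: scaleC_add_right linear_extension_add distrib_left scaleC_single
      linear_extension_single scaleC_complex_def)

lemmas linear_extension_simps = linear_extension_add linear_extension_uminus
  linear_extension_diff linear_extension_single linear_extension_scaleC

section \<open>The free algebra on the basis symbols and its relators\<close>

text \<open>The enveloping algebra is presented by words in all elements of the superalgebra,
  whereas straightening relies on an order of the basis symbols; this map translates the
  letters.\<close>

definition gen_embed :: "bms \<Rightarrow> bms_gen list \<Rightarrow>\<^sub>0 complex"
  where "gen_embed x = (\<Sum>g \<in> bms_support x. Poly_Mapping.single [g] (bms_coeff x g))"

lemma lookup_gen_embed:
  "Poly_Mapping.lookup (gen_embed x) w = (if length w = 1 then bms_coeff x (hd w) else 0)"
proof -
  have "Poly_Mapping.lookup (gen_embed x) w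
      = (\<Sum>g \<in> bms_support x. if w = [g] then bms_coeff x g else 0)"
    by (simp add: gen_embed_def lookup_sum lookup_single when_def eq_commute)
  also have "\<dots> = (if length w = 1 then bms_coeff x (hd w) else 0)"
    by (cases w) (auto simp: support_iff sum.delta' intro!: sum.neutral)
  finally show ?thesis .
qed

lemma gen_embed_simps:
  "gen_embed (x + y) = gen_embed x + gen_embed y" "gen_embed (- x) = - gen_embed x"
  "gen_embed (x - y) = gen_embed x - gen_embed y" "gen_embed (c *\<^sub>C x) = c *\<^sub>C gen_embed x"
  "gen_embed 0 = 0" "gen_embed (bms_basis g) = Poly_Mapping.single [g] 1"
proof -
  show "gen_embed (bms_basis g) = Poly_Mapping.single [g] 1"
    by (rule poly_mapping_eqI)
      (auto simp: lookup_gen_embed lookup_single coeff_gen when_def length_Suc_conv; metis)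
qed (rule poly_mapping_eqI,
    simp add: lookup_gen_embed lookup_add lookup_minus scaleC_complex_def)+

text \<open>The Koszul sign as an operation on any abelian group, so that it passes unchanged
  through additive maps from the free algebra to the complex numbers.\<close>

definition super_sign :: "bool \<Rightarrow> 'a \<Rightarrow> 'a::ab_group_add"
  where "super_sign e t = (if e then - t else t)"

lemma super_sign_koszul: "koszul p q *\<^sub>C t = super_sign (p \<and> q) t"
  by (simp add: koszul_def super_sign_def scaleC_one scaleC_uminus_left)

text \<open>\<open>p\<close> and \<open>q\<close> are the parities of \<open>x\<close> and \<open>y\<close>.\<close>

definition relator :: "bool \<Rightarrow> bms \<Rightarrow> bool \<Rightarrow> bms \<Rightarrow> bms_gen list \<Rightarrow>\<^sub>0 complex"
  where "relator p x q y = gen_embed x * gen_embed y - super_sign (p \<and> q) (gen_embed y * gen_embed x)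
    - gen_embed (bms_bracket x y)"

abbreviation gen_relator :: "bms_gen \<Rightarrow> bms_gen \<Rightarrow> bms_gen list \<Rightarrow>\<^sub>0 complex"
  where "gen_relator x y \<equiv> relator (gen_odd x) (bms_basis x) (gen_odd y) (bms_basis y)"

lemma relator_linear:
  "relator p (x + x') q y = relator p x q y + relator p x' q y"
  "relator p x q (y + y') = relator p x q y + relator p x q y'"
  "relator p (c *\<^sub>C x) q y = c *\<^sub>C relator p x q y"
  "relator p x q (c *\<^sub>C y) = c *\<^sub>C relator p x q y"
  "relator p 0 q y = 0" "relator p x q 0 = 0"
proof -
  have minus: "c *\<^sub>C (u - v) = c *\<^sub>C u - c *\<^sub>C v" for u v :: "bms_gen list \<Rightarrow>\<^sub>0 complex"
    by (metis diff_conv_add_uminus scaleC_add_right scaleC_uminus_right)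
  show "relator p (x + x') q y = relator p x q y + relator p x' q y"
    "relator p x q (y + y') = relator p x q y + relator p x q y'"
    "relator p (c *\<^sub>C x) q y = c *\<^sub>C relator p x q y"
    "relator p x q (c *\<^sub>C y) = c *\<^sub>C relator p x q y"
    "relator p 0 q y = 0" "relator p x q 0 = 0"
    by (simp_all add: relator_def super_sign_def bms_bracket_linear bms_bracket_zero gen_embed_simps
        algebra_simps scaleC_mult_left scaleC_mult_right minus scaleC_add_right scaleC_uminus_right)
qed

lemma bms_basis_parity: "bms_basis g \<in> parity_part (gen_odd g)"
  by (auto simp: parity_part_bms_def support_iff coeff_gen split: if_splits)

lemma gen_bracket_parity: "gen_bracket x y \<in> parity_part (gen_odd x \<noteq> gen_odd y)"
  using bms_bracket_parity by (simp add: parity_part_bms_def)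

lemma gen_relator_skew:
  "gen_relator x y = - super_sign (gen_odd x \<and> gen_odd y) (gen_relator y x)"
proof -
  have "gen_bracket x y = - super_sign (gen_odd x \<and> gen_odd y) (gen_bracket y x)"
    using gen_bracket_skew[of x y] by (simp add: super_sign_koszul)
  then show ?thesis
    by (auto simp: relator_def super_sign_def bms_bracket_gen gen_embed_simps)
qed

text \<open>On the left all words of length three cancel. What remains are supercommutators of a
  bracket with the third letter; each is a relator plus a double bracket, and the double brackets
  cancel by the super Jacobi identity. The right side thus involves only shorter words.\<close>

lemma relator_jacobi:
  assumes "x \<in> parity_part p" "y \<in> parity_part q" "z \<in> parity_part s"
  shows "relator p x q y * gen_embed z
      + super_sign (p \<and> q) (gen_embed y * relator p x s z)
      + super_sign (p \<and> (q \<noteq> s)) (relator q y s z * gen_embed x)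
      - gen_embed x * relator q y s z
      - super_sign (q \<and> s) (relator p x s z * gen_embed y)
      - super_sign (s \<and> (p \<noteq> q)) (gen_embed z * relator p x q y)
    = relator p x (q \<noteq> s) (bms_bracket y z) - relator (p \<noteq> q) (bms_bracket x y) s z
      - super_sign (p \<and> q) (relator q y (p \<noteq> s) (bms_bracket x z))"
proof -
  have "bms_bracket x (bms_bracket y z)
      = bms_bracket (bms_bracket x y) z + super_sign (p \<and> q) (bms_bracket y (bms_bracket x z))"
    using bracket_jacobi[OF assms] by (simp add: lie_bracket_bms_def super_sign_koszul)
  then have *: "gen_embed (bms_bracket x (bms_bracket y z)) = gen_embed (bms_bracket (bms_bracket x y) z)
      + super_sign (p \<and> q) (gen_embed (bms_bracket y (bms_bracket x z)))"
    by (simp add: super_sign_def gen_embed_simps)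
  show ?thesis
    unfolding relator_def *
    by (cases p; cases q; cases s) (simp_all add: super_sign_def algebra_simps)
qed

section \<open>Straightening of words\<close>

text \<open>In a sorted word the generators outside the Borel subalgebra precede those in it.\<close>

fun gen_rank :: "bms_gen \<Rightarrow> nat" where
  "gen_rank (Lgen n) = (if n < 0 then 0 else 3)"
| "gen_rank (Qgen k) = (if k < 0 then 1 else 4)"
| "gen_rank (Mgen n) = (if n < 0 then 2 else 5)"
| "gen_rank C1gen = 6"
| "gen_rank C2gen = 7"

fun gen_index :: "bms_gen \<Rightarrow> int" where
  "gen_index (Lgen n) = n"
| "gen_index (Qgen k) = k"
| "gen_index (Mgen n) = n"
| "gen_index _ = 0"

instantiation bms_gen :: linorder
begin

definition less_eq_bms_gen :: "bms_gen \<Rightarrow> bms_gen \<Rightarrow> bool" where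
  "x \<le> y \<longleftrightarrow> gen_rank x < gen_rank y \<or> gen_rank x = gen_rank y \<and> gen_index x \<le> gen_index y"

definition less_bms_gen :: "bms_gen \<Rightarrow> bms_gen \<Rightarrow> bool" where
  "x < y \<longleftrightarrow> gen_rank x < gen_rank y \<or> gen_rank x = gen_rank y \<and> gen_index x < gen_index y"

instance
proof
  fix x y z :: bms_gen
  show "x \<le> y \<Longrightarrow> y \<le> x \<Longrightarrow> x = y"
    by (cases x; cases y) (auto simp: less_eq_bms_gen_def split: if_splits)
qed (auto simp: less_eq_bms_gen_def less_bms_gen_def)

end

abbreviation borel_gens :: "bms_gen set"
  where "borel_gens \<equiv> cartan_gens \<union> positive_gens"

lemma borel_gens_iff: "g \<in> borel_gens \<longleftrightarrow> gen_rank g \<ge> 3"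
  by (cases g) (auto simp: cartan_gens_def positive_gens_def)

lemma borel_gens_upward: "g \<in> borel_gens \<Longrightarrow> g \<le> h \<Longrightarrow> h \<in> borel_gens"
  unfolding borel_gens_iff less_eq_bms_gen_def by auto

lemma gen_bracket_borel:
  assumes "x \<in> borel_gens" "y \<in> borel_gens"
  shows "bms_support (gen_bracket x y) \<subseteq> positive_gens"
proof -
  have "bms_support (bms_basis g) \<subseteq> {g}" for g
    by (auto simp: support_iff coeff_gen split: if_splits)
  then have "bms_support (gen_bracket x y) \<subseteq> borel_gens"
    "\<And>g. g \<in> cartan_gens \<Longrightarrow> bms_coeff (gen_bracket x y) g = 0"
    using bms_bracket_borel[of "bms_basis x" "bms_basis y"] assms unfolding bms_bracket_gen
    by blast+
  then show ?thesis
    by (auto simp: support_iff)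
qed

text \<open>A repeated odd letter counts as a descent because \<open>x x = - x x + [x, x]\<close>:
  its square is half a bracket and must not occur in a normal word.\<close>

definition inverted :: "bms_gen \<Rightarrow> bms_gen \<Rightarrow> bool"
  where "inverted x y \<longleftrightarrow> x > y \<or> x = y \<and> gen_odd x"

definition descent :: "bms_gen list \<Rightarrow> nat \<Rightarrow> bool"
  where "descent w i \<longleftrightarrow> Suc i < length w \<and> inverted (w ! i) (w ! Suc i)"

fun inversions :: "bms_gen list \<Rightarrow> nat" where
  "inversions [] = 0"
| "inversions (x # w) = length (filter (\<lambda>y. y < x) w) + inversions w"

lemma inversions_swap:
  "y < x \<Longrightarrow> inversions (a @ y # x # b) < inversions (a @ x # y # b)"
  by (induction a) auto

lemma descent_append:
  assumes "descent w i"
  obtains a x y b where "w = a @ x # y # b" "inverted x y" "length a = i"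
proof (rule that)
  show "w = take i w @ w ! i # w ! Suc i # drop (Suc (Suc i)) w"
    using assms by (metis Cons_nth_drop_Suc Suc_lessD append_take_drop_id descent_def)
qed (use assms in \<open>auto simp: descent_def\<close>)

lemma descent_appendI: "inverted x y \<Longrightarrow> descent (a @ x # y # b) (length a)"
  by (simp add: descent_def nth_append)

text \<open>Bracket terms are shorter but can have more inversions, hence length comes first. A swap
  of distinct letters keeps the length and removes an inversion; the square of an odd letter only
  produces shorter words, so \<open>inversions\<close> ignores equal letters.\<close>

definition word_less :: "(bms_gen list \<times> bms_gen list) set"
  where "word_less = measures [length, inversions]"

lemma wf_word_less: "wf word_less"
  by (simp add: word_less_def)

lemma word_less_iff:
  "(v, w) \<in> word_less \<longleftrightarrow> length v < length w \<or> length v = length w \<and> inversions v < inversions w"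
  by (simp add: word_less_def)

definition normal_word :: "bms_gen list \<Rightarrow> bool"
  where "normal_word w \<longleftrightarrow> (\<forall>i. \<not> descent w i) \<and> set w \<inter> borel_gens = {}"

text \<open>The value at a word of the linear functional that is \<open>\<phi>\<close> on normal words and respects
  the relations of the Verma module of character \<open>\<chi>\<close>, computed by straightening
  the leftmost descent.\<close>

function straighten :: "(bms_gen \<Rightarrow> complex) \<Rightarrow> (bms_gen list \<Rightarrow> complex) \<Rightarrow> bms_gen list \<Rightarrow> complex"
  where
  "straighten \<chi> \<phi> w =
    (if \<exists>i. descent w i then
      let i = LEAST i. descent w i; x = w ! i; y = w ! Suc i; a = take i w; b = drop (Suc (Suc i)) w;
        t = (\<Sum>g \<in> bms_support (gen_bracket x y).
          bms_coeff (gen_bracket x y) g * straighten \<chi> \<phi> (a @ g # b))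
      in if y < x then koszul (gen_odd x) (gen_odd y) * straighten \<chi> \<phi> (a @ y # x # b) + t
        else t / 2
    else if w \<noteq> [] \<and> last w \<in> borel_gens then \<chi> (last w) * straighten \<chi> \<phi> (butlast w)
    else \<phi> w)"
  by auto

termination
proof (relation "inv_image word_less (\<lambda>(_, _, w). w)")
  show "wf (inv_image word_less (\<lambda>(_, _, w). w))"
    by (intro wf_inv_image wf_word_less)
next
  fix \<chi> :: "bms_gen \<Rightarrow> complex" and \<phi> :: "bms_gen list \<Rightarrow> complex" and w i x y a b
  assume "\<exists>i. descent w i" and i: "i = (LEAST i. descent w i)"
    and *: "x = w ! i" "y = w ! Suc i" "a = take i w" "b = drop (Suc (Suc i)) w"
  then have "descent w i"
    by (metis LeastI)
  then have w: "w = a @ x # y # b"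
    using * by (metis Cons_nth_drop_Suc Suc_lessD append_take_drop_id descent_def)
  show "((\<chi>, \<phi>, a @ g # b), \<chi>, \<phi>, w) \<in> inv_image word_less (\<lambda>(_, _, w). w)" for g
    by (simp add: word_less_iff w)
  show "((\<chi>, \<phi>, a @ y # x # b), \<chi>, \<phi>, w) \<in> inv_image word_less (\<lambda>(_, _, w). w)" if "y < x"
    using inversions_swap[OF that] by (simp add: word_less_iff w)
next
  fix \<chi> :: "bms_gen \<Rightarrow> complex" and \<phi> :: "bms_gen list \<Rightarrow> complex" and w :: "bms_gen list"
  assume "w \<noteq> [] \<and> last w \<in> borel_gens"
  then show "((\<chi>, \<phi>, butlast w), \<chi>, \<phi>, w) \<in> inv_image word_less (\<lambda>(_, _, w). w)"
    by (simp add: word_less_iff)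
qed

declare straighten.simps [simp del]

text \<open>The products \<open>a t b\<close> with \<open>t\<close> a relator and \<open>a\<close>,
  \<open>b\<close> words span the two-sided ideal of relations, so respecting the relations means
  that this vanishes for all relators \<open>t\<close>.\<close>

definition straighten_ext ::
  "(bms_gen \<Rightarrow> complex) \<Rightarrow> (bms_gen list \<Rightarrow> complex) \<Rightarrow> bms_gen list \<Rightarrow>
    (bms_gen list \<Rightarrow>\<^sub>0 complex) \<Rightarrow> bms_gen list \<Rightarrow> complex"
  where "straighten_ext \<chi> \<phi> a t b = linear_extension (straighten \<chi> \<phi>)
    (Poly_Mapping.single a 1 * t * Poly_Mapping.single b 1)"

lemma straighten_ext_linear:
  "straighten_ext \<chi> \<phi> a (s + t) b = straighten_ext \<chi> \<phi> a s b + straighten_ext \<chi> \<phi> a t b"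
  "straighten_ext \<chi> \<phi> a (- t) b = - straighten_ext \<chi> \<phi> a t b"
  "straighten_ext \<chi> \<phi> a (s - t) b = straighten_ext \<chi> \<phi> a s b - straighten_ext \<chi> \<phi> a t b"
  "straighten_ext \<chi> \<phi> a (c *\<^sub>C t) b = c * straighten_ext \<chi> \<phi> a t b"
  "straighten_ext \<chi> \<phi> a 0 b = 0"
  by (simp_all add: straighten_ext_def distrib_left distrib_right left_diff_distrib
      right_diff_distrib scaleC_mult_left scaleC_mult_right linear_extension_simps)

lemma straighten_ext_super_sign:
  "straighten_ext \<chi> \<phi> a (super_sign e t) b = super_sign e (straighten_ext \<chi> \<phi> a t b)"
  by (simp add: super_sign_def straighten_ext_linear)

lemma straighten_ext_single:
  "straighten_ext \<chi> \<phi> a (Poly_Mapping.single v c) b = c * straighten \<chi> \<phi> (a @ v @ b)"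
  by (simp add: straighten_ext_def mult_single plus_list_def linear_extension_single)

lemma straighten_ext_mult:
  "straighten_ext \<chi> \<phi> a (Poly_Mapping.single v 1 * t) b = straighten_ext \<chi> \<phi> (a @ v) t b"
  "straighten_ext \<chi> \<phi> a (t * Poly_Mapping.single v 1) b = straighten_ext \<chi> \<phi> a t (v @ b)"
proof -
  have "Poly_Mapping.single (a @ v) 1 = Poly_Mapping.single a 1 * Poly_Mapping.single v (1::complex)"
    "Poly_Mapping.single (v @ b) 1 = Poly_Mapping.single v 1 * Poly_Mapping.single b (1::complex)"
    by (simp_all add: mult_single plus_list_def)
  then show "straighten_ext \<chi> \<phi> a (Poly_Mapping.single v 1 * t) b = straighten_ext \<chi> \<phi> (a @ v) t b"
    "straighten_ext \<chi> \<phi> a (t * Poly_Mapping.single v 1) b = straighten_ext \<chi> \<phi> a t (v @ b)"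
    by (simp_all add: straighten_ext_def mult.assoc)
qed

lemma straighten_ext_embed:
  "straighten_ext \<chi> \<phi> a (gen_embed x) b
    = (\<Sum>g \<in> bms_support x. bms_coeff x g * straighten \<chi> \<phi> (a @ g # b))"
proof -
  have "straighten_ext \<chi> \<phi> a (sum f A) b = (\<Sum>i \<in> A. straighten_ext \<chi> \<phi> a (f i) b)"
    for f and A :: "bms_gen set"
    by (induction A rule: infinite_finite_induct) (simp_all add: straighten_ext_linear)
  then show ?thesis
    by (simp add: gen_embed_def straighten_ext_single)
qed

lemma straighten_ext_relator:
  "straighten_ext \<chi> \<phi> a (gen_relator x y) b = straighten \<chi> \<phi> (a @ x # y # b)
    - koszul (gen_odd x) (gen_odd y) * straighten \<chi> \<phi> (a @ y # x # b)
    - straighten_ext \<chi> \<phi> a (gen_embed (gen_bracket x y)) b"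
  by (simp add: relator_def bms_bracket_gen gen_embed_simps mult_single plus_list_def
      straighten_ext_linear straighten_ext_super_sign straighten_ext_single koszul_def super_sign_def)

text \<open>The defining recursion of \<open>straighten\<close>, read as the vanishing of one
  relator. At this stage it is available only at the leftmost descent; confluence extends it to
  every context.\<close>

lemma straighten_leftmost:
  assumes "descent w i"
  obtains a x y b where "w = a @ x # y # b" "inverted x y"
    "\<And>j. descent w j \<Longrightarrow> length a \<le> j"
    "straighten_ext \<chi> \<phi> a (gen_relator x y) b = 0"
proof -
  define i0 where "i0 = (LEAST i. descent w i)"
  have i0: "descent w i0"
    unfolding i0_def using assms by (rule LeastI)
  obtain a x y b where w: "w = a @ x # y # b" and xy: "inverted x y" and a: "length a = i0"
    by (rule descent_append[OF i0])
  let ?t = "straighten_ext \<chi> \<phi> a (gen_embed (gen_bracket x y)) b"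
  have "straighten \<chi> \<phi> w =
      (if y < x then koszul (gen_odd x) (gen_odd y) * straighten \<chi> \<phi> (a @ y # x # b) + ?t
        else ?t / 2)"
  proof -
    have parts: "take i0 w = a" "w ! i0 = x" "w ! Suc i0 = y" "drop (Suc (Suc i0)) w = b"
      unfolding w a[symmetric] by (simp_all add: nth_append)
    show ?thesis
      using assms by (subst straighten.simps) (auto simp: Let_def i0_def[symmetric] parts straighten_ext_embed)
  qed
  \<comment> \<open>For a repeated odd letter, the value \<open>t / 2\<close> is the solution of
    \<open>z = - z + t\<close>, which is the vanishing of the relator.\<close>
  moreover have "koszul (gen_odd x) (gen_odd y) = - 1" if "\<not> y < x"
    using xy that by (auto simp: inverted_def koszul_def)
  moreover have "x = y" if "\<not> y < x"
    using xy that by (simp add: inverted_def)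
  ultimately have "straighten_ext \<chi> \<phi> a (gen_relator x y) b = 0"
    unfolding straighten_ext_relator w by (auto simp: field_simps split: if_splits)
  then show ?thesis
    using that[OF w xy] a Least_le[of "descent w", folded i0_def] by blast
qed

lemma straighten_last:
  assumes "\<And>i. \<not> descent (a @ [g]) i" "g \<in> borel_gens"
  shows "straighten \<chi> \<phi> (a @ [g]) = \<chi> g * straighten \<chi> \<phi> a"
proof -
  have "(\<exists>i. descent (a @ [g]) i) = False"
    using assms(1) by simp
  then show ?thesis
    using assms(2) by (subst straighten.simps) (simp only: if_False, simp)
qed

lemma straighten_normal: "normal_word w \<Longrightarrow> straighten \<chi> \<phi> w = \<phi> w"
  unfolding normal_word_def by (subst straighten.simps) (auto dest: last_in_set)

text \<open>The inversions between the two parts are expressed through multisets, so rearranging a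
  factor of a word visibly leaves its inversions with the rest unchanged.\<close>

lemma inversions_append:
  "inversions (u @ v) = inversions u + inversions v
    + (\<Sum>x \<in># mset u. size (filter_mset (\<lambda>y. y < x) (mset v)))"
  by (induction u) (simp_all flip: mset_filter size_mset)

lemma word_less_middle:
  assumes "mset u = mset v" "inversions u < inversions v"
  shows "(a @ u @ b, a @ v @ b) \<in> word_less"
  using assms mset_eq_length[OF assms(1)] by (simp add: word_less_iff inversions_append)

lemma word_less_rearranged:
  assumes "z \<le> y" "y \<le> x"
  shows "y \<noteq> x \<Longrightarrow> (a @ y # x # z # b, a @ x # y # z # b) \<in> word_less"
    "z \<noteq> x \<Longrightarrow> (a @ y # z # x # b, a @ x # y # z # b) \<in> word_less"
    "z \<noteq> y \<Longrightarrow> (a @ x # z # y # b, a @ x # y # z # b) \<in> word_less"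
    "z \<noteq> x \<Longrightarrow> (a @ z # x # y # b, a @ x # y # z # b) \<in> word_less"
proof -
  have *: "z < y \<longleftrightarrow> z \<noteq> y" "y < x \<longleftrightarrow> y \<noteq> x" "z < x \<longleftrightarrow> z \<noteq> x" "\<not> y < z" "\<not> x < y" "\<not> x < z"
    and "z = x \<Longrightarrow> y = x"
    using assms by auto
  then have "y \<noteq> x \<Longrightarrow> inversions [y, x, z] < inversions [x, y, z]"
    "z \<noteq> x \<Longrightarrow> inversions [y, z, x] < inversions [x, y, z]"
    "z \<noteq> y \<Longrightarrow> inversions [x, z, y] < inversions [x, y, z]"
    "z \<noteq> x \<Longrightarrow> inversions [z, x, y] < inversions [x, y, z]"
    by (auto simp: *)
  then show "y \<noteq> x \<Longrightarrow> (a @ y # x # z # b, a @ x # y # z # b) \<in> word_less"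
    "z \<noteq> x \<Longrightarrow> (a @ y # z # x # b, a @ x # y # z # b) \<in> word_less"
    "z \<noteq> y \<Longrightarrow> (a @ x # z # y # b, a @ x # y # z # b) \<in> word_less"
    "z \<noteq> x \<Longrightarrow> (a @ z # x # y # b, a @ x # y # z # b) \<in> word_less"
    using word_less_middle[of "[y, x, z]" "[x, y, z]" a b] word_less_middle[of "[y, z, x]" "[x, y, z]" a b]
      word_less_middle[of "[x, z, y]" "[x, y, z]" a b] word_less_middle[of "[z, x, y]" "[x, y, z]" a b]
    by simp_all
qed

lemma inverted_cases:
  obtains "inverted x y" | "inverted y x" | "x = y" "\<not> gen_odd x"
  unfolding inverted_def by (metis linorder_neqE)

text \<open>Two letters are inverted in one of their two orders unless they are the same even
  letter; in that case super skew symmetry makes the relator its own negative.\<close>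

lemma straighten_ext_gen_relator_flip:
  assumes "\<And>x y. inverted x y \<Longrightarrow> straighten_ext \<chi> \<phi> a (gen_relator x y) b = 0"
  shows "straighten_ext \<chi> \<phi> a (gen_relator x y) b = 0"
proof (cases rule: inverted_cases[of x y])
  case 2
  have "straighten_ext \<chi> \<phi> a (gen_relator x y) b
      = - super_sign (gen_odd x \<and> gen_odd y) (straighten_ext \<chi> \<phi> a (gen_relator y x) b)"
    by (subst gen_relator_skew) (simp only: straighten_ext_linear straighten_ext_super_sign)
  then show ?thesis
    by (simp only: assms[OF 2] super_sign_def) simp
next
  case 3
  then have "straighten_ext \<chi> \<phi> a (gen_relator x y) b = - straighten_ext \<chi> \<phi> a (gen_relator x y) b"
    using gen_relator_skew[of x x] by (metis straighten_ext_linear(2) super_sign_def)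
  then show ?thesis by simp
qed (rule assms)

lemma straighten_ext_relator_parity:
  assumes "\<And>x y. straighten_ext \<chi> \<phi> a (gen_relator x y) b = 0"
    and "X \<in> parity_part p" "Y \<in> parity_part q"
  shows "straighten_ext \<chi> \<phi> a (relator p X q Y) b = 0"
proof (induction X rule: bms_induct)
  case (bms_basis x c)
  have p: "p = gen_odd x"
    using bms_basis assms(2) by (auto simp: parity_part_bms_def)
  show ?case
  proof (induction Y rule: bms_induct)
    case (bms_basis y d)
    have "q = gen_odd y"
      using bms_basis assms(3) by (auto simp: parity_part_bms_def)
    with p show ?case
      by (simp add: relator_linear straighten_ext_linear assms(1))
  qed (auto simp: relator_linear straighten_ext_linear)
qed (simp_all add: relator_linear straighten_ext_linear)

lemma straighten_ext_mult_embed: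
  assumes "\<And>g. g \<in> bms_support z \<Longrightarrow> straighten_ext \<chi> \<phi> a t (c @ g # b) = 0"
  shows "straighten_ext \<chi> \<phi> a (t * Poly_Mapping.single c 1 * gen_embed z) b = 0"
  by (induction z rule: bms_induct)
    (simp_all add: gen_embed_simps distrib_left scaleC_mult_right straighten_ext_linear
      straighten_ext_mult assms)

lemma straighten_ext_embed_mult:
  assumes "\<And>g. g \<in> bms_support z \<Longrightarrow> straighten_ext \<chi> \<phi> (a @ g # c) t b = 0"
  shows "straighten_ext \<chi> \<phi> a (gen_embed z * (Poly_Mapping.single c 1 * t)) b = 0"
  by (induction z rule: bms_induct)
    (simp_all add: gen_embed_simps distrib_right scaleC_mult_left straighten_ext_linear
      straighten_ext_mult assms)

text \<open>Bergman's diamond lemma: disjoint descents commute and overlapping ones are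
  resolved by the Jacobi identity.\<close>

lemma straighten_ext_inverted:
  assumes "inverted x y"
  shows "straighten_ext \<chi> \<phi> a (gen_relator x y) b = 0"
  using assms
proof (induction "a @ x # y # b" arbitrary: a x y b rule: wf_induct_rule[OF wf_word_less])
  case (1 a x y b)
  let ?E = "straighten_ext \<chi> \<phi>" and ?w = "a @ x # y # b"
  have IH: "?E a' (gen_relator x' y') b' = 0"
    if "inverted x' y'" "(a' @ x' # y' # b', ?w) \<in> word_less" for a' x' y' b'
    using 1 that by blast
  have short: "?E a' (gen_relator x' y') b' = 0" if "length a' + length b' < length a + length b"
    for a' x' y' b'
    by (rule straighten_ext_gen_relator_flip, rule IH) (use that in \<open>simp_all add: word_less_iff\<close>)
  obtain a0 x0 y0 b0 where w: "?w = a0 @ x0 # y0 # b0" and inv0: "inverted x0 y0"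
    and left: "\<And>j. descent ?w j \<Longrightarrow> length a0 \<le> j" and zero0: "?E a0 (gen_relator x0 y0) b0 = 0"
    using straighten_leftmost[OF descent_appendI[OF \<open>inverted x y\<close>]] by metis
  have "length a0 \<le> length a"
    using left descent_appendI[OF \<open>inverted x y\<close>] by blast
  \<comment> \<open>The leftmost descent, where the relator vanishes by definition, is the given
    one, overlaps it in one letter, or is disjoint from it.\<close>
  then consider "a = a0" | "length a = Suc (length a0)" | "Suc (length a0) < length a"
    by (metis Suc_lessI append_eq_append_conv le_neq_implies_less w)
  then show ?case
  proof cases
    case 1
    then show ?thesis
      using w zero0 by simp
  next
    case 2
    then have a: "a = a0 @ [x0]" and xb: "y0 = x" "b0 = y # b"
      using w by (auto simp: append_eq_append_conv2 append_eq_Cons_conv)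
    let ?T = "?E a (gen_relator x y) b"
    have order: "x0 \<ge> x" "x \<ge> y" "x0 = x \<Longrightarrow> gen_odd x" "x = y \<Longrightarrow> gen_odd y" "inverted x0 y"
      using inv0 \<open>inverted x y\<close> xb by (auto simp: inverted_def)
    note smaller = word_less_rearranged[OF order(2,1), of a0 b]
    have equal: "x0 = y \<longleftrightarrow> x0 = x \<and> x = y"
      using order by auto
    \<comment> \<open>Rearrangements of the triple \<open>x0\<close>, \<open>x\<close>,
      \<open>y\<close> are smaller unless letters coincide. In the coinciding cases the induction
      hypothesis is silent, and the term is \<open>?T\<close> itself or the known value at the
      leftmost descent.\<close>
    have 1: "?E (a0 @ [x]) (gen_relator x0 y) b = (if x0 = x then ?T else 0)"
      using IH[OF \<open>inverted x0 y\<close>, of "a0 @ [x]" b] smaller(1) by (auto simp: a)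
    have 2: "?E a0 (gen_relator x y) (x0 # b) = 0"
      using IH[OF \<open>inverted x y\<close>, of a0 "x0 # b"] smaller(2) zero0 xb
      by (cases "x0 = y") (auto simp: a equal)
    have 3: "?E a0 (gen_relator x0 y) (x # b) = 0"
      using IH[OF \<open>inverted x0 y\<close>, of a0 "x # b"] smaller(3) zero0 xb
      by (cases "x = y") (auto simp: a)
    have 4: "?E (a0 @ [y]) (gen_relator x0 x) b = (if x0 = y then ?T else 0)"
      using IH[OF inv0, of "a0 @ [y]" b] smaller(4) xb
      by (cases "x0 = y") (auto simp: a equal)
    note par = bms_basis_parity gen_bracket_parity
    have "?E a0 (relator p X q Y) b = 0" if "X \<in> parity_part p" "Y \<in> parity_part q" for p q X Y
      using that by (rule straighten_ext_relator_parity[rotated]) (rule short, simp add: a)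
    note 5 = this[OF par(1) par(2)[of x y]] this[OF par(2)[of x0 x] par(1)] this[OF par(1) par(2)[of x0 y]]
    have zero: "super_sign e (0 :: complex) = 0" for e
      by (simp add: super_sign_def)
    \<comment> \<open>The total coefficient of \<open>?T\<close> is -1 for \<open>x0\<close>
      different from \<open>x\<close>, -2 for \<open>x0 = x\<close> different from \<open>y\<close>,
      and -3 if all three letters agree; it is never 0.\<close>
    have "0 + super_sign (gen_odd x0 \<and> gen_odd x) (if x0 = x then ?T else 0) + 0 - ?T - 0
        - super_sign (gen_odd y \<and> gen_odd x0 \<noteq> gen_odd x) (if x0 = y then ?T else 0) = 0"
      using arg_cong[OF relator_jacobi[OF par(1) par(1) par(1), of x0 x y], of "\<lambda>t. ?E a0 t b"]
      by (simp only: straighten_ext_linear straighten_ext_super_sign gen_embed_simps straighten_ext_mult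
          bms_bracket_gen append_Cons append_Nil zero0[unfolded xb] 1 2 3 4 5 a[symmetric] zero diff_zero)
    then show ?thesis
      using order(3,4) equal by (auto simp: super_sign_def split: if_splits)
  next
    case 3
    define c where "c = drop (Suc (Suc (length a0))) a"
    have a: "a = a0 @ x0 # y0 # c" and b0: "b0 = c @ x # y # b"
    proof -
      have "take (Suc (Suc (length a0))) ?w = a0 @ [x0, y0]"
        unfolding w by simp
      then show "a = a0 @ x0 # y0 # c"
        unfolding c_def using 3 append_take_drop_id[of "Suc (Suc (length a0))" a] by simp
      then show "b0 = c @ x # y # b"
        using w by simp
    qed
    let ?T = "?E a (gen_relator x y) b" and ?c = "Poly_Mapping.single c (1 :: complex)"
    have 1: "?E a0 (gen_relator x0 y0) (c @ y # x # b) = 0"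
    proof (cases "x = y")
      case False
      then show ?thesis
        using IH[OF inv0, of a0 "c @ y # x # b"] \<open>inverted x y\<close>
          word_less_middle[of "[y, x]" "[x, y]" "a0 @ x0 # y0 # c" b]
        by (auto simp: a inverted_def)
    qed (use zero0 b0 in simp)
    have 2: "?E (a0 @ y0 # x0 # c) (gen_relator x y) b = (if x0 = y0 then ?T else 0)"
      using IH[OF \<open>inverted x y\<close>, of "a0 @ y0 # x0 # c" b] inv0
        word_less_middle[of "[y0, x0]" "[x0, y0]" a0 "c @ x # y # b"]
      by (auto simp: a inverted_def)
    have embed: "gen_relator x y = Poly_Mapping.single [x, y] 1
        - super_sign (gen_odd x \<and> gen_odd y) (Poly_Mapping.single [y, x] 1) - gen_embed (gen_bracket x y)"
      for x y
      by (simp add: relator_def gen_embed_simps bms_bracket_gen mult_single plus_list_def)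
    \<comment> \<open>The product of the two relators is evaluated twice. Expanding the right one
      leaves the left one at the leftmost descent or in smaller words, which gives 0; expanding the
      left one gives \<open>?T\<close>, or twice \<open>?T\<close> if \<open>x0\<close> is a
      repeated odd letter.\<close>
    have "?E a0 (gen_relator x0 y0 * ?c * gen_relator x y) b = 0"
    proof -
      have "?E a0 (gen_relator x0 y0 * ?c * gen_embed (gen_bracket x y)) b = 0"
        by (intro straighten_ext_mult_embed short) (simp add: a)
      then show ?thesis
        unfolding embed[of x y] using zero0 1
        by (auto simp: right_diff_distrib straighten_ext_linear straighten_ext_mult b0 super_sign_def)
    qed
    moreover have "?E a0 (gen_relator x0 y0 * (?c * gen_relator x y)) b
        = ?T - super_sign (gen_odd x0 \<and> gen_odd y0) (if x0 = y0 then ?T else 0)"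
    proof -
      have "?E a0 (gen_embed (gen_bracket x0 y0) * (?c * gen_relator x y)) b = 0"
        by (intro straighten_ext_embed_mult short) (simp add: a)
      then show ?thesis
        unfolding embed[of x0 y0] using 2
        by (auto simp: left_diff_distrib straighten_ext_linear straighten_ext_mult super_sign_def a)
    qed
    ultimately show ?thesis
      using inv0 by (auto simp: mult.assoc super_sign_def inverted_def split: if_splits)
  qed
qed

lemma straighten_ext_gen_relator: "straighten_ext \<chi> \<phi> a (gen_relator x y) b = 0"
  by (rule straighten_ext_gen_relator_flip, rule straighten_ext_inverted)

lemma straighten_swap:
  "straighten \<chi> \<phi> (a @ x # y # b) = koszul (gen_odd x) (gen_odd y) * straighten \<chi> \<phi> (a @ y # x # b)
    + (\<Sum>g \<in> bms_support (gen_bracket x y). bms_coeff (gen_bracket x y) g * straighten \<chi> \<phi> (a @ g # b))"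
  using straighten_ext_gen_relator[of \<chi> \<phi> a x y b]
  by (simp add: straighten_ext_relator straighten_ext_embed algebra_simps)

text \<open>A descent away from the last letter is resolved in the same way with and without
  \<open>g\<close>. If \<open>g\<close> takes part in the descent, its neighbour is at least
  \<open>g\<close>, hence also a Borel letter; their bracket lies in the positive part, where
  \<open>\<chi>\<close> vanishes.\<close>

lemma straighten_append_borel:
  assumes chi: "\<And>g. g \<in> positive_gens \<Longrightarrow> \<chi> g = 0" and "g \<in> borel_gens"
  shows "straighten \<chi> \<phi> (a @ [g]) = \<chi> g * straighten \<chi> \<phi> a"
  using assms(2)
proof (induction "a @ [g]" arbitrary: a g rule: wf_induct_rule[OF wf_word_less])
  case (1 a g)
  let ?N = "straighten \<chi> \<phi>"
  have IH: "?N (a' @ [g']) = \<chi> g' * ?N a'" if "g' \<in> borel_gens" "(a' @ [g'], a @ [g]) \<in> word_less" for a' g'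
    using 1 that by blast
  show ?case
  proof (cases "\<exists>i. descent (a @ [g]) i")
    case False
    then show ?thesis
      using 1 straighten_last[of a g \<chi> \<phi>] by blast
  next
    case True
    then obtain u x y b where w: "a @ [g] = u @ x # y # b" and xy: "inverted x y"
      using descent_append by metis
    show ?thesis
    proof (cases b rule: rev_cases)
      case Nil
      with w have a: "a = u @ [x]" and g: "g = y"
        by auto
      have "y \<le> x"
        using xy by (auto simp: inverted_def)
      then have x: "x \<in> borel_gens"
        using 1 borel_gens_upward g by blast
      have short: "?N (u @ [z]) = \<chi> z * ?N u" if "z \<in> borel_gens" for z
        using that by (intro IH) (simp_all add: word_less_iff a)
      have bracket: "bms_coeff (gen_bracket x y) z * ?N (u @ [z]) = 0"
        if "z \<in> bms_support (gen_bracket x y)" for z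
        using gen_bracket_borel[OF x, of y] that 1 g short[of z] chi[of z] by auto
      \<comment> \<open>An odd Borel letter is positive, so both Koszul signs and squares of odd
        letters are harmless.\<close>
      have odd: "\<chi> z = 0" if "gen_odd z" "z \<in> borel_gens" for z
        using that chi by (cases z) (auto simp: cartan_gens_def)
      have "?N (u @ [x, y]) = koszul (gen_odd x) (gen_odd y) * ?N (u @ [y, x])"
        using straighten_swap[of \<chi> \<phi> u x y "[]"] bracket by simp
      moreover have "?N (u @ [y, x]) = \<chi> x * (\<chi> y * ?N u)" if "y < x"
      proof -
        have "((u @ [y]) @ [x], a @ [g]) \<in> word_less"
          using inversions_swap[OF that, of u "[]"] by (simp add: word_less_iff a g)
        from IH[OF x this] short[of y] show ?thesis
          using 1 g by simp
      qed
      ultimately have "?N (u @ [x, y]) = \<chi> y * (\<chi> x * ?N u)"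
        using xy odd[OF _ x] odd[of y] 1 g
        by (cases "y < x") (auto simp: inverted_def koszul_def)
      then show ?thesis
        using short[OF x] by (simp add: a g)
    next
      case (snoc b' h)
      with w have a: "a = u @ x # y # b'" and h: "h = g"
        by auto
      have bracket: "bms_coeff (gen_bracket x y) z * ?N (u @ z # b' @ [g])
          = \<chi> g * (bms_coeff (gen_bracket x y) z * ?N (u @ z # b'))" for z
        using IH[of g "u @ z # b'"] 1 by (simp add: word_less_iff a)
      have swap: "?N (u @ y # x # b' @ [g]) = \<chi> g * ?N (u @ y # x # b')" if "y < x"
        using IH[of g "u @ y # x # b'"] 1 inversions_swap[OF that, of u "b' @ [g]"]
        by (simp add: word_less_iff a)
      show ?thesis
      proof (cases "y < x")
        case True
        then show ?thesis
          using straighten_swap[of \<chi> \<phi> u x y "b' @ [g]"] straighten_swap[of \<chi> \<phi> u x y b'] swap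
          by (simp add: a bracket sum_distrib_left algebra_simps)
      next
        case False
        then have "x = y" "koszul (gen_odd x) (gen_odd y) = - 1"
          using xy by (auto simp: inverted_def koszul_def)
        moreover have "(\<Sum>z \<in> bms_support (gen_bracket x y). bms_coeff (gen_bracket x y) z * ?N (u @ z # b' @ [g]))
            = \<chi> g * (\<Sum>z \<in> bms_support (gen_bracket x y). bms_coeff (gen_bracket x y) z * ?N (u @ z # b'))"
          by (simp add: bracket sum_distrib_left)
        ultimately have "2 * ?N (a @ [g]) = \<chi> g * (2 * ?N a)"
          using straighten_swap[of \<chi> \<phi> u x y "b' @ [g]"] straighten_swap[of \<chi> \<phi> u x y b']
          by (simp add: a)
        then show ?thesis
          by simp
      qed
    qed
  qed
qed

section \<open>The enveloping algebra and the Verma module\<close>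

global_interpretation complex_vs: vector_space "scaleC :: complex \<Rightarrow> 'a \<Rightarrow> 'a::complex_space"
  by unfold_locales (rule scaleC_add_right scaleC_add_left scaleC_scaleC scaleC_one)+

lemma span_linear_image:
  assumes "x \<in> complex_vs.span A" "\<And>a. a \<in> A \<Longrightarrow> f a \<in> complex_vs.span B"
    and "\<And>a b. f (a + b) = f a + f b" "\<And>c a. f (c *\<^sub>C a) = c *\<^sub>C f a"
  shows "f x \<in> complex_vs.span B"
proof -
  have "f 0 = 0"
    using assms(4)[of 0 0] by simp
  then have "complex_vs.subspace {x. f x \<in> complex_vs.span B}"
    unfolding complex_vs.subspace_def
    by (simp add: assms(3,4) complex_vs.span_add complex_vs.span_scale complex_vs.span_zero)
  then show ?thesis
    using complex_vs.span_induct[OF assms(1), of "\<lambda>x. f x \<in> complex_vs.span B"] assms(2) by simp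
qed

lemma span_mult_left:
  fixes u :: "'a::complex_algebra"
  assumes "x \<in> complex_vs.span A" "\<And>a. a \<in> A \<Longrightarrow> u * a \<in> complex_vs.span B"
  shows "u * x \<in> complex_vs.span B"
  using assms by (rule span_linear_image) (simp_all add: distrib_left scaleC_mult_right)

lemma span_mult_right:
  fixes u :: "'a::complex_algebra"
  assumes "x \<in> complex_vs.span A" "\<And>a. a \<in> A \<Longrightarrow> a * u \<in> complex_vs.span B"
  shows "x * u \<in> complex_vs.span B"
  using assms by (rule span_linear_image) (simp_all add: distrib_right scaleC_mult_left)

abbreviation uea_gen :: "bms_gen \<Rightarrow> bms uea"
  where "uea_gen g \<equiv> uea_of (bms_basis g)"

definition word_eval :: "bms_gen list \<Rightarrow> bms uea"
  where "word_eval w = prod_list (map uea_gen w)"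

lemma word_eval_simps [simp]:
  "word_eval [] = 1" "word_eval (g # w) = uea_gen g * word_eval w"
  "word_eval (v @ w) = word_eval v * word_eval w"
  by (simp_all add: word_eval_def)

lemma uea_gen_swap:
  "uea_gen x * uea_gen y = koszul (gen_odd x) (gen_odd y) *\<^sub>C (uea_gen y * uea_gen x)
    + uea_of (gen_bracket x y)"
  using uea_of_bracket[OF bms_basis_parity[of x] bms_basis_parity[of y]]
  by (simp add: lie_bracket_bms_def bms_bracket_gen algebra_simps)

lemma uea_of_zero: "uea_of 0 = 0"
  using uea_of_scale[of 0 0] by simp

lemma uea_of_expand:
  "uea_of x = (\<Sum>g \<in> bms_support x. bms_coeff x g *\<^sub>C uea_gen g)"
proof -
  have *: "uea_of (sum f A) = (\<Sum>g \<in> A. uea_of (f g))" for f and A :: "bms_gen set"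
    by (induction A rule: infinite_finite_induct) (simp_all add: uea_of_zero uea_of_add)
  have coeff_sum: "bms_coeff (sum f A) h = (\<Sum>g \<in> A. bms_coeff (f g) h)" for f h and A :: "bms_gen set"
    by (induction A rule: infinite_finite_induct) simp_all
  have "x = (\<Sum>g \<in> bms_support x. bms_coeff x g *\<^sub>C bms_basis g)"
    by (rule bms_eqI) (auto simp: coeff_sum coeff_gen support_iff if_distrib cong: if_cong)
  then have "uea_of x = uea_of (\<Sum>g \<in> bms_support x. bms_coeff x g *\<^sub>C bms_basis g)"
    by simp
  then show ?thesis
    by (simp add: * uea_of_scale)
qed

lemma abs_uea_add: "abs_uea (s + t) = abs_uea s + abs_uea t"
  by (simp add: plus_uea.abs_eq)

lemma abs_uea_single: "abs_uea (Poly_Mapping.single w c) = c *\<^sub>C prod_list (map uea_of w)"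
proof (induction w arbitrary: c)
  case Nil
  have "abs_uea (Poly_Mapping.single [] c) = abs_uea (Poly_Mapping.single [] c * 1)"
    by simp
  then show ?case
    by (simp add: scaleC_uea.abs_eq one_uea_def)
next
  case (Cons x w)
  have "Poly_Mapping.single (x # w) c = Poly_Mapping.single [x] 1 * Poly_Mapping.single w c"
    by (simp add: mult_single plus_list_def)
  then show ?case
    by (simp add: Cons scaleC_mult_right uea_of_def flip: times_uea.abs_eq)
qed

lemma uea_span_words: "u \<in> complex_vs.span (range word_eval)"
proof (induct u)
  case (1 t)
  have "prod_list (map uea_of w) \<in> complex_vs.span (range word_eval)" for w :: "bms list"
  proof (induction w)
    case Nil
    show ?case
      using complex_vs.span_base[OF rangeI, of word_eval "[]"] by simp
  next
    case (Cons x w)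
    have "uea_gen g * prod_list (map uea_of w) \<in> complex_vs.span (range word_eval)" for g
    proof (rule span_mult_left[OF Cons])
      fix a assume "a \<in> range word_eval"
      then obtain v where "a = word_eval v" by blast
      then have "uea_gen g * a = word_eval (g # v)"
        by simp
      then show "uea_gen g * a \<in> complex_vs.span (range word_eval)"
        by (metis complex_vs.span_base rangeI)
    qed
    then show ?case
      by (simp add: uea_of_expand[of x] sum_distrib_right scaleC_mult_left
          complex_vs.span_sum complex_vs.span_scale)
  qed
  then show ?case
    by (induction t rule: poly_mapping_keys_induct)
      (simp_all add: abs_uea_add abs_uea_single complex_vs.span_add complex_vs.span_scale
        complex_vs.span_zero flip: zero_uea_def)
qed

section \<open>Functionals on the enveloping algebra\<close>

definition gen_char :: "complex \<Rightarrow> complex \<Rightarrow> complex \<Rightarrow> complex \<Rightarrow> bms_gen \<Rightarrow> complex"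
  where "gen_char h1 h2 c1 c2 g = (if g = Lgen 0 then h1 else if g = Mgen 0 then h2
    else if g = C1gen then c1 else if g = C2gen then c2 else 0)"

lemma gen_char_positive: "g \<in> positive_gens \<Longrightarrow> gen_char h1 h2 c1 c2 g = 0"
  by (auto simp: gen_char_def positive_gens_def)

definition word_functional ::
  "(bms_gen \<Rightarrow> complex) \<Rightarrow> (bms_gen list \<Rightarrow> complex) \<Rightarrow> bms uea \<Rightarrow> complex"
  where "word_functional \<chi> \<phi> u = linear_extension (straighten \<chi> \<phi>) (free_eval gen_embed (rep_uea u))"

text \<open>The outer factors \<open>a\<close> and \<open>b\<close> stay arbitrary so that the
  induction passes through two-sided multiples. This makes \<open>word_functional\<close>
  independent of the chosen representative.\<close>

lemma linear_extension_uea_ideal: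
  assumes "t \<in> uea_ideal"
  shows "linear_extension (straighten \<chi> \<phi>) (a * free_eval gen_embed t * b) = 0"
  using assms
proof (induction arbitrary: a b rule: uea_ideal.induct)
  case (supercommutator x p y q)
  have "linear_extension (straighten \<chi> \<phi>) (a * relator p x q y * b) = 0"
  proof (induction a rule: poly_mapping_keys_induct)
    case (single v c)
    show ?case
    proof (induction b rule: poly_mapping_keys_induct)
      case (single w d)
      have "straighten_ext \<chi> \<phi> v (relator p x q y) w = 0"
        using straighten_ext_gen_relator supercommutator by (rule straighten_ext_relator_parity)
      moreover have "Poly_Mapping.single v c = c *\<^sub>C Poly_Mapping.single v (1 :: complex)"
        "Poly_Mapping.single w d = d *\<^sub>C Poly_Mapping.single w (1 :: complex)"
        by (simp_all add: scaleC_single scaleC_complex_def)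
      ultimately show ?case
        by (simp add: straighten_ext_def scaleC_mult_left scaleC_mult_right linear_extension_simps)
    qed (simp_all add: distrib_left linear_extension_simps)
  qed (simp_all add: distrib_right linear_extension_simps)
  moreover have "free_eval gen_embed (Poly_Mapping.single [x, y] 1 - Poly_Mapping.single [y, x] (koszul p q)
      - Poly_Mapping.single [lie_bracket x y] 1) = relator p x q y"
    by (simp add: free_eval_diff free_eval_single relator_def scaleC_one super_sign_koszul lie_bracket_bms_def)
  ultimately show ?case
    by simp
next
  case (add s t)
  then show ?case
    by (simp add: free_eval_add distrib_left distrib_right linear_extension_simps)
next
  case (mult t c d)
  then show ?case
    by (simp add: free_eval_mult) (metis mult.assoc)
qed (simp_all add: free_eval_diff free_eval_single gen_embed_simps scaleC_one free_eval_zero)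

lemma word_functional_abs:
  "word_functional \<chi> \<phi> (abs_uea t) = linear_extension (straighten \<chi> \<phi>) (free_eval gen_embed t)"
proof -
  have "uea_rel (rep_uea (abs_uea t)) t"
    using uea.abs_eq_iff Quotient3_abs_rep[OF Quotient3_uea] by blast
  then have "linear_extension (straighten \<chi> \<phi>) (1 * free_eval gen_embed (rep_uea (abs_uea t) - t) * 1) = 0"
    unfolding uea_rel_def by (rule linear_extension_uea_ideal)
  then show ?thesis
    by (simp add: word_functional_def free_eval_diff linear_extension_simps)
qed

lemma word_functional_linear:
  "word_functional \<chi> \<phi> (u + v) = word_functional \<chi> \<phi> u + word_functional \<chi> \<phi> v"
  "word_functional \<chi> \<phi> (c *\<^sub>C u) = c * word_functional \<chi> \<phi> u"
proof -
  show "word_functional \<chi> \<phi> (u + v) = word_functional \<chi> \<phi> u + word_functional \<chi> \<phi> v"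
    by (induct u, induct v) (simp add: plus_uea.abs_eq word_functional_abs free_eval_add linear_extension_simps)
  show "word_functional \<chi> \<phi> (c *\<^sub>C u) = c * word_functional \<chi> \<phi> u"
    by (induct u) (simp add: scaleC_uea.abs_eq word_functional_abs free_eval_mult free_eval_single
        scaleC_mult_left linear_extension_simps)
qed

lemma word_functional_word: "word_functional \<chi> \<phi> (word_eval w) = straighten \<chi> \<phi> w"
proof -
  have "prod_list (map gen_embed (map bms_basis w)) = Poly_Mapping.single w 1"
    by (induction w) (simp_all add: gen_embed_simps mult_single plus_list_def single_Nil_one)
  moreover have "word_eval w = abs_uea (Poly_Mapping.single (map bms_basis w) 1)"
    by (simp add: abs_uea_single scaleC_one word_eval_def comp_def)
  ultimately show ?thesis
    by (simp only: word_functional_abs free_eval_single scaleC_one linear_extension_single mult_1)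
qed

lemma word_functional_span_zero:
  assumes "u \<in> complex_vs.span A" "\<And>a. a \<in> A \<Longrightarrow> word_functional \<chi> \<phi> a = 0"
  shows "word_functional \<chi> \<phi> u = 0"
proof -
  have "complex_vs.subspace {u. word_functional \<chi> \<phi> u = 0}"
    using word_functional_linear(2)[of \<chi> \<phi> 0 0]
    by (simp add: complex_vs.subspace_def word_functional_linear)
  then show ?thesis
    using complex_vs.span_induct[OF assms(1), of "\<lambda>u. word_functional \<chi> \<phi> u = 0"] assms(2) by simp
qed

lemma word_functional_borel:
  assumes "\<And>g. g \<in> positive_gens \<Longrightarrow> \<chi> g = 0" and "g \<in> borel_gens"
  shows "word_functional \<chi> \<phi> (u * uea_gen g) = \<chi> g * word_functional \<chi> \<phi> u"
proof -
  let ?f = "\<lambda>u. word_functional \<chi> \<phi> (u * uea_gen g) - \<chi> g * word_functional \<chi> \<phi> u"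
  have "complex_vs.subspace {u. ?f u = 0}"
    using word_functional_linear(2)[of \<chi> \<phi> 0 0]
    by (simp add: complex_vs.subspace_def word_functional_linear distrib_right distrib_left scaleC_mult_left)
  moreover have "?f (word_eval w) = 0" for w
    using word_functional_word[of \<chi> \<phi> "w @ [g]"] straighten_append_borel[OF assms, where a = w and \<phi> = \<phi>]
    by (simp add: word_functional_word)
  ultimately have "?f u = 0"
    using complex_vs.span_induct[OF uea_span_words, of "\<lambda>u. ?f u = 0" u] by auto
  then show ?thesis
    by simp
qed

section \<open>The annihilator of the highest weight vector\<close>

text \<open>The left ideal of all \<open>u\<close> that kill the highest weight vector, the tensor
  of 1 with 1; the Verma module is the enveloping algebra modulo this ideal.\<close>

definition verma_ann :: "complex \<Rightarrow> complex \<Rightarrow> complex \<Rightarrow> complex \<Rightarrow> bms uea set"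
  where "verma_ann h1 h2 c1 c2 =
    {u. frag_of (u, 1) \<in> tensor_kernel borel_uea_incl (verma_char_act h1 h2 c1 c2)}"

lemma tensor_kernel_relators:
  "frag_of (u + v, z) - frag_of (u, z) - frag_of (v, z) \<in> tensor_kernel f act"
  "frag_of (u, y + z) - frag_of (u, y) - frag_of (u, z) \<in> tensor_kernel f act"
  "frag_of (u * f r, z) - frag_of (u, act r z) \<in> tensor_kernel f act"
  unfolding tensor_kernel_def by (rule generate.incl; unfold tensor_relators_def; blast)+

lemma tensor_kernel_diff:
  "x \<in> tensor_kernel f act \<Longrightarrow> y \<in> tensor_kernel f act \<Longrightarrow> x - y \<in> tensor_kernel f act"
  by (metis diff_conv_add_uminus tensor_kernel_closed(2,3))

lemma borel_uea_incl_of: "borel_uea_incl (uea_of x) = uea_of (borel_incl x)"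
  and borel_uea_incl_scalar: "borel_uea_incl (c *\<^sub>C 1) = c *\<^sub>C 1"
  by (simp_all add: borel_uea_incl_def uea_lift_hom[OF super_representation_borel_incl])

lemma verma_char_act_of: "verma_char_act h1 h2 c1 c2 (uea_of x) z = verma_char h1 h2 c1 c2 x * z"
  and verma_char_act_scalar: "verma_char_act h1 h2 c1 c2 (c *\<^sub>C 1) z = c * z"
  by (simp_all add: verma_char_act_def uea_lift_hom[OF super_representation_verma_char] scaleC_complex_def)

locale verma =
  fixes h1 h2 c1 c2 :: complex
begin

abbreviation "verma_kernel \<equiv> tensor_kernel borel_uea_incl (verma_char_act h1 h2 c1 c2)"
abbreviation "ann \<equiv> verma_ann h1 h2 c1 c2"

lemma verma_kernel_add: "frag_of (u + v, 1) - frag_of (u, 1) - frag_of (v, 1) \<in> verma_kernel"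
  by (rule tensor_kernel_relators)

lemma verma_ann_zero: "0 \<in> ann"
  using tensor_kernel_closed(3)[OF verma_kernel_add[of 0 0]] by (simp add: verma_ann_def)

lemma verma_ann_add: "u \<in> ann \<Longrightarrow> v \<in> ann \<Longrightarrow> u + v \<in> ann"
  using tensor_kernel_closed(2)[OF tensor_kernel_closed(2)[OF verma_kernel_add[of u v]],
      of "frag_of (u, 1)" "frag_of (v, 1)"]
  by (simp add: verma_ann_def)

lemma verma_ann_mult: "u \<in> ann \<Longrightarrow> a * u \<in> ann"
  using translate_tensor_kernel[of "frag_of (u, 1)" borel_uea_incl "verma_char_act h1 h2 c1 c2" a]
  by (simp add: verma_ann_def)

lemma verma_ann_scale: "u \<in> ann \<Longrightarrow> c *\<^sub>C u \<in> ann"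
  using verma_ann_mult[of u "c *\<^sub>C 1"] by (simp add: scaleC_mult_left)

lemma verma_ann_subspace: "complex_vs.subspace ann"
  by (simp add: complex_vs.subspace_def verma_ann_zero verma_ann_add verma_ann_scale)

lemma verma_kernel_diff_iff: "frag_of (u, 1) - frag_of (v, 1) \<in> verma_kernel \<longleftrightarrow> u - v \<in> ann"
proof -
  have *: "frag_of (u, 1) - frag_of (u - v, 1) - frag_of (v, 1) \<in> verma_kernel"
    using verma_kernel_add[of "u - v" v] by simp
  show ?thesis
  proof
    assume "frag_of (u, 1) - frag_of (v, 1) \<in> verma_kernel"
    from tensor_kernel_diff[OF this *] show "u - v \<in> ann"
      by (simp add: verma_ann_def algebra_simps)
  next
    assume "u - v \<in> ann"
    then have "frag_of (u - v, 1) \<in> verma_kernel"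
      by (simp add: verma_ann_def)
    from tensor_kernel_closed(2)[OF * this] show "frag_of (u, 1) - frag_of (v, 1) \<in> verma_kernel"
      by (simp add: algebra_simps)
  qed
qed

text \<open>Multiples of 1 belong to the enveloping algebra of the Borel subalgebra, so the
  balancing relation moves scalars across the tensor sign.\<close>

lemma verma_kernel_scalar: "frag_of (c *\<^sub>C u, 1) - frag_of (u, c) \<in> verma_kernel"
  using tensor_kernel_relators(3)[of u borel_uea_incl "c *\<^sub>C 1" 1 "verma_char_act h1 h2 c1 c2"]
  by (simp add: borel_uea_incl_scalar verma_char_act_scalar scaleC_mult_right)

lemma verma_ann_borel:
  assumes "g \<in> borel_gens"
  shows "uea_gen g - gen_char h1 h2 c1 c2 g *\<^sub>C 1 \<in> ann"
proof -
  let ?x = "Borel (bms_basis g)"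
  have x: "borel_incl ?x = bms_basis g"
    using assms by (intro Borel_inverse) (auto simp: support_iff coeff_gen split: if_splits)
  have "verma_char h1 h2 c1 c2 ?x = gen_char h1 h2 c1 c2 g"
    by (simp add: verma_char_def x coeff_gen gen_char_def)
  then have "frag_of (uea_gen g, 1) - frag_of (1, gen_char h1 h2 c1 c2 g) \<in> verma_kernel"
    using tensor_kernel_relators(3)[of 1 borel_uea_incl "uea_of ?x" 1 "verma_char_act h1 h2 c1 c2"]
    by (simp add: borel_uea_incl_of x verma_char_act_of)
  from tensor_kernel_diff[OF this verma_kernel_scalar[of "gen_char h1 h2 c1 c2 g" 1]]
  show ?thesis
    by (simp add: verma_kernel_diff_iff[symmetric])
qed

text \<open>The additive map \<open>\<Psi>\<close> sending the pair \<open>(u, z)\<close> to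
  \<open>z\<close> times the value at \<open>u\<close> respects the tensor relations. Balancing
  holds because right multiplication by an element of the Borel enveloping algebra multiplies the
  functional by its character, first for generators, then for words, then for all elements.\<close>

lemma word_functional_ann:
  assumes "u \<in> ann"
  shows "word_functional (gen_char h1 h2 c1 c2) \<phi> u = 0"
proof -
  let ?F = "word_functional (gen_char h1 h2 c1 c2) \<phi>"
  define \<Psi> where "\<Psi> x = (\<Sum>p \<in> Poly_Mapping.keys x. of_int (Poly_Mapping.lookup x p) * (snd p * ?F (fst p)))"
    for x :: "bms uea \<times> complex \<Rightarrow>\<^sub>0 int"
  have sup: "\<Psi> x = (\<Sum>p \<in> A. of_int (Poly_Mapping.lookup x p) * (snd p * ?F (fst p)))"
    if "finite A" "Poly_Mapping.keys x \<subseteq> A" for x A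
    unfolding \<Psi>_def using that by (intro sum.mono_neutral_left) (auto simp: in_keys_iff)
  have add: "\<Psi> (x + y) = \<Psi> x + \<Psi> y" for x y
    using keys_add[of x y] sup[of "Poly_Mapping.keys x \<union> Poly_Mapping.keys y"]
    by (simp add: lookup_add distrib_right sum.distrib)
  have zero: "\<Psi> 0 = 0"
    by (simp add: \<Psi>_def)
  have minus: "\<Psi> (- x) = - \<Psi> x" for x
    using add[of "- x" x] zero by (simp add: eq_neg_iff_add_eq_0)
  have diff: "\<Psi> (x - y) = \<Psi> x - \<Psi> y" for x y
    by (metis add minus diff_conv_add_uminus)
  have of: "\<Psi> (frag_of (u, z)) = z * ?F u" for u z
    by (simp add: \<Psi>_def)
  have act: "?F (u * borel_uea_incl r) = uea_lift (verma_char h1 h2 c1 c2) r * ?F u" for u r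
  proof -
    have F_sum: "?F (sum f A) = (\<Sum>g \<in> A. ?F (f g))" for f and A :: "bms_gen set"
      using word_functional_linear(2)[of "gen_char h1 h2 c1 c2" \<phi> 0 0]
      by (induction A rule: infinite_finite_induct) (simp_all add: word_functional_linear)
    note hom = uea_lift_hom[OF super_representation_borel_incl, folded borel_uea_incl_def]
      uea_lift_hom[OF super_representation_verma_char[of h1 h2 c1 c2]]
    have of': "?F (u * uea_of (borel_incl x)) = verma_char h1 h2 c1 c2 x * ?F u" for x u
    proof -
      have sub: "bms_support (borel_incl x) \<subseteq> borel_gens"
        using borel_incl by blast
      have "?F (u * uea_of (borel_incl x))
          = (\<Sum>g \<in> bms_support (borel_incl x). bms_coeff (borel_incl x) g * (gen_char h1 h2 c1 c2 g * ?F u))"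
        unfolding uea_of_expand[of "borel_incl x"] sum_distrib_left F_sum
        using word_functional_borel[OF gen_char_positive] sub
        by (intro sum.cong) (auto simp: scaleC_mult_right word_functional_linear)
      also have "\<dots> = (\<Sum>g \<in> bms_support (borel_incl x) \<union> cartan_gens.
          bms_coeff (borel_incl x) g * (gen_char h1 h2 c1 c2 g * ?F u))"
        by (intro sum.mono_neutral_left) (auto simp: support_iff cartan_gens_def)
      also have "\<dots> = (\<Sum>g \<in> cartan_gens. bms_coeff (borel_incl x) g * (gen_char h1 h2 c1 c2 g * ?F u))"
        using sub by (intro sum.mono_neutral_right) (auto simp: gen_char_positive cartan_gens_def)
      also have "\<dots> = verma_char h1 h2 c1 c2 x * ?F u"
        by (simp add: cartan_gens_def verma_char_def gen_char_def algebra_simps)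
      finally show ?thesis .
    qed
    have word: "?F (u * borel_uea_incl (prod_list (map uea_of w)))
        = uea_lift (verma_char h1 h2 c1 c2) (prod_list (map uea_of w)) * ?F u" for w u
    proof (induction w arbitrary: u)
      case (Cons x w)
      then show ?case
        by (simp add: hom of' mult.assoc[symmetric])
    qed (simp add: hom)
    show ?thesis
    proof (induct r)
      case (1 t)
      have zero: "abs_uea (0 :: bms_borel list \<Rightarrow>\<^sub>0 complex) = 0" "borel_uea_incl 0 = 0"
        "uea_lift (verma_char h1 h2 c1 c2) 0 = 0" "?F 0 = 0"
        using hom(5)[of 0 0] hom(10)[of 0 0] word_functional_linear(2)[of "gen_char h1 h2 c1 c2" \<phi> 0 0]
        by (simp_all flip: zero_uea_def)
      show ?case
        by (induction t rule: poly_mapping_keys_induct)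
          (use word in \<open>simp_all add: abs_uea_add abs_uea_single hom distrib_left distrib_right
            word_functional_linear scaleC_mult_right scaleC_complex_def mult.assoc zero\<close>)
    qed
  qed
  have "\<Psi> x = 0" if "x \<in> verma_kernel" for x
    using that unfolding tensor_kernel_def
  proof (induction rule: generate.induct)
    have rel: "\<Psi> h = 0" if "h \<in> tensor_relators borel_uea_incl (verma_char_act h1 h2 c1 c2)" for h
      using that unfolding tensor_relators_def
      by (auto simp: diff of word_functional_linear distrib_left distrib_right mult_ac act verma_char_act_def)
    {
      case (incl h)
      then show ?case by (rule rel)
    next
      case (inv h)
      then show ?case by (simp add: minus rel)
    }
  qed (simp_all add: zero add)
  then have "\<Psi> (frag_of (u, 1)) = 0"
    using assms by (simp add: verma_ann_def)
  then show ?thesis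
    by (simp add: of)
qed

lemma one_notin_verma_ann: "1 \<notin> ann"
proof
  assume "1 \<in> ann"
  then have "straighten (gen_char h1 h2 c1 c2) (\<lambda>_. 1) [] = 0"
    using word_functional_ann[of 1] word_functional_word[of _ _ "[]"] by simp
  then show False
    by (simp add: straighten_normal normal_word_def descent_def)
qed

text \<open>The cosets \<open>C u\<close> identify the module with the enveloping algebra modulo
  \<open>ann\<close>. It is nonzero and generated by the class of 1, so a submodule is everything as
  soon as it contains that class.\<close>

lemma simple_verma_iff:
  "simple_left_module (verma_group h1 h2 c1 c2) (verma_act h1 h2 c1 c2) \<longleftrightarrow>
    (\<forall>u. u \<notin> ann \<longrightarrow> (\<exists>a. a * u - 1 \<in> ann))"
proof -
  let ?F = "free_Abelian_group UNIV"
  define C where "C u = verma_kernel #>\<^bsub>?F\<^esub> frag_of (u, 1)" for u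
  let ?G = "verma_group h1 h2 c1 c2" and ?act = "verma_act h1 h2 c1 c2"
  have G: "?G = ?F Mod verma_kernel"
    by (simp add: verma_group_def induced_group_def)
  have eq: "C u = C v \<longleftrightarrow> u - v \<in> ann" for u v
    by (simp add: C_def r_coset_free_eq_iff verma_kernel_diff_iff)
  have one: "\<one>\<^bsub>?G\<^esub> = C 0"
  proof -
    have "verma_kernel #>\<^bsub>?F\<^esub> 0 = C 0"
      unfolding C_def r_coset_free_eq_iff using verma_ann_zero tensor_kernel_closed(3)
      by (force simp: verma_ann_def)
    then show ?thesis
      by (simp add: G r_coset_def)
  qed
  have act: "?act a (C u) = C (a * u)" for a u
    by (simp add: C_def verma_act_def induced_act_coset)
  have mult: "C u \<otimes>\<^bsub>?G\<^esub> C v = C (u + v)" for u v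
  proof -
    have "frag_of (u, 1) + frag_of (v, 1) - frag_of (u + v, 1) \<in> verma_kernel"
      using tensor_kernel_closed(3)[OF verma_kernel_add[of u v]] by (simp add: algebra_simps)
    then show ?thesis
      using normal.rcos_sum[OF tensor_kernel_normal, of "frag_of (u, 1)" "frag_of (v, 1)"
          borel_uea_incl "verma_char_act h1 h2 c1 c2"]
      by (simp add: G C_def r_coset_free_eq_iff)
  qed
  \<comment> \<open>The tensor of \<open>u\<close> with \<open>z\<close> equals that of
    \<open>z u\<close> with 1, and sums and differences of such tensors keep this shape.\<close>
  have carrier: "carrier ?G = range C"
  proof -
    have "\<exists>u. x - frag_of (u, 1) \<in> verma_kernel" for x
    proof (induction x rule: frag_induction[OF subset_UNIV, case_names zero one diff])
      case zero
      show ?case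
        using verma_ann_zero tensor_kernel_closed(3) by (force simp: verma_ann_def)
    next
      case (one p)
      obtain u z where "p = (u, z)"
        by (cases p)
      then show ?case
        using tensor_kernel_closed(3)[OF verma_kernel_scalar[of z u]] by auto
    next
      case (diff x y)
      then obtain u v where "x - frag_of (u, 1) \<in> verma_kernel" "y - frag_of (v, 1) \<in> verma_kernel"
        by blast
      from tensor_kernel_closed(2)[OF tensor_kernel_diff[OF this] verma_kernel_add[of "u - v" v]]
      have "x - y - frag_of (u - v, 1) \<in> verma_kernel"
        by (simp add: algebra_simps)
      then show ?case ..
    qed
    then show ?thesis
      unfolding G by (auto simp: carrier_FactGroup C_def r_coset_free_eq_iff image_iff)
  qed
  interpret left_module ?G ?act
    by (rule left_module_verma)
  have inv: "inv\<^bsub>?G\<^esub> (C u) = C (- u)" for u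
    by (rule inv_equality) (simp_all add: mult one carrier)
  show ?thesis
  proof
    assume simple: "simple_left_module ?G ?act"
    show "\<forall>u. u \<notin> ann \<longrightarrow> (\<exists>a. a * u - 1 \<in> ann)"
    proof (intro allI impI)
      fix u assume u: "u \<notin> ann"
      let ?W = "range (\<lambda>a. C (a * u))"
      have "subgroup ?W ?G"
      proof
        show "x \<otimes>\<^bsub>?G\<^esub> y \<in> ?W" if "x \<in> ?W" "y \<in> ?W" for x y
          using that by (auto simp: mult simp flip: distrib_right)
        show "\<one>\<^bsub>?G\<^esub> \<in> ?W"
          unfolding one by (rule range_eqI[of _ _ 0]) simp
        show "inv\<^bsub>?G\<^esub> x \<in> ?W" if "x \<in> ?W" for x
          using that by (auto simp: inv) (metis minus_mult_left rangeI)
      qed (auto simp: carrier)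
      then have "left_submodule ?G ?act ?W"
        by (auto simp: left_submodule_def act simp flip: mult.assoc)
      moreover have "?W \<noteq> {\<one>\<^bsub>?G\<^esub>}"
      proof
        assume "?W = {\<one>\<^bsub>?G\<^esub>}"
        then have "C (1 * u) = C 0"
          unfolding one by blast
        with u show False
          by (simp add: eq)
      qed
      ultimately have "?W = carrier ?G"
        using simple by (auto simp: simple_left_module_def)
      then have "C 1 \<in> ?W"
        unfolding carrier by blast
      then obtain a where "C 1 = C (a * u)"
        by blast
      then have "a * u - 1 \<in> ann"
        using eq[of "a * u" 1] by simp
      then show "\<exists>a. a * u - 1 \<in> ann" ..
    qed
  next
    assume *: "\<forall>u. u \<notin> ann \<longrightarrow> (\<exists>a. a * u - 1 \<in> ann)"
    have "W = carrier ?G" if W: "left_submodule ?G ?act W" and "W \<noteq> {\<one>\<^bsub>?G\<^esub>}" for W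
    proof -
      have "subgroup W ?G" and W_act: "\<And>a w. w \<in> W \<Longrightarrow> ?act a w \<in> W"
        using W by (auto simp: left_submodule_def)
      then have "\<one>\<^bsub>?G\<^esub> \<in> W" "W \<subseteq> carrier ?G"
        by (auto dest: subgroup.one_closed subgroup.subset)
      then obtain u where u: "C u \<in> W" "C u \<noteq> C 0"
        using \<open>W \<noteq> _\<close> unfolding one carrier by blast
      then obtain a where "a * u - 1 \<in> ann"
        using * eq[of u 0] by auto
      then have "C (a * u) = C 1"
        by (simp add: eq)
      then have "C 1 \<in> W"
        using W_act[OF u(1), of a] by (simp add: act)
      then have "C b \<in> W" for b
        using W_act[of "C 1" b] by (simp add: act)
      then show ?thesis
        using \<open>W \<subseteq> carrier ?G\<close> by (auto simp: carrier)
    qed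
    moreover have "carrier ?G \<noteq> {\<one>\<^bsub>?G\<^esub>}"
    proof
      assume "carrier ?G = {\<one>\<^bsub>?G\<^esub>}"
      then have "C 1 = C 0"
        unfolding one carrier by blast
      then show False
        using one_notin_verma_ann by (simp add: eq)
    qed
    ultimately show "simple_left_module ?G ?act"
      using left_module_verma by (auto simp: simple_left_module_def)
  qed
qed

section \<open>Calculus modulo the annihilator\<close>

text \<open>\<open>u\<close> and \<open>v\<close> send the highest weight vector to the same vector.
  Since \<open>ann\<close> is a left ideal, this is compatible with multiplication from the
  left.\<close>

definition eqv :: "bms uea \<Rightarrow> bms uea \<Rightarrow> bool" (infix "\<simeq>" 50)
  where "u \<simeq> v \<longleftrightarrow> u - v \<in> ann"

lemma eqv_refl [simp, intro!]: "u \<simeq> u"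
  by (simp add: eqv_def verma_ann_zero)

lemma eqv_zero_iff: "u \<simeq> 0 \<longleftrightarrow> u \<in> ann"
  by (simp add: eqv_def)

lemma eqv_scale: "u \<simeq> v \<Longrightarrow> c *\<^sub>C u \<simeq> c *\<^sub>C v"
  unfolding eqv_def
  by (metis diff_conv_add_uminus scaleC_add_right scaleC_uminus_right verma_ann_scale)

lemma eqv_mult: "u \<simeq> v \<Longrightarrow> a * u \<simeq> a * v"
  unfolding eqv_def by (metis right_diff_distrib verma_ann_mult)

lemma eqv_add: "u \<simeq> v \<Longrightarrow> u' \<simeq> v' \<Longrightarrow> u + u' \<simeq> v + v'"
  unfolding eqv_def using verma_ann_add[of "u - v" "u' - v'"] by (simp add: algebra_simps)

lemma eqv_sym: "u \<simeq> v \<Longrightarrow> v \<simeq> u"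
  using eqv_scale[of u v "- 1"] eqv_add[of "- u" "- v" "u + v" "u + v"]
  by (simp add: scaleC_uminus_left scaleC_one)

lemma eqv_trans [trans]: "u \<simeq> v \<Longrightarrow> v \<simeq> w \<Longrightarrow> u \<simeq> w"
  using eqv_add[of u v v w] eqv_add[of "u + v" "v + w" "- v" "- v"] by (simp add: algebra_simps)

lemma eqv_sum: "(\<And>i. i \<in> A \<Longrightarrow> f i \<simeq> g i) \<Longrightarrow> sum f A \<simeq> sum g A"
  by (induction A rule: infinite_finite_induct) (auto intro: eqv_add)

lemma eqv_ann: "u \<simeq> v \<Longrightarrow> u \<in> ann \<longleftrightarrow> v \<in> ann"
  using eqv_trans eqv_sym unfolding eqv_zero_iff[symmetric] by blast

lemma eqv_borel: "g \<in> borel_gens \<Longrightarrow> uea_gen g \<simeq> gen_char h1 h2 c1 c2 g *\<^sub>C 1"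
  unfolding eqv_def by (rule verma_ann_borel)

text \<open>In lists of natural numbers, \<open>a\<close> stands for \<open>L\<^bsub>-a\<^esub>\<close> or \<open>M\<^bsub>-a\<^esub>\<close>, and \<open>j\<close> for
  \<open>Q\<^bsub>-j-1/2\<^esub>\<close>.\<close>

abbreviation L :: "int \<Rightarrow> bms uea" where "L n \<equiv> uea_gen (Lgen n)"
abbreviation M :: "int \<Rightarrow> bms uea" where "M n \<equiv> uea_gen (Mgen n)"
abbreviation Q :: "int \<Rightarrow> bms uea" where "Q k \<equiv> uea_gen (Qgen k)"
abbreviation C2 :: "bms uea" where "C2 \<equiv> uea_gen C2gen"

definition L_word :: "nat list \<Rightarrow> bms uea"
  where "L_word as = prod_list (map (\<lambda>a. L (- int a)) as)"
definition Q_word :: "nat list \<Rightarrow> bms uea"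
  where "Q_word js = prod_list (map (\<lambda>j. Q (- 1 - int j)) js)"
definition M_word :: "nat list \<Rightarrow> bms uea"
  where "M_word as = prod_list (map (\<lambda>a. M (- int a)) as)"

lemma words_simps [simp]:
  "L_word [] = 1" "L_word (a # as) = L (- int a) * L_word as"
  "Q_word [] = 1" "Q_word (a # as) = Q (- 1 - int a) * Q_word as"
  "M_word [] = 1" "M_word (a # as) = M (- int a) * M_word as"
  by (simp_all add: L_word_def Q_word_def M_word_def)

section \<open>Normal words span the Verma module\<close>

definition partitions :: "nat list set"
  where "partitions = {as. sorted_wrt (\<ge>) as \<and> (\<forall>a \<in> set as. a > 0)}"
definition strict_lists :: "nat list set"
  where "strict_lists = {js. sorted_wrt (>) js}"

lemma normal_word_sorted:
  assumes "\<And>i. \<not> descent w i"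
  shows "sorted_wrt (\<lambda>x y. \<not> inverted x y) w"
proof -
  have "transp (\<lambda>x y. \<not> inverted x y)"
    by (auto simp: transp_def inverted_def not_less)
  then show ?thesis
    using assms by (auto simp: sorted_wrt_iff_nth_Suc_transp descent_def)
qed

lemma normal_word_cases:
  assumes "normal_word w"
  obtains as js bs where "as \<in> partitions" "js \<in> strict_lists" "bs \<in> partitions"
    "w = map (\<lambda>a. Lgen (- int a)) as @ map (\<lambda>j. Qgen (- 1 - int j)) js @ map (\<lambda>b. Mgen (- int b)) bs"
proof -
  have "sorted_wrt (\<lambda>x y. \<not> inverted x y) w" "set w \<inter> borel_gens = {}"
    using assms normal_word_sorted by (auto simp: normal_word_def)
  then have "\<exists>as js bs. as \<in> partitions \<and> js \<in> strict_lists \<and> bs \<in> partitions \<and>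
    w = map (\<lambda>a. Lgen (- int a)) as @ map (\<lambda>j. Qgen (- 1 - int j)) js @ map (\<lambda>b. Mgen (- int b)) bs"
  proof (induction w)
    case Nil
    show ?case
      by (rule exI[of _ "[]"])+ (simp add: partitions_def strict_lists_def)
  next
    case (Cons g w)
    then obtain as js bs where IH: "as \<in> partitions" "js \<in> strict_lists" "bs \<in> partitions"
      and w: "w = map (\<lambda>a. Lgen (- int a)) as @ map (\<lambda>j. Qgen (- 1 - int j)) js @ map (\<lambda>b. Mgen (- int b)) bs"
      by auto
    have le: "\<not> inverted g h" if "h \<in> set w" for h
      using Cons.prems that by auto
    have g: "g \<notin> borel_gens"
      using Cons.prems by auto
    have Lw: "\<not> inverted g (Lgen (- int a))" if "a \<in> set as" for a
      by (rule le) (use that w in auto)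
    have Qw: "\<not> inverted g (Qgen (- 1 - int j))" if "j \<in> set js" for j
      by (rule le) (use that w in auto)
    have Mw: "\<not> inverted g (Mgen (- int b))" if "b \<in> set bs" for b
      by (rule le) (use that w in auto)
    note order = inverted_def less_bms_gen_def
    have pos: "a > 0" if "a \<in> set as \<union> set bs" for a
      using IH that by (auto simp: partitions_def)
    show ?case
    proof (cases g)
      case (Lgen n)
      with g have n: "n < 0"
        unfolding borel_gens_iff by (auto split: if_splits)
      then have "a \<le> nat (- n)" if "a \<in> set as" for a
        using Lw[OF that] that pos by (auto simp: order Lgen)
      then have "nat (- n) # as \<in> partitions"
        using IH n by (simp add: partitions_def)
      with IH n show ?thesis
        by (intro exI[of _ "nat (- n) # as"] exI[of _ js] exI[of _ bs]) (simp add: w Lgen)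
    next
      case (Qgen n)
      with g have n: "n < 0"
        unfolding borel_gens_iff by (auto split: if_splits)
      have as: "as = []"
        using Lw[of "hd as"] pos[of "hd as"] n unfolding Qgen by (cases as) (auto simp: order)
      have "j < nat (- n - 1)" if "j \<in> set js" for j
        using Qw[OF that] n by (auto simp: order Qgen)
      then have "nat (- n - 1) # js \<in> strict_lists"
        using IH by (simp add: strict_lists_def)
      with IH n as show ?thesis
        by (intro exI[of _ as] exI[of _ "nat (- n - 1) # js"] exI[of _ bs]) (simp add: w Qgen)
    next
      case (Mgen n)
      with g have n: "n < 0"
        unfolding borel_gens_iff by (auto split: if_splits)
      have as: "as = []"
        using Lw[of "hd as"] pos[of "hd as"] n unfolding Mgen by (cases as) (auto simp: order)
      have js: "js = []"
        using Qw[of "hd js"] n unfolding Mgen by (cases js) (auto simp: order)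
      have "b \<le> nat (- n)" if "b \<in> set bs" for b
        using Mw[OF that] that pos n by (auto simp: order Mgen)
      then have "nat (- n) # bs \<in> partitions"
        using IH n by (simp add: partitions_def)
      with IH n as js show ?thesis
        by (intro exI[of _ as] exI[of _ js] exI[of _ "nat (- n) # bs"]) (simp add: w Mgen)
    qed (use g in \<open>auto simp: cartan_gens_def\<close>)
  qed
  then show ?thesis
    using that by blast
qed

text \<open>Straightening inside the enveloping algebra moves Borel letters to the right, where
  \<open>u0\<close> absorbs them as an eigenvector. It is applied to the highest weight vector,
  \<open>u0 = 1\<close>, and to the singular vector.\<close>

lemma borel_span:
  assumes u0: "\<And>g. g \<in> borel_gens \<Longrightarrow> \<exists>c. uea_gen g * u0 \<simeq> c *\<^sub>C u0"
  shows "u * u0 \<in> complex_vs.span ((\<lambda>w. word_eval w * u0) ` Collect normal_word \<union> ann)"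
    (is "_ \<in> complex_vs.span ?B")
proof -
  have words: "word_eval w * u0 \<in> complex_vs.span ?B" for w
  proof (induction w rule: wf_induct_rule[OF wf_word_less])
    case (1 w)
    show ?case
    proof (cases "\<exists>i. descent w i")
      case True
      then obtain a x y b where w: "w = a @ x # y # b" and xy: "inverted x y"
        using descent_append by metis
      have "word_eval (a @ g # b) * u0 \<in> complex_vs.span ?B" for g
        by (rule 1) (simp add: w word_less_iff)
      then have bracket: "word_eval a * uea_of (gen_bracket x y) * word_eval b * u0 \<in> complex_vs.span ?B"
        by (simp add: uea_of_expand[of "gen_bracket x y"] sum_distrib_left sum_distrib_right scaleC_mult_left
            scaleC_mult_right complex_vs.span_sum complex_vs.span_scale mult.assoc)
      have eq: "word_eval w * u0 = koszul (gen_odd x) (gen_odd y) *\<^sub>C (word_eval (a @ y # x # b) * u0)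
          + word_eval a * uea_of (gen_bracket x y) * word_eval b * u0"
      proof -
        have "word_eval w * u0 = word_eval a * (uea_gen x * uea_gen y) * word_eval b * u0"
          by (simp add: w mult.assoc)
        then show ?thesis
          by (simp add: uea_gen_swap[of x y] distrib_left distrib_right scaleC_mult_left scaleC_mult_right mult.assoc)
      qed
      show ?thesis
      proof (cases "y < x")
        case True
        then have "word_eval (a @ y # x # b) * u0 \<in> complex_vs.span ?B"
          by (intro 1) (simp add: w word_less_iff inversions_swap)
        then show ?thesis
          unfolding eq using bracket by (intro complex_vs.span_add complex_vs.span_scale)
      next
        case False
        then have xy: "x = y" and odd: "koszul (gen_odd x) (gen_odd y) = - 1"
          using xy by (auto simp: inverted_def koszul_def)
        have double: "z + z = X" if "z = - z + X" for z X :: "bms uea"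
          using arg_cong[OF that, of "(+) z"] by simp
        have "word_eval w * u0 + word_eval w * u0 = word_eval a * uea_of (gen_bracket x y) * word_eval b * u0"
          using eq unfolding odd by (intro double) (simp only: w xy scaleC_uminus_left scaleC_one)
        then have "(1 / 2) *\<^sub>C (word_eval w * u0 + word_eval w * u0) \<in> complex_vs.span ?B"
          using bracket complex_vs.span_scale by metis
        moreover have "(1 / 2) *\<^sub>C (z + z) = z" for z :: "bms uea"
          by (simp add: scaleC_add_right scaleC_one flip: scaleC_add_left)
        ultimately show ?thesis
          by simp
      qed
    next
      case False
      show ?thesis
      proof (cases "normal_word w")
        case True
        then show ?thesis
          by (auto intro: complex_vs.span_base)
      next
        case not_normal: False
        then obtain g where g: "g \<in> set w" "g \<in> borel_gens"
          using False by (auto simp: normal_word_def)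
        then obtain a h where w: "w = a @ [h]"
          by (metis empty_iff list.set(1) rev_exhaust)
        have "sorted_wrt (\<lambda>x y. \<not> inverted x y) w"
          using False normal_word_sorted by blast
        then have "g \<le> h"
          using g by (auto simp: w sorted_wrt_append inverted_def not_less)
        then obtain c where "uea_gen h * u0 \<simeq> c *\<^sub>C u0"
          using u0 borel_gens_upward g(2) by blast
        then have "word_eval a * (uea_gen h * u0) \<simeq> word_eval a * (c *\<^sub>C u0)"
          by (rule eqv_mult)
        then have "word_eval w * u0 - c *\<^sub>C (word_eval a * u0) \<in> complex_vs.span ?B"
          by (auto intro: complex_vs.span_base simp: eqv_def w mult.assoc scaleC_mult_right)
        moreover have "c *\<^sub>C (word_eval a * u0) \<in> complex_vs.span ?B"
          by (intro complex_vs.span_scale 1) (simp add: w word_less_iff)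
        ultimately show ?thesis
          using complex_vs.span_add by fastforce
      qed
    qed
  qed
  show ?thesis
    by (rule span_mult_right[OF uea_span_words]) (use words in blast)
qed

lemma span_Un_ann:
  assumes "x \<in> complex_vs.span (f ` A \<union> ann)"
  obtains T c where "finite T" "T \<subseteq> A" "x \<simeq> (\<Sum>t \<in> T. c t *\<^sub>C f t)"
proof -
  have span_ann: "complex_vs.span ann = ann"
    using complex_vs.span_eq_iff verma_ann_subspace by blast
  then obtain y z where x: "x = y + z" "y \<in> complex_vs.span (f ` A)" "z \<in> ann"
    using assms unfolding complex_vs.span_Un span_ann by auto
  have "\<exists>T c. finite T \<and> T \<subseteq> A \<and> y = (\<Sum>t \<in> T. c t *\<^sub>C f t)"
    using x(2)
  proof (induction rule: complex_vs.span_induct_alt)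
    case base
    show ?case
      by (rule exI[of _ "{}"]) simp
  next
    case (step d v y)
    then obtain T c a where T: "finite T" "T \<subseteq> A" "y = (\<Sum>t \<in> T. c t *\<^sub>C f t)" and a: "a \<in> A" "v = f a"
      by blast
    let ?c = "\<lambda>t. (if t = a then d else 0) + (if t \<in> T then c t else 0)"
    have "(\<Sum>t \<in> insert a T. (if t = a then d else 0) *\<^sub>C f t) = d *\<^sub>C v"
      using sum.mono_neutral_right[of "insert a T" "{a}" "\<lambda>t. (if t = a then d else 0) *\<^sub>C f t"] T
      by (simp add: a)
    moreover have "(\<Sum>t \<in> insert a T. (if t \<in> T then c t else 0) *\<^sub>C f t) = y"
      unfolding T(3) using T(1) by (intro sum.mono_neutral_cong_right) auto
    ultimately have "d *\<^sub>C v + y = (\<Sum>t \<in> insert a T. ?c t *\<^sub>C f t)"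
      by (simp add: scaleC_add_left sum.distrib)
    then show ?case
      using T a by (intro exI[of _ "insert a T"] exI[of _ ?c]) auto
  qed
  then obtain T c where T: "finite T" "T \<subseteq> A" "y = (\<Sum>t \<in> T. c t *\<^sub>C f t)"
    by blast
  have "x \<simeq> (\<Sum>t \<in> T. c t *\<^sub>C f t)"
    using x T by (simp add: eqv_def)
  with T show ?thesis
    using that by blast
qed

lemma uea_expansion:
  obtains P c where "finite P" "P \<subseteq> partitions \<times> strict_lists \<times> partitions"
    "u \<simeq> (\<Sum>(as, js, bs) \<in> P. c (as, js, bs) *\<^sub>C (L_word as * (Q_word js * M_word bs)))"
proof -
  let ?f = "\<lambda>(as, js, bs). L_word as * (Q_word js * M_word bs)"
  have "word_eval w * 1 \<in> ?f ` (partitions \<times> strict_lists \<times> partitions)" if w: "normal_word w" for w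
  proof -
    have "word_eval (map (\<lambda>a. Lgen (- int a)) as) = L_word as"
      "word_eval (map (\<lambda>j. Qgen (- 1 - int j)) as) = Q_word as"
      "word_eval (map (\<lambda>a. Mgen (- int a)) as) = M_word as" for as
      by (simp_all add: word_eval_def L_word_def Q_word_def M_word_def comp_def)
    moreover obtain as js bs where "as \<in> partitions" "js \<in> strict_lists" "bs \<in> partitions"
      "w = map (\<lambda>a. Lgen (- int a)) as @ map (\<lambda>j. Qgen (- 1 - int j)) js @ map (\<lambda>b. Mgen (- int b)) bs"
      by (rule normal_word_cases[OF w])
    ultimately show ?thesis
      by (intro image_eqI[of _ _ "(as, js, bs)"]) simp_all
  qed
  then have "complex_vs.span ((\<lambda>w. word_eval w * 1) ` Collect normal_word \<union> ann)
      \<subseteq> complex_vs.span (?f ` (partitions \<times> strict_lists \<times> partitions) \<union> ann)"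
    by (intro complex_vs.span_mono) blast
  moreover have "u * 1 \<in> complex_vs.span ((\<lambda>w. word_eval w * 1) ` Collect normal_word \<union> ann)"
    by (rule borel_span) (metis eqv_borel mult.right_neutral)
  ultimately have "u \<in> complex_vs.span (?f ` (partitions \<times> strict_lists \<times> partitions) \<union> ann)"
    by auto
  then obtain T c where "finite T" "T \<subseteq> partitions \<times> strict_lists \<times> partitions" "u \<simeq> (\<Sum>t \<in> T. c t *\<^sub>C ?f t)"
    by (rule span_Un_ann)
  then show ?thesis
    by (intro that[of T c]) (simp_all add: case_prod_unfold)
qed

section \<open>Separating the monomials\<close>

definition factor :: "nat \<Rightarrow> complex"
  where "factor i = h2 + ((of_nat i)\<^sup>2 - 1) / 24 * c2"

section \<open>Moving positive letters past negative ones\<close>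

lemma commute_all:
  assumes "\<And>h. gen_bracket g h = 0" "\<not> gen_odd g"
  shows "uea_gen g * u = u * uea_gen g"
proof -
  have gen: "uea_gen g * uea_gen h = uea_gen h * uea_gen g" for h
    using uea_gen_swap[of g h] assms by (simp add: koszul_def scaleC_one uea_of_zero)
  have "uea_gen g * word_eval w = word_eval w * uea_gen g" for w
  proof (induction w)
    case (Cons h w)
    have "uea_gen g * word_eval (h # w) = uea_gen h * (uea_gen g * word_eval w)"
      by (simp add: gen flip: mult.assoc)
    then show ?case
      by (simp add: Cons mult.assoc)
  qed simp
  moreover have "complex_vs.subspace {u. uea_gen g * u = u * uea_gen g}"
    by (simp add: complex_vs.subspace_def distrib_left distrib_right scaleC_mult_left scaleC_mult_right)
  ultimately show ?thesis
    using complex_vs.span_induct[OF uea_span_words, of "\<lambda>u. uea_gen g * u = u * uea_gen g" u] by auto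
qed

lemma C2_commute: "C2 * u = u * C2"
  by (rule commute_all) simp_all

lemma C2_eqv: "C2 * u \<simeq> c2 *\<^sub>C u"
  using eqv_mult[OF eqv_borel[of C2gen], of u]
  by (simp add: C2_commute cartan_gens_def gen_char_def scaleC_mult_right)

lemma M_commute: "M m * M n = M n * M m" "M m * Q k = Q k * M m"
  using uea_gen_swap[of "Mgen m" "Mgen n"] uea_gen_swap[of "Mgen m" "Qgen k"]
  by (simp_all add: koszul_def scaleC_one uea_of_zero)

lemma M_left_commute: "M m * (M n * u) = M n * (M m * u)" "M m * (Q k * u) = Q k * (M m * u)"
  by (simp_all add: M_commute flip: mult.assoc)

lemma Q_M_word: "Q k * M_word bs = M_word bs * Q k"
  by (induction bs) (simp_all add: mult.assoc flip: M_left_commute(2))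

text \<open>The common value of \<open>[L_n, M_{-a}]\<close> and
  \<open>[M_n, L_{-a}]\<close>.\<close>

definition bracket_LM :: "nat \<Rightarrow> nat \<Rightarrow> bms uea"
  where "bracket_LM n a = of_nat (n + a) *\<^sub>C M (int n - int a)
    + (if n = a then (of_nat n ^ 3 - of_nat n) / 12 else 0) *\<^sub>C C2"

text \<open>The value of \<open>[Q_r, Q_{-s}]\<close> for \<open>r = k + 1/2\<close> and
  \<open>s = j + 1/2\<close>.\<close>

definition bracket_QQ :: "nat \<Rightarrow> nat \<Rightarrow> bms uea"
  where "bracket_QQ k j = 2 *\<^sub>C M (int k - int j)
    + (if k = j then ((of_nat k + 1 / 2)\<^sup>2 - 1 / 4) / 3 else 0) *\<^sub>C C2"

lemma L_M_swap: "L (int n) * M (- int a) = M (- int a) * L (int n) + bracket_LM n a"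
  using uea_gen_swap[of "Lgen (int n)" "Mgen (- int a)"]
  by (cases "n = a") (simp_all add: koszul_def scaleC_one uea_of_add uea_of_scale bracket_LM_def)

lemma M_L_swap: "M (int n) * L (- int a) = L (- int a) * M (int n) + bracket_LM n a"
proof -
  have "gen_bracket (Mgen (int n)) (Lgen (- int a)) = of_nat (n + a) *\<^sub>C bms_basis (Mgen (int n - int a))
      + (if n = a then (of_nat n ^ 3 - of_nat n) / 12 else 0) *\<^sub>C bms_basis C2gen"
    by (rule bms_eqI) (auto simp: coeff_gen field_simps)
  then have "uea_of (gen_bracket (Mgen (int n)) (Lgen (- int a))) = bracket_LM n a"
    by (simp only: uea_of_add uea_of_scale bracket_LM_def)
  then show ?thesis
    using uea_gen_swap[of "Mgen (int n)" "Lgen (- int a)"] by (simp add: koszul_def scaleC_one)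
qed

lemma Q_Q_swap: "Q (int k) * Q (- 1 - int j) = - (Q (- 1 - int j) * Q (int k)) + bracket_QQ k j"
  using uea_gen_swap[of "Qgen (int k)" "Qgen (- 1 - int j)"]
  by (cases "k = j") (simp_all add: koszul_def scaleC_one scaleC_uminus_left uea_of_add uea_of_scale bracket_QQ_def)

section \<open>Vectors on which the nonnegative M's act as on the highest weight vector\<close>

text \<open>Stable under all Q's and M's, since these commute with every M; it therefore contains
  whatever stands to the right of the L's in a normal monomial.\<close>

definition M_vacuum :: "bms uea set"
  where "M_vacuum = {s. M 0 * s \<simeq> h2 *\<^sub>C s \<and> (\<forall>n > 0. M (int n) * s \<simeq> 0)}"

lemma M_vacuumD: "s \<in> M_vacuum \<Longrightarrow> M 0 * s \<simeq> h2 *\<^sub>C s" "s \<in> M_vacuum \<Longrightarrow> n > 0 \<Longrightarrow> M (int n) * s \<simeq> 0"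
  by (simp_all add: M_vacuum_def)

lemma eqv_mult_zero: "u \<simeq> 0 \<Longrightarrow> a * u \<simeq> 0"
  using eqv_mult[of u 0 a] by simp

lemma M_vacuum_mult:
  assumes "s \<in> M_vacuum" "\<And>n. M n * (x * s) = x * (M n * s)"
  shows "x * s \<in> M_vacuum"
  using assms eqv_mult[of "M 0 * s" "h2 *\<^sub>C s" x] eqv_mult_zero
  by (simp add: M_vacuum_def scaleC_mult_right)

lemma M_vacuum_words:
  assumes "s \<in> M_vacuum"
  shows "M n * s \<in> M_vacuum" "Q k * s \<in> M_vacuum" "M_word as * s \<in> M_vacuum" "Q_word js * s \<in> M_vacuum"
proof -
  have M: "M n * s \<in> M_vacuum" "Q k * s \<in> M_vacuum" if "s \<in> M_vacuum" for s n k
    using that by (intro M_vacuum_mult; simp add: M_left_commute)+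
  show "M_word as * s \<in> M_vacuum"
    by (induction as) (simp_all add: M mult.assoc assms)
  show "Q_word js * s \<in> M_vacuum"
    by (induction js) (simp_all add: M mult.assoc assms)
  show "M n * s \<in> M_vacuum" "Q k * s \<in> M_vacuum"
    using assms by (rule M)+
qed

lemma M_vacuum_add: "s \<in> M_vacuum \<Longrightarrow> t \<in> M_vacuum \<Longrightarrow> s + t \<in> M_vacuum"
  using eqv_add[of "M 0 * s" "h2 *\<^sub>C s" "M 0 * t" "h2 *\<^sub>C t"] eqv_add[of _ 0 _ 0]
  by (simp add: M_vacuum_def distrib_left scaleC_add_right)

lemma M_vacuum_scale: "s \<in> M_vacuum \<Longrightarrow> c *\<^sub>C s \<in> M_vacuum"
  using M_vacuum_mult[of s "c *\<^sub>C 1"] by (simp add: scaleC_mult_left scaleC_mult_right)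

lemma M_vacuum_sum: "(\<And>i. i \<in> A \<Longrightarrow> f i \<in> M_vacuum) \<Longrightarrow> sum f A \<in> M_vacuum"
proof (induction A rule: infinite_finite_induct)
  case (insert i A)
  then show ?case
    by (simp add: M_vacuum_add)
qed (simp_all add: M_vacuum_def)

lemma eqv_vacuum_one: "g \<in> positive_gens \<Longrightarrow> uea_gen g * 1 \<simeq> 0"
  using eqv_borel[of g] gen_char_positive[of g] by simp

lemma M_vacuum_one: "1 \<in> M_vacuum"
  using eqv_borel[of "Mgen 0"] eqv_vacuum_one
  by (auto simp: M_vacuum_def gen_char_def cartan_gens_def positive_gens_def)

text \<open>For \<open>n = a\<close> the bracket is the scalar
  \<open>2 n h2 + (n^3 - n)/12 c2\<close>, which is \<open>2 n\<close> times
  \<open>factor n\<close>. For \<open>a < n\<close> it is a multiple of a positive M.\<close>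

lemma bracket_LM_vacuum:
  assumes "s \<in> M_vacuum" "a \<le> n"
  shows "bracket_LM n a * s \<simeq> (if n = a then 2 * of_nat n * factor n else 0) *\<^sub>C s"
proof (cases "n = a")
  case True
  have "bracket_LM n a * s = (2 * of_nat n) *\<^sub>C (M 0 * s) + ((of_nat n ^ 3 - of_nat n) / 12) *\<^sub>C (C2 * s)"
    using True by (simp add: bracket_LM_def distrib_right scaleC_mult_left)
  also have "\<dots> \<simeq> (2 * of_nat n) *\<^sub>C (h2 *\<^sub>C s) + ((of_nat n ^ 3 - of_nat n) / 12) *\<^sub>C (c2 *\<^sub>C s)"
    using assms by (intro eqv_add eqv_scale C2_eqv M_vacuumD)
  also have "\<dots> = (2 * of_nat n * factor n) *\<^sub>C s"
    by (simp add: scaleC_scaleC factor_def field_simps power2_eq_square power3_eq_cube flip: scaleC_add_left)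
  finally show ?thesis
    using True by simp
next
  case False
  then have "M (int (n - a)) * s \<simeq> 0"
    using assms by (intro M_vacuumD) auto
  then show ?thesis
    using False eqv_scale[of "M (int n - int a) * s" 0] assms
    by (simp add: bracket_LM_def scaleC_mult_left of_nat_diff)
qed

text \<open>With \<open>r = k + 1/2 = i/2\<close> the central coefficient
  \<open>(r^2 - 1/4)/3\<close> is \<open>(i^2 - 1)/12\<close>, so the odd letters contribute
  \<open>factor\<close> at the odd numbers \<open>i = 2 k + 1\<close>.\<close>

lemma bracket_QQ_vacuum:
  assumes "s \<in> M_vacuum" "j \<le> k"
  shows "bracket_QQ k j * s \<simeq> (if k = j then 2 * factor (2 * k + 1) else 0) *\<^sub>C s"
proof (cases "k = j")
  case True
  have "bracket_QQ k j * s = 2 *\<^sub>C (M 0 * s) + (((of_nat k + 1 / 2)\<^sup>2 - 1 / 4) / 3) *\<^sub>C (C2 * s)"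
    using True by (simp add: bracket_QQ_def distrib_right scaleC_mult_left)
  also have "\<dots> \<simeq> 2 *\<^sub>C (h2 *\<^sub>C s) + (((of_nat k + 1 / 2)\<^sup>2 - 1 / 4) / 3) *\<^sub>C (c2 *\<^sub>C s)"
    using assms by (intro eqv_add eqv_scale C2_eqv M_vacuumD)
  also have "\<dots> = (2 * factor (2 * k + 1)) *\<^sub>C s"
    by (simp add: scaleC_scaleC factor_def field_simps power2_eq_square flip: scaleC_add_left)
  finally show ?thesis
    using True by simp
next
  case False
  then have "M (int (k - j)) * s \<simeq> 0"
    using assms by (intro M_vacuumD) auto
  then show ?thesis
    using False eqv_scale[of "M (int k - int j) * s" 0] assms
    by (simp add: bracket_QQ_def scaleC_mult_left of_nat_diff)
qed

section \<open>Isolating one word of a combination\<close>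

text \<open>The element \<open>a\<close> and the constant \<open>c\<close> do not depend on
  \<open>s\<close>, so one \<open>a\<close> can be applied to a sum in which each word has its own
  coefficient vector.\<close>

definition separating :: "nat list set \<Rightarrow> (nat list \<Rightarrow> bms uea) \<Rightarrow> bms uea set \<Rightarrow> bool"
  where "separating I W S \<longleftrightarrow> (\<forall>\<Lambda>. finite \<Lambda> \<and> \<Lambda> \<noteq> {} \<and> \<Lambda> \<subseteq> I \<longrightarrow>
    (\<exists>\<nu>\<^sub>0 \<in> \<Lambda>. \<exists>a c. c \<noteq> 0 \<and> (\<forall>\<nu> \<in> \<Lambda>. \<forall>s \<in> S. a * (W \<nu> * s) \<simeq> (if \<nu> = \<nu>\<^sub>0 then c else 0) *\<^sub>C s)))"

text \<open>Words whose coefficient vector lies in \<open>ann\<close> are discarded first, which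
  guarantees that the isolated coefficient vector is nonzero in the module.\<close>

lemma separating_select:
  assumes "separating I W S" "finite \<Lambda>" "\<Lambda> \<subseteq> I" "\<And>\<nu>. \<nu> \<in> \<Lambda> \<Longrightarrow> s \<nu> \<in> S"
    and notin: "(\<Sum>\<nu> \<in> \<Lambda>. W \<nu> * s \<nu>) \<notin> ann"
  obtains a \<nu> where "\<nu> \<in> \<Lambda>" "s \<nu> \<notin> ann" "a * (\<Sum>\<nu> \<in> \<Lambda>. W \<nu> * s \<nu>) \<simeq> s \<nu>"
proof -
  define \<Lambda>' where "\<Lambda>' = {\<nu> \<in> \<Lambda>. s \<nu> \<notin> ann}"
  have nonempty: "\<Lambda>' \<noteq> {}"
  proof
    assume "\<Lambda>' = {}"
    then have "(\<Sum>\<nu> \<in> \<Lambda>. W \<nu> * s \<nu>) \<in> ann"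
      by (intro complex_vs.subspace_sum[OF verma_ann_subspace] verma_ann_mult) (auto simp: \<Lambda>'_def)
    with notin show False ..
  qed
  have "finite \<Lambda>'" "\<Lambda>' \<subseteq> I"
    using assms(2,3) by (auto simp: \<Lambda>'_def)
  with nonempty obtain \<nu>\<^sub>0 a c where \<nu>: "\<nu>\<^sub>0 \<in> \<Lambda>'" and c: "c \<noteq> 0"
    and sep: "\<And>\<nu> t. \<nu> \<in> \<Lambda>' \<Longrightarrow> t \<in> S \<Longrightarrow> a * (W \<nu> * t) \<simeq> (if \<nu> = \<nu>\<^sub>0 then c else 0) *\<^sub>C t"
    using assms(1)[unfolded separating_def, rule_format, of \<Lambda>'] by blast
  have "a * (W \<nu> * s \<nu>) \<simeq> (if \<nu> = \<nu>\<^sub>0 then c else 0) *\<^sub>C s \<nu>" if "\<nu> \<in> \<Lambda>" for \<nu>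
  proof (cases "\<nu> \<in> \<Lambda>'")
    case True
    then show ?thesis
      using sep assms(4) that by blast
  next
    case False
    then have "s \<nu> \<simeq> 0" "\<nu> \<noteq> \<nu>\<^sub>0"
      using that \<nu> by (auto simp: \<Lambda>'_def eqv_zero_iff)
    then show ?thesis
      by (simp add: eqv_mult_zero)
  qed
  then have "(\<Sum>\<nu> \<in> \<Lambda>. a * (W \<nu> * s \<nu>)) \<simeq> (\<Sum>\<nu> \<in> \<Lambda>. (if \<nu> = \<nu>\<^sub>0 then c else 0) *\<^sub>C s \<nu>)"
    by (rule eqv_sum)
  also have "\<dots> = (\<Sum>\<nu> \<in> {\<nu>\<^sub>0}. c *\<^sub>C s \<nu>)"
    using \<nu> assms(2) by (intro sum.mono_neutral_cong_right) (auto simp: \<Lambda>'_def)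
  finally have "(1 / c) *\<^sub>C (a * (\<Sum>\<nu> \<in> \<Lambda>. W \<nu> * s \<nu>)) \<simeq> (1 / c) *\<^sub>C (c *\<^sub>C s \<nu>\<^sub>0)"
    by (intro eqv_scale) (simp add: sum_distrib_left)
  then have "((1 / c) *\<^sub>C a) * (\<Sum>\<nu> \<in> \<Lambda>. W \<nu> * s \<nu>) \<simeq> s \<nu>\<^sub>0"
    using c by (simp add: scaleC_mult_left scaleC_scaleC scaleC_one)
  then show ?thesis
    using that \<nu> by (auto simp: \<Lambda>'_def)
qed

text \<open>If \<open>A k\<close> removes a leading letter \<open>k\<close> and kills the words in smaller letters, then
  the lexicographically greatest word can be isolated letter by letter.\<close>

lemma separating_peel:
  assumes Nil: "W [] = 1"
    and sorted: "\<And>\<nu>. \<nu> \<in> I \<Longrightarrow> sorted_wrt (\<ge>) \<nu>"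
    and Cons: "\<And>k \<nu>. k # \<nu> \<in> I \<Longrightarrow> \<nu> \<in> I"
    and nonzero: "\<And>k \<nu>. k # \<nu> \<in> I \<Longrightarrow> \<kappa> k \<noteq> 0"
    and peel: "\<And>k \<nu>\<^sub>0 \<nu> s. k # \<nu>\<^sub>0 \<in> I \<Longrightarrow> \<nu> \<in> I \<Longrightarrow> \<forall>j \<in> set \<nu>. j \<le> k \<Longrightarrow> s \<in> S \<Longrightarrow>
      A k * (W \<nu> * s) \<simeq> (of_nat (count_list \<nu> k) * \<kappa> k) *\<^sub>C (W (tl \<nu>) * s)"
  shows "separating I W S"
proof -
  have "\<exists>\<nu>\<^sub>0 \<in> \<Lambda>. \<exists>a c. c \<noteq> 0 \<and> (\<forall>\<nu> \<in> \<Lambda>. \<forall>s \<in> S. a * (W \<nu> * s) \<simeq> (if \<nu> = \<nu>\<^sub>0 then c else 0) *\<^sub>C s)"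
    if "finite \<Lambda>" "\<Lambda> \<noteq> {}" "\<Lambda> \<subseteq> I" "\<forall>\<nu> \<in> \<Lambda>. length \<nu> \<le> N" for \<Lambda> N
    using that
  proof (induction N arbitrary: \<Lambda>)
    case 0
    then have "\<Lambda> = {[]}"
      by auto
    then show ?case
      by (intro bexI[of _ "[]"] exI[of _ 1]) (simp_all add: Nil scaleC_one)
  next
    case (Suc N)
    show ?case
    proof (cases "\<Lambda> = {[]}")
      case True
      then show ?thesis
        by (intro bexI[of _ "[]"] exI[of _ 1]) (simp_all add: Nil scaleC_one)
    next
      case False
      define k where "k = Max (\<Union>\<nu> \<in> \<Lambda>. set \<nu>)"
      have fin: "finite (\<Union>\<nu> \<in> \<Lambda>. set \<nu>)"
        using Suc.prems by simp
      have "(\<Union>\<nu> \<in> \<Lambda>. set \<nu>) \<noteq> {}"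
        using False Suc.prems(2) by (auto simp: subset_singleton_iff)
      then have k: "k \<in> (\<Union>\<nu> \<in> \<Lambda>. set \<nu>)"
        using fin unfolding k_def by (rule Max_in[rotated])
      have le: "j \<le> k" if "\<nu> \<in> \<Lambda>" "j \<in> set \<nu>" for \<nu> j
        unfolding k_def using fin that by (intro Max_ge) auto
      have split: "\<nu> = k # tl \<nu>" if "\<nu> \<in> \<Lambda>" "k \<in> set \<nu>" for \<nu>
        using sorted[of \<nu>] that le[OF that(1)] Suc.prems(3) by (cases \<nu>) force+
      \<comment> \<open>The words that begin with the greatest letter \<open>k\<close>, with that
        letter removed; the other words do not contain \<open>k\<close> and are killed by
        \<open>A k\<close>.\<close>
      let ?\<Lambda>' = "(#) k -` \<Lambda>"
      have "\<exists>\<nu>\<^sub>0 \<in> ?\<Lambda>'. \<exists>a c. c \<noteq> 0 \<and>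
        (\<forall>\<nu> \<in> ?\<Lambda>'. \<forall>s \<in> S. a * (W \<nu> * s) \<simeq> (if \<nu> = \<nu>\<^sub>0 then c else 0) *\<^sub>C s)"
      proof (rule Suc.IH)
        show "finite ?\<Lambda>'"
          using Suc.prems by (intro finite_vimageI) auto
        show "?\<Lambda>' \<noteq> {}"
        proof -
          obtain \<nu> where "\<nu> \<in> \<Lambda>" "k \<in> set \<nu>"
            using k by blast
          then have "tl \<nu> \<in> ?\<Lambda>'"
            using split[of \<nu>] by simp
          then show ?thesis
            by blast
        qed
        show "?\<Lambda>' \<subseteq> I" "\<forall>\<nu> \<in> ?\<Lambda>'. length \<nu> \<le> N"
          using Suc.prems Cons by force+
      qed
      then obtain \<nu>\<^sub>0 a c where "\<nu>\<^sub>0 \<in> ?\<Lambda>'" and c: "c \<noteq> 0"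
        and IH: "\<forall>\<nu> \<in> ?\<Lambda>'. \<forall>s \<in> S. a * (W \<nu> * s) \<simeq> (if \<nu> = \<nu>\<^sub>0 then c else 0) *\<^sub>C s"
        by blast
      then have \<nu>: "k # \<nu>\<^sub>0 \<in> \<Lambda>"
        by simp
      let ?n = "\<lambda>\<nu>. of_nat (count_list \<nu> k) * \<kappa> k"
      have I: "k # \<nu>\<^sub>0 \<in> I"
        using \<nu> Suc.prems by blast
      show ?thesis
      proof (intro bexI[OF _ \<nu>] exI conjI ballI)
        have "of_nat (Suc (count_list \<nu>\<^sub>0 k)) \<noteq> (0 :: complex)"
          by (rule of_nat_neq_0)
        then show "?n (k # \<nu>\<^sub>0) * c \<noteq> 0"
          using c nonzero[OF I] by simp
        fix \<nu> s assume \<nu>s: "\<nu> \<in> \<Lambda>" "s \<in> S"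
        have "a * (A k * (W \<nu> * s)) \<simeq> a * (?n \<nu> *\<^sub>C (W (tl \<nu>) * s))"
          using peel[OF I] \<nu>s le Suc.prems by (intro eqv_mult) blast
        also have "\<dots> = ?n \<nu> *\<^sub>C (a * (W (tl \<nu>) * s))"
          by (simp add: scaleC_mult_right)
        also have "\<dots> \<simeq> (if \<nu> = k # \<nu>\<^sub>0 then ?n (k # \<nu>\<^sub>0) * c else 0) *\<^sub>C s"
        proof (cases "k \<in> set \<nu>")
          case True
          then have eq: "k # tl \<nu> = \<nu>"
            using split[OF \<nu>s(1)] by simp
          with \<nu>s have "a * (W (tl \<nu>) * s) \<simeq> (if tl \<nu> = \<nu>\<^sub>0 then c else 0) *\<^sub>C s"
            by (intro IH[rule_format]) simp_all
          then have "?n \<nu> *\<^sub>C (a * (W (tl \<nu>) * s)) \<simeq> ?n \<nu> *\<^sub>C ((if tl \<nu> = \<nu>\<^sub>0 then c else 0) *\<^sub>C s)"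
            by (rule eqv_scale)
          moreover have "\<nu> = k # \<nu>\<^sub>0 \<longleftrightarrow> tl \<nu> = \<nu>\<^sub>0"
            using eq by (metis list.sel(3))
          ultimately show ?thesis
            by (auto simp: scaleC_scaleC)
        next
          case False
          then show ?thesis
            by (auto simp: count_list_0_iff)
        qed
        finally show "(a * A k) * (W \<nu> * s) \<simeq> (if \<nu> = k # \<nu>\<^sub>0 then ?n (k # \<nu>\<^sub>0) * c else 0) *\<^sub>C s"
          by (simp add: mult.assoc)
      qed
    qed
  qed
  then show ?thesis
    unfolding separating_def by (metis finite_imageI Max_ge imageI)
qed

text \<open>\<open>L k\<close> acts on a product of M's by its brackets with the single factors,
  which are 0 for factors below \<open>k\<close> and the scalar \<open>2 k\<close> times
  \<open>factor k\<close> at \<open>k\<close>. As M's commute, each of the equal factors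
  \<open>k\<close> contributes the same word.\<close>

lemma separating_M_word:
  assumes "\<And>i. i > 0 \<Longrightarrow> factor i \<noteq> 0"
  shows "separating partitions M_word {s \<in> M_vacuum. \<forall>n > 0. L (int n) * s \<simeq> 0}"
proof (rule separating_peel[where A = "\<lambda>k. L (int k)" and \<kappa> = "\<lambda>k. 2 * of_nat k * factor k"])
  fix k :: nat and \<nu>\<^sub>0 \<nu> s
  assume k: "k # \<nu>\<^sub>0 \<in> partitions" and \<nu>: "\<nu> \<in> partitions" "\<forall>j \<in> set \<nu>. j \<le> k"
    and s: "s \<in> {s \<in> M_vacuum. \<forall>n > 0. L (int n) * s \<simeq> 0}"
  let ?\<kappa> = "2 * of_nat k * factor k"
  show "L (int k) * (M_word \<nu> * s) \<simeq> (of_nat (count_list \<nu> k) * ?\<kappa>) *\<^sub>C (M_word (tl \<nu>) * s)"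
    using \<nu>
  proof (induction \<nu>)
    case Nil
    then show ?case
      using s k by (simp add: partitions_def)
  next
    case (Cons a \<nu>)
    have \<nu>: "\<nu> \<in> partitions" and le: "\<forall>j \<in> set \<nu>. j \<le> a" "a \<le> k"
      using Cons.prems by (auto simp: partitions_def)
    have vac: "M_word \<nu> * s \<in> M_vacuum"
      using s by (simp add: M_vacuum_words)
    have "L (int k) * (M_word (a # \<nu>) * s)
        = M (- int a) * (L (int k) * (M_word \<nu> * s)) + bracket_LM k a * (M_word \<nu> * s)"
      by (simp add: L_M_swap distrib_right flip: mult.assoc)
    also have "\<dots> \<simeq> M (- int a) * ((of_nat (count_list \<nu> k) * ?\<kappa>) *\<^sub>C (M_word (tl \<nu>) * s))
        + (if k = a then ?\<kappa> else 0) *\<^sub>C (M_word \<nu> * s)"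
      using Cons.IH[OF \<nu>] Cons.prems(2) bracket_LM_vacuum[OF vac le(2)]
      by (intro eqv_add eqv_mult) simp_all
    also have "\<dots> = (of_nat (count_list (a # \<nu>) k) * ?\<kappa>) *\<^sub>C (M_word (tl (a # \<nu>)) * s)"
    proof (cases "k \<in> set \<nu>")
      case True
      then have "a = k" "\<nu> = k # tl \<nu>"
        using le \<nu> by (cases \<nu>; force simp: partitions_def)+
      then have "M (- int a) * (M_word (tl \<nu>) * s) = M_word \<nu> * s"
        by (metis words_simps(6) mult.assoc)
      then show ?thesis
        using \<open>a = k\<close> by (simp add: scaleC_mult_right algebra_simps scaleC_add_left)
    next
      case False
      then have "count_list \<nu> k = 0"
        by (simp add: count_list_0_iff)
      then show ?thesis
        by auto
    qed
    finally show ?case .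
  qed
qed (use assms in \<open>auto simp: partitions_def\<close>)

text \<open>A strict word with letters at most \<open>k\<close> contains \<open>k\<close> only as
  its first letter, and the bracket of \<open>Q k\<close> with a smaller letter is a positive M,
  which vanishes on the rest.\<close>

lemma separating_Q_word:
  assumes "\<And>i. i > 0 \<Longrightarrow> factor i \<noteq> 0"
  shows "separating strict_lists Q_word {s \<in> M_vacuum. \<forall>k. Q (int k) * s \<simeq> 0}"
proof (rule separating_peel[where A = "\<lambda>k. Q (int k)" and \<kappa> = "\<lambda>k. 2 * factor (2 * k + 1)"])
  fix k :: nat and \<nu>\<^sub>0 \<nu> s
  assume \<nu>: "\<nu> \<in> strict_lists" "\<forall>j \<in> set \<nu>. j \<le> k"
    and s: "s \<in> {s \<in> M_vacuum. \<forall>k. Q (int k) * s \<simeq> 0}"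
  let ?\<kappa> = "2 * factor (2 * k + 1)"
  show "Q (int k) * (Q_word \<nu> * s) \<simeq> (of_nat (count_list \<nu> k) * ?\<kappa>) *\<^sub>C (Q_word (tl \<nu>) * s)"
    using \<nu>
  proof (induction \<nu>)
    case Nil
    then show ?case
      using s by simp
  next
    case (Cons a \<nu>)
    have \<nu>: "\<nu> \<in> strict_lists" and le: "a \<le> k" and notin: "k \<notin> set \<nu>"
      using Cons.prems by (auto simp: strict_lists_def)
    have vac: "Q_word \<nu> * s \<in> M_vacuum"
      using s by (simp add: M_vacuum_words)
    have count: "count_list \<nu> k = 0"
      using notin by (simp add: count_list_0_iff)
    have zero: "Q (int k) * (Q_word \<nu> * s) \<simeq> 0"
      using Cons.IH[OF \<nu>] Cons.prems(2) by (simp add: count)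
    have "Q (int k) * (Q_word (a # \<nu>) * s)
        = (- Q (- 1 - int a)) * (Q (int k) * (Q_word \<nu> * s)) + bracket_QQ k a * (Q_word \<nu> * s)"
      by (simp add: Q_Q_swap distrib_right left_diff_distrib flip: mult.assoc)
    also have "\<dots> \<simeq> 0 + (if k = a then ?\<kappa> else 0) *\<^sub>C (Q_word \<nu> * s)"
      using bracket_QQ_vacuum[OF vac le] by (rule eqv_add[OF eqv_mult_zero[OF zero]])
    also have "\<dots> = (of_nat (count_list (a # \<nu>) k) * ?\<kappa>) *\<^sub>C (Q_word (tl (a # \<nu>)) * s)"
      using count by auto
    finally show ?case .
  qed
next
  show "sorted_wrt (\<ge>) \<nu>" if "\<nu> \<in> strict_lists" for \<nu>
    using that unfolding strict_lists_def by (auto intro: sorted_wrt_mono_rel[of _ "(>)"])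
qed (use assms in \<open>auto simp: strict_lists_def\<close>)

section \<open>Pairing words in positive M's with words in negative L's\<close>

definition M_pos_word :: "nat list \<Rightarrow> bms uea"
  where "M_pos_word ns = prod_list (map (\<lambda>n. M (int n)) ns)"

lemma M_pos_word_simps [simp]:
  "M_pos_word [] = 1" "M_pos_word (n # ns) = M (int n) * M_pos_word ns"
  by (simp_all add: M_pos_word_def)

lemma M_bracket_LM: "M m * bracket_LM n a = bracket_LM n a * M m"
  by (simp add: bracket_LM_def distrib_left distrib_right scaleC_mult_left scaleC_mult_right
      M_commute C2_commute)

lemma M_pos_word_L:
  "M_pos_word ns * L (- int a) = L (- int a) * M_pos_word ns
    + (\<Sum>i < length ns. bracket_LM (ns ! i) a * M_pos_word (take i ns @ drop (Suc i) ns))"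
proof (induction ns)
  case (Cons n ns)
  have "M_pos_word (n # ns) * L (- int a) = M (int n) * (M_pos_word ns * L (- int a))"
    by (simp add: mult.assoc)
  also have "\<dots> = M (int n) * L (- int a) * M_pos_word ns
      + (\<Sum>i < length ns. M (int n) * bracket_LM (ns ! i) a * M_pos_word (take i ns @ drop (Suc i) ns))"
    by (simp add: Cons distrib_left sum_distrib_left mult.assoc)
  also have "\<dots> = L (- int a) * M_pos_word (n # ns) + (bracket_LM n a * M_pos_word ns
      + (\<Sum>i < length ns. bracket_LM (ns ! i) a * (M (int n) * M_pos_word (take i ns @ drop (Suc i) ns))))"
    by (simp add: M_L_swap M_bracket_LM distrib_right mult.assoc add.assoc)
  finally show ?case
    by (simp add: sum.lessThan_Suc_shift del: sum.lessThan_Suc)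
qed simp

text \<open>Each L can use up at most one of the positive M's by a bracket, and M's commute; with
  more M's than L's, a positive M reaches \<open>s\<close>.\<close>

lemma M_pos_word_L_word_zero:
  assumes "length as < length ns" "\<forall>n \<in> set ns. n > 0" "s \<in> M_vacuum"
  shows "M_pos_word ns * (L_word as * s) \<simeq> 0"
  using assms(1,2)
proof (induction as arbitrary: ns)
  case Nil
  then obtain n ns' where ns: "ns = n # ns'"
    by (cases ns) auto
  have "M_pos_word ns' * s \<in> M_vacuum"
    by (induction ns') (simp_all add: assms(3) M_vacuum_words mult.assoc)
  then show ?case
    using Nil ns M_vacuumD(2)[of "M_pos_word ns' * s" n] by (simp add: mult.assoc)
next
  case (Cons a as)
  let ?w = "L_word as * s"
  have "bracket_LM (ns ! i) a * (M_pos_word (take i ns @ drop (Suc i) ns) * ?w) \<simeq> 0" if "i < length ns" for i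
    using Cons that by (intro eqv_mult_zero Cons.IH) (auto dest: in_set_takeD in_set_dropD)
  then have "(\<Sum>i < length ns. bracket_LM (ns ! i) a * (M_pos_word (take i ns @ drop (Suc i) ns) * ?w)) \<simeq> (\<Sum>i < length ns. 0)"
    by (intro eqv_sum) simp
  moreover have "L (- int a) * (M_pos_word ns * ?w) \<simeq> 0"
    using Cons by (intro eqv_mult_zero Cons.IH) auto
  moreover have "M_pos_word ns * (L_word (a # as) * s) = L (- int a) * (M_pos_word ns * ?w)
      + (\<Sum>i < length ns. bracket_LM (ns ! i) a * (M_pos_word (take i ns @ drop (Suc i) ns) * ?w))"
  proof -
    have "M_pos_word ns * (L_word (a # as) * s) = (M_pos_word ns * L (- int a)) * ?w"
      by (simp add: mult.assoc)
    then show ?thesis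
      unfolding M_pos_word_L by (simp add: distrib_right sum_distrib_right mult.assoc)
  qed
  ultimately show ?case
    using eqv_add[of _ 0 _ 0] by simp
qed

text \<open>The product over the distinct letters \<open>a\<close>, of multiplicity
  \<open>m\<close>, of \<open>m!\<close> times the \<open>m\<close>-th power of \<open>2 a\<close>
  times \<open>factor a\<close>.\<close>

fun pairing_const :: "nat list \<Rightarrow> complex" where
  "pairing_const [] = 1"
| "pairing_const (a # as) = of_nat (count_list (a # as) a) * (2 * of_nat a * factor a) * pairing_const as"

text \<open>As many M's as L's means that each L must consume one M. If \<open>M_n\<close> meets
  \<open>L_{-a}\<close> with \<open>n > a\<close>, the bracket is again a positive M, one too many
  for the remaining L's. If \<open>n < a\<close>, the remaining M's have larger sum than the
  remaining L's and cannot match them. Only \<open>n = a\<close> survives, with a scalar.\<close>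

lemma M_pos_word_L_word:
  assumes "length ns = length as" "sum_list as \<le> sum_list ns" "\<forall>n \<in> set ns. n > 0" "s \<in> M_vacuum"
  shows "M_pos_word ns * (L_word as * s) \<simeq> (if mset ns = mset as then pairing_const as else 0) *\<^sub>C s"
  using assms(1-3)
proof (induction as arbitrary: ns)
  case Nil
  then show ?case
    by (simp add: scaleC_one)
next
  case (Cons a as)
  let ?w = "L_word as * s" and ?\<kappa> = "2 * of_nat a * factor a"
  let ?del = "\<lambda>i. take i ns @ drop (Suc i) ns"
  let ?c = "if mset ns = mset (a # as) then pairing_const as else 0"
  have summand: "bracket_LM (ns ! i) a * (M_pos_word (?del i) * ?w) \<simeq> (if ns ! i = a then ?\<kappa> * ?c else 0) *\<^sub>C s"
    if i: "i < length ns" for i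
  proof -
    have ns: "ns = take i ns @ ns ! i # drop (Suc i) ns"
      using i by (rule id_take_nth_drop)
    have del: "length (?del i) = length as" "\<forall>n \<in> set (?del i). n > 0"
      using i Cons.prems by (auto dest: in_set_takeD in_set_dropD)
    have mset: "mset ns = add_mset (ns ! i) (mset (?del i))"
      by (subst (1) ns) simp
    have sum: "sum_list ns = ns ! i + sum_list (?del i)"
      using arg_cong[OF mset, of sum_mset] by (simp flip: sum_mset_sum_list)
    consider "ns ! i < a" | "ns ! i = a" | "a < ns ! i"
      by linarith
    then show ?thesis
    proof cases
      case 1
      then have "sum_list as < sum_list (?del i)"
        using sum Cons.prems by simp
      then have "mset (?del i) \<noteq> mset as"
        by (metis less_irrefl sum_mset_sum_list)
      then have "M_pos_word (?del i) * ?w \<simeq> 0"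
        using Cons.IH[OF del(1) _ del(2)] \<open>sum_list as < _\<close> by simp
      then show ?thesis
        using 1 by (simp add: eqv_mult_zero)
    next
      case 2
      then have "mset (?del i) = mset as \<longleftrightarrow> mset ns = mset (a # as)"
        using mset by simp
      then have "M_pos_word (?del i) * ?w \<simeq> ?c *\<^sub>C s"
        using Cons.IH[OF del(1) _ del(2)] 2 sum Cons.prems by simp
      then have "bracket_LM (ns ! i) a * (M_pos_word (?del i) * ?w) \<simeq> ?c *\<^sub>C (bracket_LM a a * s)"
        using 2 eqv_mult[of _ "?c *\<^sub>C s" "bracket_LM a a"] by (simp add: scaleC_mult_right)
      also have "\<dots> \<simeq> ?c *\<^sub>C (?\<kappa> *\<^sub>C s)"
        using bracket_LM_vacuum[OF assms(4), of a a] by (intro eqv_scale) simp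
      finally show ?thesis
        using 2 by (simp add: scaleC_scaleC mult_ac)
    next
      case 3
      \<comment> \<open>The bracket puts a positive M back, so there are again more M's than
        L's.\<close>
      have zero: "M_pos_word ((ns ! i - a) # ?del i) * ?w \<simeq> 0"
        using 3 del assms(4) by (intro M_pos_word_L_word_zero) auto
      have "bracket_LM (ns ! i) a = of_nat (ns ! i + a) *\<^sub>C M (int (ns ! i - a))"
        using 3 by (simp add: bracket_LM_def of_nat_diff)
      then show ?thesis
        using 3 eqv_scale[OF zero, of "of_nat (ns ! i + a)"] by (simp add: scaleC_mult_left mult.assoc)
    qed
  qed
  have "M_pos_word ns * (L_word (a # as) * s) = (M_pos_word ns * L (- int a)) * ?w"
    by (simp add: mult.assoc)
  also have "\<dots> = L (- int a) * (M_pos_word ns * ?w)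
      + (\<Sum>i < length ns. bracket_LM (ns ! i) a * (M_pos_word (?del i) * ?w))"
    unfolding M_pos_word_L by (simp add: distrib_right sum_distrib_right mult.assoc)
  also have "\<dots> \<simeq> 0 + (\<Sum>i < length ns. (if ns ! i = a then ?\<kappa> * ?c else 0) *\<^sub>C s)"
    using Cons.prems assms(4)
    by (intro eqv_add[OF eqv_mult_zero eqv_sum] M_pos_word_L_word_zero summand) auto
  also have "\<dots> = (of_nat (count_list ns a) * (?\<kappa> * ?c)) *\<^sub>C s"
  proof -
    have "(\<Sum>i < length ns. (if ns ! i = a then z else 0) *\<^sub>C s) = (of_nat (count_list ns a) * z) *\<^sub>C s" for z
      by (induction ns) (simp_all add: sum.lessThan_Suc_shift distrib_right scaleC_add_left
          del: sum.lessThan_Suc)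
    then show ?thesis
      by simp
  qed
  also have "\<dots> = (if mset ns = mset (a # as) then pairing_const (a # as) else 0) *\<^sub>C s"
  proof (cases "mset ns = mset (a # as)")
    case True
    then have "count_list ns a = count_list (a # as) a"
      by (metis count_mset)
    then show ?thesis
      using True by (simp add: mult_ac)
  qed simp
  finally show ?case .
qed

lemma partitions_eqI:
  assumes "as \<in> partitions" "bs \<in> partitions" "mset as = mset bs"
  shows "as = bs"
proof -
  have "sorted (rev as)" "sorted (rev bs)" "mset (rev as) = mset (rev bs)"
    using assms by (auto simp: partitions_def sorted_wrt_rev)
  then have "rev as = rev bs"
    by (metis properties_for_sort)
  then show ?thesis
    by simp
qed

text \<open>The L's do not commute, and the vector to the right of a leading L need not be killed by
  positive M's, so letters are not peeled one by one. Instead a word of greatest length and, among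
  those, of greatest sum is turned into positive M's: shorter words are killed, and words of the
  same length pair to 0 unless they agree.\<close>

lemma separating_L_word:
  assumes factor: "\<And>i. i > 0 \<Longrightarrow> factor i \<noteq> 0"
  shows "separating partitions L_word M_vacuum"
  unfolding separating_def
proof (intro allI impI; elim conjE)
  fix \<Lambda> :: "nat list set"
  assume \<Lambda>: "finite \<Lambda>" "\<Lambda> \<noteq> {}" "\<Lambda> \<subseteq> partitions"
  define N where "N = Max (length ` \<Lambda>)"
  have N: "length as \<le> N" if "as \<in> \<Lambda>" for as
    unfolding N_def using that \<Lambda> by simp
  let ?\<Lambda> = "{as \<in> \<Lambda>. length as = N}"
  have "N \<in> length ` \<Lambda>"
    unfolding N_def using \<Lambda> by (intro Max_in) auto
  then have "Max (sum_list ` ?\<Lambda>) \<in> sum_list ` ?\<Lambda>"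
    using \<Lambda> by (intro Max_in) auto
  then obtain ns where ns: "ns \<in> ?\<Lambda>" "Max (sum_list ` ?\<Lambda>) = sum_list ns"
    by blast
  have max: "sum_list as \<le> sum_list ns" if "as \<in> ?\<Lambda>" for as
    unfolding ns(2)[symmetric] using that \<Lambda> by (intro Max_ge) auto
  have pos: "\<forall>n \<in> set as. n > 0" if "as \<in> \<Lambda>" for as
    using that \<Lambda> by (auto simp: partitions_def)
  have const: "pairing_const as \<noteq> 0" if "\<forall>a \<in> set as. a > 0" for as
    using that
  proof (induction as)
    case (Cons a as)
    have "of_nat (Suc (count_list as a)) \<noteq> (0 :: complex)"
      by (rule of_nat_neq_0)
    with Cons factor show ?case
      by simp
  qed simp
  have "M_pos_word ns * (L_word as * s) \<simeq> (if as = ns then pairing_const ns else 0) *\<^sub>C s"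
    if as: "as \<in> \<Lambda>" and s: "s \<in> M_vacuum" for as s
  proof (cases "length as = N")
    case True
    have "mset ns = mset as \<longleftrightarrow> as = ns"
      using partitions_eqI as ns \<Lambda>(3) by blast
    then show ?thesis
      using M_pos_word_L_word[of ns as s] max[of as] pos[of ns] as s True ns by auto
  next
    case False
    then show ?thesis
      using M_pos_word_L_word_zero[of as ns s] N[OF as] pos[of ns] s ns by auto
  qed
  then show "\<exists>ns \<in> \<Lambda>. \<exists>a c. c \<noteq> 0 \<and>
      (\<forall>as \<in> \<Lambda>. \<forall>s \<in> M_vacuum. a * (L_word as * s) \<simeq> (if as = ns then c else 0) *\<^sub>C s)"
    using ns const[OF pos[of ns]] by blast
qed

section \<open>Descent from an arbitrary vector to the highest weight vector\<close>

lemma sum_fst_image: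
  assumes "finite P"
  shows "(\<Sum>p \<in> P. h p) = (\<Sum>i \<in> fst ` P. \<Sum>q \<in> Pair i -` P. h (i, q))"
proof -
  have "(\<Sum>p \<in> P. h p) = (\<Sum>p \<in> Sigma (fst ` P) (\<lambda>i. Pair i -` P). h p)"
    by (rule sum.cong) force+
  then show ?thesis
    using assms by (simp add: sum.Sigma finite_vimageI inj_on_def)
qed

lemma cyclic_if_factor_nonzero:
  assumes "\<And>i. i > 0 \<Longrightarrow> factor i \<noteq> 0" and u: "u \<notin> ann"
  shows "\<exists>a. a * u \<simeq> 1"
proof -
  obtain P c where P: "finite P" "P \<subseteq> partitions \<times> strict_lists \<times> partitions"
    and expand: "u \<simeq> (\<Sum>(as, js, bs) \<in> P. c (as, js, bs) *\<^sub>C (L_word as * (Q_word js * M_word bs)))"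
    by (rule uea_expansion)
  have Q_one: "L (int n) * 1 \<simeq> 0" "Q (int k) * 1 \<simeq> 0" if "n > 0" for n k
    using that eqv_vacuum_one[of "Lgen (int n)"] eqv_vacuum_one[of "Qgen (int k)"]
    by (auto simp: positive_gens_def)
  \<comment> \<open>\<open>m as js\<close> collects the M-words behind a given L-word and Q-word,
    and \<open>q as\<close> everything behind a given L-word. The scalar coefficients are placed
    last, as multiples of 1, so that all three stages have the shape required by
    \<open>separating_select\<close>.\<close>
  define m where "m as js = (\<Sum>bs \<in> Pair js -` (Pair as -` P). M_word bs * (c (as, js, bs) *\<^sub>C 1))" for as js
  define q where "q as = (\<Sum>js \<in> fst ` (Pair as -` P). Q_word js * m as js)" for as
  have fin: "finite (Pair as -` P)" "finite (Pair js -` (Pair as -` P))" for as js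
    using P by (simp_all add: finite_vimageI inj_on_def)
  have sub: "fst ` P \<subseteq> partitions" "fst ` (Pair as -` P) \<subseteq> strict_lists"
    "Pair js -` (Pair as -` P) \<subseteq> partitions" for as js
    using P(2) by auto
  have m: "m as js \<in> {s \<in> M_vacuum. \<forall>k. Q (int k) * s \<simeq> 0}" for as js
  proof -
    have "Q (int k) * (M_word bs * (d *\<^sub>C 1)) \<simeq> 0" for k bs d
      using eqv_scale[OF eqv_mult_zero[OF Q_one(2)[of 1 k]], of d "M_word bs"]
      by (simp add: scaleC_mult_right Q_M_word)
    then have "(\<Sum>bs \<in> Pair js -` (Pair as -` P). Q (int k) * (M_word bs * (c (as, js, bs) *\<^sub>C 1)))
        \<simeq> (\<Sum>bs \<in> Pair js -` (Pair as -` P). 0)" for k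
      by (rule eqv_sum)
    then have "Q (int k) * m as js \<simeq> 0" for k
      by (simp add: m_def sum_distrib_left)
    moreover have "m as js \<in> M_vacuum"
      unfolding m_def by (intro M_vacuum_sum M_vacuum_words M_vacuum_scale M_vacuum_one)
    ultimately show ?thesis
      by simp
  qed
  have q: "q as \<in> M_vacuum" for as
    unfolding q_def using m by (intro M_vacuum_sum M_vacuum_words) simp
  have u_eq: "u \<simeq> (\<Sum>as \<in> fst ` P. L_word as * q as)"
  proof -
    have "(\<Sum>(as, js, bs) \<in> P. c (as, js, bs) *\<^sub>C (L_word as * (Q_word js * M_word bs)))
        = (\<Sum>as \<in> fst ` P. L_word as * q as)"
      using P(1) fin by (simp add: sum_fst_image[of P] sum_fst_image[of "Pair _ -` P"] q_def m_def
          sum_distrib_left scaleC_mult_right)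
    then show ?thesis
      using expand by simp
  qed
  with u have notin: "(\<Sum>as \<in> fst ` P. L_word as * q as) \<notin> ann"
    using eqv_ann by blast
  obtain a1 as where 1: "as \<in> fst ` P" "q as \<notin> ann" "a1 * (\<Sum>as \<in> fst ` P. L_word as * q as) \<simeq> q as"
    by (rule separating_select[where s = q, OF separating_L_word[OF assms(1)] finite_imageI[OF P(1)] sub(1) q notin])
  have u1: "a1 * u \<simeq> q as"
    using eqv_trans[OF eqv_mult[OF u_eq] 1(3)] .
  obtain a2 js where 2: "js \<in> fst ` (Pair as -` P)" "m as js \<notin> ann" "a2 * q as \<simeq> m as js"
    unfolding q_def
    by (rule separating_select[where s = "m as", OF separating_Q_word[OF assms(1)] finite_imageI[OF fin(1)]
          sub(2) m 1(2)[unfolded q_def]])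
  have scalar: "d *\<^sub>C 1 \<in> {s \<in> M_vacuum. \<forall>n > 0. L (int n) * s \<simeq> 0}" for d
  proof -
    have "L (int n) * (d *\<^sub>C 1) \<simeq> 0" if "n > 0" for n
      using eqv_scale[OF Q_one(1)[OF that], of d] by (simp add: scaleC_mult_right)
    then show ?thesis
      using M_vacuum_scale[OF M_vacuum_one] by blast
  qed
  obtain a3 bs where 3: "c (as, js, bs) *\<^sub>C 1 \<notin> ann" "a3 * m as js \<simeq> c (as, js, bs) *\<^sub>C 1"
    unfolding m_def
    by (rule separating_select[where s = "\<lambda>bs. c (as, js, bs) *\<^sub>C 1",
          OF separating_M_word[OF assms(1)] fin(2) sub(3) scalar 2(2)[unfolded m_def]])
  have "a2 * (a1 * u) \<simeq> m as js"
    using eqv_trans[OF eqv_mult[OF u1] 2(3)] .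
  then have "a3 * (a2 * (a1 * u)) \<simeq> a3 * m as js"
    by (rule eqv_mult)
  also note 3(2)
  finally have "(1 / c (as, js, bs)) *\<^sub>C (a3 * (a2 * (a1 * u))) \<simeq> (1 / c (as, js, bs)) *\<^sub>C (c (as, js, bs) *\<^sub>C 1)"
    by (rule eqv_scale)
  moreover have "c (as, js, bs) \<noteq> 0"
    using 3(1) by (auto simp: verma_ann_zero)
  ultimately have "((1 / c (as, js, bs)) *\<^sub>C (a3 * a2 * a1)) * u \<simeq> 1"
    by (simp add: scaleC_scaleC scaleC_one scaleC_mult_left mult.assoc)
  then show ?thesis ..
qed

end

section \<open>A singular vector\<close>

text \<open>Rewriting never leaves \<open>W\<close>, and without Borel letters the character is
  never applied; the value is therefore a combination of values of \<open>\<phi>\<close> on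
  \<open>W\<close>.\<close>

lemma straighten_closed_zero:
  assumes "w \<in> W"
    and swap: "\<And>a x y b. a @ x # y # b \<in> W \<Longrightarrow> inverted x y \<Longrightarrow> a @ y # x # b \<in> W"
    and bracket: "\<And>a x y b g. a @ x # y # b \<in> W \<Longrightarrow> inverted x y \<Longrightarrow>
      g \<in> bms_support (gen_bracket x y) \<Longrightarrow> a @ g # b \<in> W"
    and borel: "\<And>w. w \<in> W \<Longrightarrow> set w \<inter> borel_gens = {}"
    and zero: "\<And>w. w \<in> W \<Longrightarrow> \<phi> w = 0"
  shows "straighten \<chi> \<phi> w = 0"
  using assms(1)
proof (induction w rule: wf_induct_rule[OF wf_word_less])
  case (1 w)
  show ?case
  proof (cases "\<exists>i. descent w i")
    case True
    then obtain a x y b where w: "w = a @ x # y # b" and xy: "inverted x y"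
      using descent_append by metis
    have "straighten \<chi> \<phi> (a @ g # b) = 0" if "g \<in> bms_support (gen_bracket x y)" for g
      using bracket[OF _ xy that] 1(2) by (intro 1(1)) (simp_all add: w word_less_iff)
    then have eq: "straighten \<chi> \<phi> w = koszul (gen_odd x) (gen_odd y) * straighten \<chi> \<phi> (a @ y # x # b)"
      using straighten_swap[of \<chi> \<phi> a x y b] by (simp add: w)
    show ?thesis
    proof (cases "y < x")
      case True
      then show ?thesis
        using 1 swap[OF _ xy] eq inversions_swap[OF True] by (simp add: w word_less_iff)
    next
      case False
      then show ?thesis
        using xy eq by (auto simp: w inverted_def koszul_def)
    qed
  next
    case False
    then show ?thesis
      using 1(2) borel zero by (simp add: straighten_normal normal_word_def)
  qed
qed

context verma
begin

text \<open>The coefficients \<open>S_m\<close> of a power series with \<open>S_0 = 1\<close> and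
  \<open>(c2/6) m (m - i) S_m\<close> equal to minus the sum of the \<open>M_{-k} S_{m-k}\<close>.
  At the resonance \<open>m = i\<close> division by zero gives the value 0, but
  \<open>singular_sum i i\<close> refers only to smaller \<open>m\<close>.\<close>

function singular_poly :: "nat \<Rightarrow> nat \<Rightarrow> bms uea" where
  "singular_poly i m = (if m = 0 then 1 else
    (- 6 / (c2 * of_nat m * (of_nat m - of_nat i))) *\<^sub>C
      (\<Sum>k = 1..m. M (- int k) * singular_poly i (m - k)))"
  by auto
termination
  by (relation "measure snd") auto

declare singular_poly.simps [simp del]

definition singular_sum :: "nat \<Rightarrow> nat \<Rightarrow> bms uea"
  where "singular_sum i m = (\<Sum>k = 1..m. M (- int k) * singular_poly i (m - k))"

lemma singular_poly_0 [simp]: "singular_poly i 0 = 1"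
  by (simp add: singular_poly.simps)

lemma singular_poly_eq:
  "m > 0 \<Longrightarrow> singular_poly i m = (- 6 / (c2 * of_nat m * (of_nat m - of_nat i))) *\<^sub>C singular_sum i m"
  by (subst singular_poly.simps) (simp add: singular_sum_def)

text \<open>The filtration of the polynomials in the negative M's by degree. Degree at least 1 keeps
  the singular vector away from constants; degree at least 2 isolates its linear term.\<close>

definition M_span :: "nat \<Rightarrow> bms uea set"
  where "M_span N = complex_vs.span {M_word bs |bs. N \<le> length bs \<and> (\<forall>b \<in> set bs. b > 0)}"

lemma M_word_in_span: "N \<le> length bs \<Longrightarrow> \<forall>b \<in> set bs. b > 0 \<Longrightarrow> M_word bs \<in> M_span N"
  unfolding M_span_def by (rule complex_vs.span_base) blast

lemma M_span_Suc:
  assumes "x \<in> M_span N" "k > 0"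
  shows "M (- int k) * x \<in> M_span (Suc N)"
  using assms(1) unfolding M_span_def
proof (rule span_mult_left)
  fix a assume "a \<in> {M_word bs |bs. N \<le> length bs \<and> (\<forall>b \<in> set bs. b > 0)}"
  then obtain bs where "a = M_word bs" "N \<le> length bs" "\<forall>b \<in> set bs. b > 0"
    by blast
  then have "M (- int k) * a = M_word (k # bs)" "M_word (k # bs) \<in> M_span (Suc N)"
    using assms(2) by (simp, intro M_word_in_span) auto
  then show "M (- int k) * a \<in> complex_vs.span {M_word bs |bs. Suc N \<le> length bs \<and> (\<forall>b \<in> set bs. b > 0)}"
    by (simp add: M_span_def)
qed

lemma M_span_mono: "N \<le> N' \<Longrightarrow> M_span N' \<subseteq> M_span N"
  unfolding M_span_def by (intro complex_vs.span_mono) auto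

lemma singular_poly_M_span: "singular_poly i m \<in> M_span (if m = 0 then 0 else 1)"
proof (induction m rule: less_induct)
  case (less m)
  show ?case
  proof (cases "m = 0")
    case True
    have "M_word [] \<in> M_span 0"
      by (rule M_word_in_span) simp_all
    then show ?thesis
      using True by simp
  next
    case False
    have "singular_poly i (m - k) \<in> M_span 0" if "k \<in> {1..m}" for k
      using less[of "m - k"] that M_span_mono[of 0 1] by (auto split: if_splits)
    then have "M (- int k) * singular_poly i (m - k) \<in> M_span 1" if "k \<in> {1..m}" for k
      using M_span_Suc[of _ 0 k] that by simp
    then have "c *\<^sub>C singular_sum i m \<in> M_span 1" for c
      unfolding singular_sum_def M_span_def by (intro complex_vs.span_scale complex_vs.span_sum)
    then show ?thesis
      using False by (simp only: singular_poly_eq if_False)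
  qed
qed

lemma singular_sum_M_span: "singular_sum i m \<in> M_span 1"
proof -
  have "M (- int k) * singular_poly i (m - k) \<in> M_span 1" if "k \<in> {1..m}" for k
    using M_span_Suc[of "singular_poly i (m - k)" 0 k] that singular_poly_M_span[of i "m - k"] M_span_mono[of 0 1]
    by (auto split: if_splits)
  then show ?thesis
    unfolding singular_sum_def M_span_def by (rule complex_vs.span_sum)
qed

lemma M_span_vacuum:
  assumes "x \<in> M_span 0"
  shows "x \<in> M_vacuum" "Q (int k) * x \<simeq> 0"
proof -
  have "complex_vs.subspace M_vacuum"
    using M_vacuum_sum[of "{}"] by (simp add: complex_vs.subspace_def M_vacuum_add M_vacuum_scale)
  moreover have "M_word bs \<in> M_vacuum" for bs
    using M_vacuum_words(3)[OF M_vacuum_one, of bs] by simp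
  ultimately have "M_span 0 \<subseteq> M_vacuum"
    unfolding M_span_def by (intro complex_vs.span_minimal) auto
  then show "x \<in> M_vacuum"
    using assms by blast
  have "complex_vs.subspace {x. Q (int k) * x \<simeq> 0}"
    using eqv_add[of _ 0 _ 0] eqv_scale[of _ 0]
    by (simp add: complex_vs.subspace_def distrib_left scaleC_mult_right)
  moreover have "Q (int k) * M_word bs \<simeq> 0" for bs
    using eqv_mult_zero[OF eqv_vacuum_one[of "Qgen (int k)"], of "M_word bs"]
    by (simp add: Q_M_word positive_gens_def)
  ultimately have "M_span 0 \<subseteq> {x. Q (int k) * x \<simeq> 0}"
    unfolding M_span_def by (intro complex_vs.span_minimal) auto
  then show "Q (int k) * x \<simeq> 0"
    using assms by blast
qed

lemma singular_poly_vacuum: "singular_poly i m \<in> M_vacuum"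
  using singular_poly_M_span[of i m] M_span_mono[of 0 1] M_span_vacuum(1) by (auto split: if_splits)

lemma L_mult_singular_sum:
  "L (int n) * singular_sum i m = (\<Sum>k = 1..m. M (- int k) * (L (int n) * singular_poly i (m - k))
    + bracket_LM n k * singular_poly i (m - k))"
  unfolding singular_sum_def sum_distrib_left
  by (rule sum.cong) (simp_all add: L_M_swap distrib_right flip: mult.assoc)

lemma L0_singular:
  shows "L 0 * singular_poly i m \<simeq> (h1 + of_nat m) *\<^sub>C singular_poly i m"
    and "L 0 * singular_sum i m \<simeq> (h1 + of_nat m) *\<^sub>C singular_sum i m"
proof -
  have sum: "L 0 * singular_sum i m \<simeq> (h1 + of_nat m) *\<^sub>C singular_sum i m"
    if prev: "\<And>m'. m' < m \<Longrightarrow> L 0 * singular_poly i m' \<simeq> (h1 + of_nat m') *\<^sub>C singular_poly i m'" for m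
  proof -
    have "M (- int k) * (L 0 * singular_poly i (m - k)) + bracket_LM 0 k * singular_poly i (m - k)
        \<simeq> (h1 + of_nat m) *\<^sub>C (M (- int k) * singular_poly i (m - k))" if "k \<in> {1..m}" for k
    proof -
      have "M (- int k) * (L 0 * singular_poly i (m - k)) + bracket_LM 0 k * singular_poly i (m - k)
          \<simeq> M (- int k) * ((h1 + of_nat (m - k)) *\<^sub>C singular_poly i (m - k)) + bracket_LM 0 k * singular_poly i (m - k)"
        using that by (intro eqv_add eqv_mult prev) auto
      also have "\<dots> = (h1 + of_nat m) *\<^sub>C (M (- int k) * singular_poly i (m - k))"
        using that by (simp add: bracket_LM_def scaleC_mult_right scaleC_mult_left of_nat_diff flip: scaleC_add_left)
      finally show ?thesis .
    qed
    then have "L (int 0) * singular_sum i m \<simeq> (\<Sum>k = 1..m. (h1 + of_nat m) *\<^sub>C (M (- int k) * singular_poly i (m - k)))"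
      unfolding L_mult_singular_sum by (intro eqv_sum) simp
    then show ?thesis
      by (simp add: singular_sum_def scaleC_sum)
  qed
  have poly: "L 0 * singular_poly i m \<simeq> (h1 + of_nat m) *\<^sub>C singular_poly i m" for m
  proof (induction m rule: less_induct)
    case (less m)
    show ?case
    proof (cases "m = 0")
      case True
      then show ?thesis
        using eqv_borel[of "Lgen 0"] by (simp add: cartan_gens_def gen_char_def)
    next
      case False
      then obtain d where d: "singular_poly i m = d *\<^sub>C singular_sum i m"
        using singular_poly_eq by blast
      have "L 0 * singular_sum i m \<simeq> (h1 + of_nat m) *\<^sub>C singular_sum i m"
        using less by (rule sum)
      from eqv_scale[OF this, of d] show ?thesis
        by (simp add: d scaleC_mult_right scaleC_scaleC mult.commute)
    qed
  qed
  then show "L 0 * singular_poly i m \<simeq> (h1 + of_nat m) *\<^sub>C singular_poly i m"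
    "L 0 * singular_sum i m \<simeq> (h1 + of_nat m) *\<^sub>C singular_sum i m"
    by (auto intro: sum)
qed

text \<open>The generating function of the \<open>singular_poly i m\<close> satisfies a second order linear
  differential equation with potential \<open>\<Sum>\<^sub>k M\<^bsub>-k\<^esub> z\<^sup>k\<close> and exponents \<open>0\<close> and \<open>i\<close> at \<open>z = 0\<close>,
  and transforms as a density of weight \<open>-1/2\<close> under vector fields; \<open>singular_sum i i\<close> is the
  obstruction to solving the recursion at the resonant exponent.\<close>

lemma L_singular_sum:
  assumes factor: "factor i = 0" and n: "n > 0"
    and poly: "\<And>m'. m' < m \<Longrightarrow> L (int n) * singular_poly i m'
      \<simeq> (if n \<le> m' then of_nat m' - 3 / 2 * of_nat n - of_nat i / 2 else 0) *\<^sub>C singular_poly i (m' - n)"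
    and rec: "\<And>m'. m' < m \<Longrightarrow> singular_sum i m'
      = (- (c2 / 6) * of_nat m' * (of_nat m' - of_nat i)) *\<^sub>C singular_poly i m'"
  shows "L (int n) * singular_sum i m
    \<simeq> (if n \<le> m then - (c2 / 6) * of_nat m * (of_nat m - of_nat i)
        * (of_nat m - 3 / 2 * of_nat n - of_nat i / 2) else 0) *\<^sub>C singular_poly i (m - n)"
proof -
  let ?S = "singular_poly i" and ?d = "\<lambda>m'. of_nat m' - 3 / 2 * of_nat n - of_nat i / 2 :: complex"
  \<comment> \<open>\<open>?R1\<close> comes from the action of \<open>L n\<close> on the earlier
    coefficients, \<open>?R2\<close> from the brackets with \<open>k > n\<close>, which are negative
    M's, and \<open>?R3\<close> from the scalar bracket at \<open>k = n\<close>; the brackets with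
    \<open>k < n\<close> vanish.\<close>
  let ?R1 = "\<lambda>k. (if n + k \<le> m then ?d (m - k) else 0) *\<^sub>C (M (- int k) * ?S (m - n - k))"
  let ?R2 = "\<lambda>k. (if n < k then of_nat (n + k) else 0) *\<^sub>C (M (int n - int k) * ?S (m - k))"
  let ?R3 = "\<lambda>k. (if k = n then 2 * of_nat n * factor n else 0) *\<^sub>C ?S (m - n)"
  have "L (int n) * singular_sum i m \<simeq> (\<Sum>k = 1..m. ?R1 k + (?R2 k + ?R3 k))"
    unfolding L_mult_singular_sum
  proof (intro eqv_sum eqv_add)
    fix k assume k: "k \<in> {1..m}"
    have "M (- int k) * (L (int n) * ?S (m - k))
        \<simeq> M (- int k) * ((if n \<le> m - k then ?d (m - k) else 0) *\<^sub>C ?S (m - k - n))"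
      using k by (intro eqv_mult poly) auto
    also have "\<dots> = ?R1 k"
    proof -
      have "n \<le> m - k \<longleftrightarrow> n + k \<le> m" "m - k - n = m - n - k"
        using k by auto
      then show ?thesis
        by (simp add: scaleC_mult_right)
    qed
    finally show "M (- int k) * (L (int n) * ?S (m - k)) \<simeq> ?R1 k" .
    show "bracket_LM n k * ?S (m - k) \<simeq> ?R2 k + ?R3 k"
    proof (cases "k \<le> n")
      case True
      then show ?thesis
        using bracket_LM_vacuum[OF singular_poly_vacuum[of i "m - k"] True] by (cases "k = n") auto
    next
      case False
      then show ?thesis
        by (simp add: bracket_LM_def scaleC_mult_left)
    qed
  qed
  also have "\<dots> = (\<Sum>k = 1..m. ?R1 k) + ((\<Sum>k = 1..m. ?R2 k) + (\<Sum>k = 1..m. ?R3 k))"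
    by (simp add: sum.distrib)
  also have "\<dots> = (if n \<le> m then - (c2 / 6) * of_nat m * (of_nat m - of_nat i) * ?d m else 0) *\<^sub>C ?S (m - n)"
  proof (cases "n \<le> m")
    case False
    then have "(\<Sum>k = 1..m. ?R1 k) = 0" "(\<Sum>k = 1..m. ?R2 k) = 0" "(\<Sum>k = 1..m. ?R3 k) = 0"
      by (auto intro!: sum.neutral)
    then show ?thesis
      using False by simp
  next
    case True
    have 1: "(\<Sum>k = 1..m. ?R1 k) = (\<Sum>k = 1..m - n. ?d (m - k) *\<^sub>C (M (- int k) * ?S (m - n - k)))"
      using True by (intro sum.mono_neutral_cong_right) auto
    have "(\<Sum>k = 1..m. ?R2 k) = (\<Sum>k = 1 + n..m - n + n. of_nat (n + k) *\<^sub>C (M (int n - int k) * ?S (m - k)))"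
      using True by (intro sum.mono_neutral_cong_right) auto
    also have "\<dots> = (\<Sum>k = 1..m - n. of_nat (n + (k + n)) *\<^sub>C (M (int n - int (k + n)) * ?S (m - (k + n))))"
      by (rule sum.shift_bounds_cl_nat_ivl)
    also have "\<dots> = (\<Sum>k = 1..m - n. of_nat (2 * n + k) *\<^sub>C (M (- int k) * ?S (m - n - k)))"
      by (intro sum.cong) (auto simp: algebra_simps)
    finally have 2: "(\<Sum>k = 1..m. ?R2 k) = \<dots>" .
    have 3: "(\<Sum>k = 1..m. ?R3 k) = (2 * of_nat n * factor n) *\<^sub>C ?S (m - n)"
      using True n by (subst sum.mono_neutral_cong_right[of "{1..m}" "{n}"]) auto
    \<comment> \<open>After the shift of \<open>k\<close> by \<open>n\<close> the two coefficients
      add up to \<open>m + n/2 - i/2\<close>, which is independent of \<open>k\<close>, so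
      \<open>singular_sum i (m - n)\<close> reappears.\<close>
    have "(\<Sum>k = 1..m. ?R1 k) + (\<Sum>k = 1..m. ?R2 k)
        = (\<Sum>k = 1..m - n. (of_nat m + of_nat n / 2 - of_nat i / 2) *\<^sub>C (M (- int k) * ?S (m - n - k)))"
      unfolding 1 2 sum.distrib[symmetric] scaleC_add_left[symmetric]
      by (intro sum.cong) (auto simp: of_nat_diff)
    also have "\<dots> = (of_nat m + of_nat n / 2 - of_nat i / 2) *\<^sub>C singular_sum i (m - n)"
      by (simp add: singular_sum_def scaleC_sum)
    also have "\<dots> = ((of_nat m + of_nat n / 2 - of_nat i / 2)
        * (- (c2 / 6) * of_nat (m - n) * (of_nat (m - n) - of_nat i))) *\<^sub>C ?S (m - n)"
      using n True by (subst rec) (auto simp: scaleC_scaleC)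
    finally have 12: "(\<Sum>k = 1..m. ?R1 k) + (\<Sum>k = 1..m. ?R2 k) = \<dots>" .
    \<comment> \<open>The hypothesis \<open>factor i = 0\<close> eliminates \<open>h2\<close> and
      leaves a polynomial identity in \<open>m\<close>, \<open>n\<close>, \<open>i\<close> and
      \<open>c2\<close>.\<close>
    have "factor n = factor i + ((of_nat n)\<^sup>2 - (of_nat i)\<^sup>2) / 24 * c2"
      by (simp add: factor_def field_simps)
    then have "factor n = ((of_nat n)\<^sup>2 - (of_nat i)\<^sup>2) / 24 * c2"
      using factor by simp
    moreover have "(x + y / 2 - z / 2) * (- (c / 6) * (x - y) * (x - y - z)) + 2 * y * ((y\<^sup>2 - z\<^sup>2) / 24 * c)
        = - (c / 6) * x * (x - z) * (x - 3 / 2 * y - z / 2)" for x y z c :: complex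
      by (simp add: field_simps power2_eq_square)
    ultimately have "(of_nat m + of_nat n / 2 - of_nat i / 2) * (- (c2 / 6) * of_nat (m - n) * (of_nat (m - n) - of_nat i))
        + 2 * of_nat n * factor n = - (c2 / 6) * of_nat m * (of_nat m - of_nat i) * ?d m"
      using True by (simp only: of_nat_diff)
    then show ?thesis
      using True unfolding add.assoc[symmetric] 12 3 scaleC_add_left[symmetric] by simp
  qed
  finally show ?thesis .
qed

text \<open>Below the resonance the denominators do not vanish for positive \<open>m\<close>; if
  \<open>c2 = 0\<close>, then \<open>i = 1\<close> and only \<open>m = 0\<close> occurs.\<close>

lemma singular_sum_rec:
  assumes "c2 \<noteq> 0 \<or> i = 1" "m < i"
  shows "singular_sum i m = (- (c2 / 6) * of_nat m * (of_nat m - of_nat i)) *\<^sub>C singular_poly i m"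
proof (cases "m = 0")
  case True
  then show ?thesis
    by (simp add: singular_sum_def)
next
  case False
  have "(of_nat m :: complex) \<noteq> of_nat i"
    using assms(2) by simp
  then have "- (c2 / 6) * of_nat m * (of_nat m - of_nat i) * (- 6 / (c2 * of_nat m * (of_nat m - of_nat i))) = 1"
    using False assms by simp
  then show ?thesis
    using False by (simp only: singular_poly_eq scaleC_scaleC scaleC_one)
qed

lemma L_singular_poly:
  assumes "factor i = 0" "c2 \<noteq> 0 \<or> i = 1" "n > 0" "m < i"
  shows "L (int n) * singular_poly i m
    \<simeq> (if n \<le> m then of_nat m - 3 / 2 * of_nat n - of_nat i / 2 else 0) *\<^sub>C singular_poly i (m - n)"
  using assms(4)
proof (induction m rule: less_induct)
  case (less m)
  show ?case
  proof (cases "m = 0")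
    case True
    then show ?thesis
      using eqv_vacuum_one[of "Lgen (int n)"] assms(3) by (simp add: positive_gens_def)
  next
    case False
    let ?g = "- (c2 / 6) * of_nat m * (of_nat m - of_nat i)"
    let ?d = "if n \<le> m then of_nat m - 3 / 2 * of_nat n - of_nat i / 2 else 0"
    have "(of_nat m :: complex) \<noteq> of_nat i"
      using less.prems by simp
    then have g: "(- 6 / (c2 * of_nat m * (of_nat m - of_nat i))) * (?g * d) = d" for d
      using False assms(2) less.prems by simp
    have "L (int n) * singular_sum i m \<simeq> (?g * ?d) *\<^sub>C singular_poly i (m - n)"
      using L_singular_sum[OF assms(1,3), of m] less singular_sum_rec[OF assms(2)]
      by (simp split: if_splits)
    from eqv_scale[OF this, of "- 6 / (c2 * of_nat m * (of_nat m - of_nat i))"]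
    show ?thesis
      using False unfolding scaleC_scaleC g by (simp add: singular_poly_eq scaleC_mult_right)
  qed
qed

section \<open>The singular vector generates a proper nonzero submodule\<close>

text \<open>The linear term is \<open>M_{-i}\<close>, from \<open>k = i\<close>, and all other terms
  have degree at least 2 in the M's. Since the M's commute, straightening preserves this degree, so
  the functional reading off the word \<open>M_{-i}\<close> takes the value 1.\<close>

lemma singular_sum_notin_ann:
  assumes "i > 0"
  shows "singular_sum i i \<notin> ann"
proof
  assume in_ann: "singular_sum i i \<in> ann"
  define \<phi> where "\<phi> w = (if w = [Mgen (- int i)] then 1 else 0 :: complex)" for w
  let ?F = "word_functional (gen_char h1 h2 c1 c2) \<phi>"
  define W where "W = {w. 2 \<le> length w \<and> (\<forall>g \<in> set w. gen_rank g = 2)}"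
  have rank: "gen_rank g = 2 \<longleftrightarrow> (\<exists>n < 0. g = Mgen n)" for g
    by (cases g) auto
  have zero: "?F x = 0" if "x \<in> M_span 2" for x
    using that unfolding M_span_def
  proof (rule word_functional_span_zero)
    fix x assume "x \<in> {M_word bs |bs. 2 \<le> length bs \<and> (\<forall>b \<in> set bs. b > 0)}"
    then obtain bs where bs: "x = M_word bs" "2 \<le> length bs" "\<forall>b \<in> set bs. b > 0"
      by blast
    define w where "w = map (\<lambda>b. Mgen (- int b)) bs"
    have w: "w \<in> W" "x = word_eval w"
      using bs by (auto simp: W_def w_def M_word_def word_eval_def comp_def)
    have "straighten (gen_char h1 h2 c1 c2) \<phi> w = 0"
      using w(1)
    proof (rule straighten_closed_zero)
      show "a @ y # x # b \<in> W" if "a @ x # y # b \<in> W" for a x y b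
        using that by (auto simp: W_def)
      show "a @ g # b \<in> W" if "a @ x # y # b \<in> W" "g \<in> bms_support (gen_bracket x y)" for a x y b g
        using that by (auto simp: W_def rank support_iff)
      show "set w \<inter> borel_gens = {}" if "w \<in> W" for w
      proof -
        have "g \<notin> borel_gens" if "g \<in> set w" for g
          unfolding borel_gens_iff using that \<open>w \<in> W\<close> by (simp add: W_def)
        then show ?thesis
          by blast
      qed
      show "\<phi> w = 0" if "w \<in> W" for w
        using that by (auto simp: W_def \<phi>_def)
    qed
    then show "?F x = 0"
      by (simp add: w(2) word_functional_word)
  qed
  have "{1..i} = insert i {1..<i}"
    using assms by auto
  then have "singular_sum i i = M (- int i) + (\<Sum>k = 1..<i. M (- int k) * singular_poly i (i - k))"
    by (simp add: singular_sum_def)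
  moreover have "M (- int k) * singular_poly i (i - k) \<in> M_span 2" if "k \<in> {1..<i}" for k
    using M_span_Suc[of "singular_poly i (i - k)" 1 k] singular_poly_M_span[of i "i - k"] that
    by (simp add: numeral_2_eq_2)
  then have "(\<Sum>k = 1..<i. M (- int k) * singular_poly i (i - k)) \<in> M_span 2"
    unfolding M_span_def by (rule complex_vs.span_sum)
  ultimately have "?F (singular_sum i i) = ?F (word_eval [Mgen (- int i)])"
    using zero by (simp add: word_functional_linear)
  also have "\<dots> = 1"
  proof -
    have "normal_word [Mgen (- int i)]"
      using assms by (auto simp: normal_word_def descent_def cartan_gens_def positive_gens_def)
    then show ?thesis
      by (simp only: word_functional_word straighten_normal) (simp add: \<phi>_def)
  qed
  finally show False
    using word_functional_ann[OF in_ann] by simp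
qed

text \<open>At \<open>m = i\<close> the coefficient in \<open>L_singular_sum\<close> contains the
  factor \<open>m - i = 0\<close>, so the positive L's kill the vector. The positive M's and Q's
  kill every polynomial in the negative M's.\<close>

lemma borel_singular_sum:
  assumes "factor i = 0" "c2 \<noteq> 0 \<or> i = 1" "g \<in> borel_gens"
  shows "\<exists>c. uea_gen g * singular_sum i i \<simeq> c *\<^sub>C singular_sum i i"
proof -
  let ?u = "singular_sum i i"
  have u: "?u \<in> M_span 0"
    using singular_sum_M_span M_span_mono[of 0 1] by blast
  have zero: "\<exists>c. x \<simeq> c *\<^sub>C ?u" if "x \<simeq> 0" for x
    using that by (intro exI[of _ 0]) simp
  have L: "L (int n) * ?u \<simeq> 0" if "n > 0" for n
    using L_singular_sum[OF assms(1) that L_singular_poly[OF assms(1,2) that] singular_sum_rec[OF assms(2)], of i]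
    by (cases "n \<le> i") simp_all
  show ?thesis
  proof (cases g)
    case (Lgen n)
    then have "n \<ge> 0"
      using assms(3) by (auto simp: cartan_gens_def positive_gens_def)
    then obtain k where n: "n = int k"
      by (metis nonneg_int_cases)
    show ?thesis
    proof (cases "k = 0")
      case True
      then show ?thesis
        using L0_singular(2)[of i i] Lgen n by auto
    qed (use zero L Lgen n in simp)
  next
    case (Mgen n)
    then have "n \<ge> 0"
      using assms(3) by (auto simp: cartan_gens_def positive_gens_def)
    then obtain k where n: "n = int k"
      by (metis nonneg_int_cases)
    show ?thesis
    proof (cases "k = 0")
      case True
      then show ?thesis
        using M_vacuumD(1)[OF M_span_vacuum(1)[OF u]] Mgen n by auto
    qed (use zero M_vacuumD(2)[OF M_span_vacuum(1)[OF u]] Mgen n in simp)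
  next
    case (Qgen n)
    then have "n \<ge> 0"
      using assms(3) by (auto simp: cartan_gens_def positive_gens_def)
    then show ?thesis
      using zero M_span_vacuum(2)[OF u, of "nat n"] Qgen by simp
  next
    case C1gen
    have "uea_gen C1gen * ?u = ?u * uea_gen C1gen"
      by (rule commute_all) simp_all
    then have "uea_gen C1gen * ?u \<simeq> ?u * (gen_char h1 h2 c1 c2 C1gen *\<^sub>C 1)"
      using eqv_mult[OF eqv_borel[of C1gen]] by (simp add: cartan_gens_def)
    then show ?thesis
      using C1gen by (auto simp: scaleC_mult_right)
  next
    case C2gen
    then show ?thesis
      using C2_eqv by blast
  qed
qed

text \<open>As the Borel letters act on the singular vector by scalars, its submodule is spanned
  modulo \<open>ann\<close> by nonempty words in negative letters. The coefficient of the empty word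
  vanishes there but not at 1.\<close>

lemma not_cyclic_if_factor_zero:
  assumes "i > 0" "factor i = 0"
  shows "\<exists>u. u \<notin> ann \<and> (\<forall>a. \<not> a * u \<simeq> 1)"
proof -
  \<comment> \<open>For \<open>c2 = 0\<close> the recursion degenerates beyond \<open>j = 1\<close>;
    but then \<open>factor\<close> is the constant \<open>h2 = 0\<close>, so \<open>j = 1\<close> is
    available.\<close>
  obtain j where j: "j > 0" "factor j = 0" "c2 \<noteq> 0 \<or> j = 1"
  proof (cases "c2 = 0")
    case True
    then have "factor 1 = 0"
      using assms(2) True unfolding factor_def by simp
    then show ?thesis
      using that[of 1] by simp
  qed (use that assms in blast)
  let ?u = "singular_sum j j"
  define \<phi> where "\<phi> w = (if w = [] then 1 else 0 :: complex)" for w :: "bms_gen list"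
  let ?F = "word_functional (gen_char h1 h2 c1 c2) \<phi>"
  \<comment> \<open>Negative letters are closed under brackets, with no central term, so
    straightening a nonempty negative word yields only such words.\<close>
  have lower: "straighten (gen_char h1 h2 c1 c2) \<phi> w = 0" if "w \<noteq> []" "set w \<inter> borel_gens = {}" for w
  proof (rule straighten_closed_zero[of _ "{w. w \<noteq> [] \<and> set w \<inter> borel_gens = {}}"])
    fix a x y b g
    assume *: "a @ x # y # b \<in> {w. w \<noteq> [] \<and> set w \<inter> borel_gens = {}}" "g \<in> bms_support (gen_bracket x y)"
    then have "x \<notin> borel_gens" "y \<notin> borel_gens"
      by auto
    then have "g \<notin> borel_gens"
      using *(2) unfolding borel_gens_iff by (cases x; cases y) (auto simp: support_iff coeff_gen split: if_splits)
    with * show "a @ g # b \<in> {w. w \<noteq> [] \<and> set w \<inter> borel_gens = {}}"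
      by auto
  qed (use that in \<open>auto simp: \<phi>_def\<close>)
  have F_u: "?F (word_eval w * ?u) = 0" if "normal_word w" for w
  proof -
    have "word_eval w * ?u \<in> complex_vs.span {word_eval v |v. v \<noteq> [] \<and> set v \<inter> borel_gens = {}}"
      using singular_sum_M_span[of j j] unfolding M_span_def
    proof (rule span_mult_left)
      fix x assume "x \<in> {M_word bs |bs. 1 \<le> length bs \<and> (\<forall>b \<in> set bs. b > 0)}"
      then obtain bs where bs: "x = M_word bs" "1 \<le> length bs" "\<forall>b \<in> set bs. b > 0"
        by blast
      let ?v = "w @ map (\<lambda>b. Mgen (- int b)) bs"
      have "word_eval w * x = word_eval ?v"
        by (simp add: bs M_word_def word_eval_def comp_def)
      moreover have "?v \<noteq> []" "set ?v \<inter> borel_gens = {}"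
        using that bs by (auto simp: normal_word_def cartan_gens_def positive_gens_def)
      ultimately show "word_eval w * x \<in> complex_vs.span {word_eval v |v. v \<noteq> [] \<and> set v \<inter> borel_gens = {}}"
        by (metis (mono_tags, lifting) complex_vs.span_base mem_Collect_eq)
    qed
    then show ?thesis
      by (rule word_functional_span_zero) (auto simp: word_functional_word lower)
  qed
  have "\<not> a * ?u \<simeq> 1" for a
  proof
    assume "a * ?u \<simeq> 1"
    then have "?F (a * ?u + (- 1) *\<^sub>C 1) = 0"
      using word_functional_ann by (simp add: eqv_def scaleC_uminus_left scaleC_one)
    moreover have "?F (a * ?u) = 0"
      using borel_span[OF borel_singular_sum[OF j(2,3)]]
    proof (rule word_functional_span_zero)
      fix x assume "x \<in> (\<lambda>w. word_eval w * ?u) ` Collect normal_word \<union> ann"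
      then show "?F x = 0"
        using F_u word_functional_ann by auto
    qed
    ultimately have "?F (word_eval []) = 0"
      unfolding word_functional_linear by simp
    then show False
      unfolding word_functional_word by (simp add: straighten_normal normal_word_def descent_def \<phi>_def)
  qed
  then show ?thesis
    using singular_sum_notin_ann[OF j(1)] by blast
qed

end

theorem theorem3p2:
  fixes h1 h2 c1 c2 :: complex
  shows "simple_left_module (verma_group h1 h2 c1 c2) (verma_act h1 h2 c1 c2) \<longleftrightarrow>
    (\<forall>i::nat. i > 0 \<longrightarrow> h2 + ((of_nat i)\<^sup>2 - 1) / 24 * c2 \<noteq> 0)"
proof -
  interpret verma h1 h2 c1 c2 .
  show ?thesis
    unfolding simple_verma_iff factor_def[symmetric] eqv_def[symmetric]
    using cyclic_if_factor_nonzero not_cyclic_if_factor_zero by blast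
qed

end
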